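(* Let $\mu\in M(\mathbb{R}^{2d})$ and $S\in\mathcal{S}^p$ for $1\le p\le\infty$. Then $$\|\mu\star S\|_{\mathcal{S}^p}\le\|\mu\|_M\|S\|_{\mathcal{S}^p}.$$
   Context: For $z=(x,\omega)\in\mathbb{R}^{2d}$, $\pi(z)\psi(t)=e^{2\pi i\omega\cdot t}\psi(t-x)$ on $L^2(\mathbb{R}^d)$. $\mathcal{S}^p$, $1\le p<\infty$, is the Schatten $p$-class of operators on $L^2(\mathbb{R}^d)$ and $\mathcal{S}^\infty=\mathcal{L}(L^2(\mathbb{R}^d))$ with the operator norm. $M(\mathbb{R}^{2d})$ is the space of bounded complex measures with total variation norm $\|\mu\|_M=|\mu|(\mathbb{R}^{2d})$. The measure-operator convolution $\mu\star T$ of $\mu\in M(\mathbb{R}^{2d})$ and $T\in\mathcal{S}^\infty$ (hence for $T$ in any $\mathcal{S}^p$) is the bounded operator defined by duality: $\langle\mu\star T,R\rangle_{\mathcal{S}^\infty,\mathcal{S}^1}=\langle\mu,R\star\check T^*\rangle_{M,C_b}$ for all $R\in\mathcal{S}^1$, where $\langle A,B\rangle_{\mathcal{S}^\infty,\mathcal{S}^1}=\operatorname{tr}(AB^* )$, $\langle\mu,F\rangle_{M,C_b}=\int\overline{F}\,d\mu$, $\check T=PTP$ with $P\psi(t)=\psi(-t)$, and $A\star B(z)=\operatorname{tr}(A\,\pi(z)\check B\pi(z)^* )$; that is, $\operatorname{tr}((\mu\star T)R^* )=\int_{\mathbb{R}^{2d}}\operatorname{tr}(\pi(z)T\pi(z)^*R^*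 )\,d\mu(z)$. For $T\in\mathcal{S}^1$ this agrees with the extension to measures of the action $\delta_z\star T=\pi(z)T\pi(z)^*$. *)

theory Defs
  imports "HOL-Analysis.Analysis"
begin

definition square_integrable :: "(real ^ 'd \<Rightarrow> complex) \<Rightarrow> bool" where
  "square_integrable f \<longleftrightarrow>
     f \<in> borel_measurable borel \<and> integrable lborel (\<lambda>t. (cmod (f t))\<^sup>2)"

lemma square_integrable_zero: "square_integrable (\<lambda>t. 0)"
  by (simp add: square_integrable_def)

lemma square_integrable_mult_bounded:
  assumes "square_integrable f" "c \<in> borel_measurable borel" "\<And>t. cmod (c t) \<le> B"
  shows "square_integrable (\<lambda>t. c t * f t)"
proof -
  have [measurable]: "f \<in> borel_measurable borel" "c \<in> borel_measurable borel"
    using assms by (auto simp: square_integrable_def)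
  have "integrable lborel (\<lambda>t. B\<^sup>2 * (cmod (f t))\<^sup>2)"
    using assms by (simp add: square_integrable_def)
  then have "integrable lborel (\<lambda>t. (cmod (c t * f t))\<^sup>2)"
  proof (rule Bochner_Integration.integrable_bound)
    show "AE t in lborel. norm ((cmod (c t * f t))\<^sup>2) \<le> norm (B\<^sup>2 * (cmod (f t))\<^sup>2)"
      using assms(3)
      by (auto intro!: AE_I2 mult_right_mono power_mono simp: norm_mult power_mult_distrib)
  qed measurable
  then show ?thesis by (simp add: square_integrable_def)
qed

lemma square_integrable_cmult:
  assumes "square_integrable f"
  shows "square_integrable (\<lambda>t. c * f t)"
  using square_integrable_mult_bounded[OF assms, of "\<lambda>_. c" "cmod c"] by simp

lemma square_integrable_add:
  assumes "square_integrable f" "square_integrable g"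
  shows "square_integrable (\<lambda>t. f t + g t)"
proof -
  have [measurable]: "f \<in> borel_measurable borel" "g \<in> borel_measurable borel"
    using assms by (auto simp: square_integrable_def)
  have "integrable lborel (\<lambda>t. 2 * (cmod (f t))\<^sup>2 + 2 * (cmod (g t))\<^sup>2)"
    using assms by (simp add: square_integrable_def)
  then have "integrable lborel (\<lambda>t. (cmod (f t + g t))\<^sup>2)"
  proof (rule Bochner_Integration.integrable_bound)
    have "(cmod (a + b))\<^sup>2 \<le> 2 * (cmod a)\<^sup>2 + 2 * (cmod b)\<^sup>2" for a b
    proof -
      have "(cmod (a + b))\<^sup>2 \<le> (cmod a + cmod b)\<^sup>2"
        by (intro power_mono norm_triangle_ineq norm_ge_zero)
      also have "\<dots> \<le> 2 * (cmod a)\<^sup>2 + 2 * (cmod b)\<^sup>2"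
        using sum_squares_bound[of "cmod a" "cmod b"] by (simp add: power2_sum)
      finally show ?thesis .
    qed
    then show "AE t in lborel. norm ((cmod (f t + g t))\<^sup>2)
        \<le> norm (2 * (cmod (f t))\<^sup>2 + 2 * (cmod (g t))\<^sup>2)"
      by (intro AE_I2) simp
  qed measurable
  then show ?thesis by (simp add: square_integrable_def)
qed

lemma borel_measurable_cnj [measurable]: "cnj \<in> borel_measurable borel"
  by (intro borel_measurable_continuous_onI continuous_intros)

lemma square_integrable_inner:
  assumes "square_integrable f" "square_integrable g"
  shows "integrable lborel (\<lambda>t. f t * cnj (g t))"
proof -
  have [measurable]: "f \<in> borel_measurable borel" "g \<in> borel_measurable borel"
    using assms by (auto simp: square_integrable_def)
  have "integrable lborel (\<lambda>t. (cmod (f t))\<^sup>2 + (cmod (g t))\<^sup>2)"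
    using assms by (simp add: square_integrable_def)
  then show ?thesis
  proof (rule Bochner_Integration.integrable_bound)
    have "cmod a * cmod b \<le> (cmod a)\<^sup>2 + (cmod b)\<^sup>2" for a b
    proof -
      have "0 \<le> cmod a * cmod b" by simp
      then show ?thesis
        using sum_squares_bound[of "cmod a" "cmod b"] by linarith
    qed
    then show "AE t in lborel. norm (f t * cnj (g t)) \<le> norm ((cmod (f t))\<^sup>2 + (cmod (g t))\<^sup>2)"
      by (intro AE_I2) (simp add: norm_mult)
  qed measurable
qed

definition L2_rel :: "(real ^ 'd \<Rightarrow> complex) \<Rightarrow> (real ^ 'd \<Rightarrow> complex) \<Rightarrow> bool" where
  "L2_rel f g \<longleftrightarrow> square_integrable f \<and> square_integrable g \<and> (AE t in lborel. f t = g t)"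

lemma part_equivp_L2_rel: "part_equivp L2_rel"
proof (rule part_equivpI)
  show "\<exists>f. L2_rel f f"
    using square_integrable_zero by (auto simp: L2_rel_def)
  show "symp L2_rel"
    by (auto simp: L2_rel_def symp_def elim: AE_mp)
  show "transp L2_rel"
    by (auto simp: L2_rel_def transp_def elim: AE_mp)
qed

quotient_type 'd L2 = "real ^ 'd \<Rightarrow> complex" / partial: L2_rel
  by (rule part_equivp_L2_rel)


lemma lborel_distr_affine:
  assumes "\<bar>c\<bar> = 1"
  shows "distr lborel borel (\<lambda>t. a + c *\<^sub>R t) = (lborel :: (real ^ 'd) measure)"
proof -
  have "c \<noteq> 0" using assms by auto
  from lborel_affine[OF this, of a] show ?thesis
    using assms by (simp add: density_1)
qed

lemma square_integrable_comp_affine: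
  fixes f :: "real ^ 'd \<Rightarrow> complex"
  assumes "square_integrable f" "\<bar>c\<bar> = 1"
  shows "square_integrable (\<lambda>t. f (a + c *\<^sub>R t))"
proof -
  have [measurable]: "f \<in> borel_measurable borel"
    using assms by (simp add: square_integrable_def)
  have "integrable (distr lborel borel (\<lambda>t. a + c *\<^sub>R t)) (\<lambda>t. (cmod (f t))\<^sup>2)"
    using assms lborel_distr_affine[OF assms(2), of a] by (simp add: square_integrable_def)
  then show ?thesis
    by (subst (asm) integrable_distr_eq) (auto simp: square_integrable_def)
qed

lemma L2_rel_comp_affine:
  fixes f g :: "real ^ 'd \<Rightarrow> complex"
  assumes "L2_rel f g" "\<bar>c\<bar> = 1"
  shows "L2_rel (\<lambda>t. f (a + c *\<^sub>R t)) (\<lambda>t. g (a + c *\<^sub>R t))"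
proof -
  have [measurable]: "f \<in> borel_measurable borel" "g \<in> borel_measurable borel"
    using assms by (auto simp: L2_rel_def square_integrable_def)
  have "AE t in distr lborel borel (\<lambda>t. a + c *\<^sub>R t). f t = g t"
    using assms unfolding lborel_distr_affine[OF assms(2)] by (simp add: L2_rel_def)
  then have "AE t in lborel. f (a + c *\<^sub>R t) = g (a + c *\<^sub>R t)"
    by (subst (asm) AE_distr_iff) auto
  then show ?thesis
    using assms square_integrable_comp_affine by (auto simp: L2_rel_def)
qed

instantiation L2 :: (finite) real_vector
begin

lift_definition zero_L2 :: "'a L2" is "\<lambda>t. 0"
  by (simp add: L2_rel_def square_integrable_zero)

lift_definition plus_L2 :: "'a L2 \<Rightarrow> 'a L2 \<Rightarrow> 'a L2" is "\<lambda>f g t. f t + g t"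
  by (auto simp: L2_rel_def square_integrable_add)

lift_definition scaleR_L2 :: "real \<Rightarrow> 'a L2 \<Rightarrow> 'a L2" is "\<lambda>r f t. complex_of_real r * f t"
  by (auto simp: L2_rel_def square_integrable_cmult)

definition uminus_L2 :: "'a L2 \<Rightarrow> 'a L2" where "uminus_L2 f = (-1) *\<^sub>R f"

definition minus_L2 :: "'a L2 \<Rightarrow> 'a L2 \<Rightarrow> 'a L2" where "minus_L2 f g = f + - g"

instance
proof
  fix f g h :: "'a L2" and a b :: real
  show "f + g + h = f + (g + h)"
    by transfer (auto simp: L2_rel_def add.assoc square_integrable_add)
  show "f + g = g + f"
    by transfer (auto simp: L2_rel_def add.commute square_integrable_add)
  show "0 + f = f"
    by transfer (auto simp: L2_rel_def)
  show "- f + f = 0"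
    unfolding uminus_L2_def
    by transfer (auto simp: L2_rel_def square_integrable_zero)
  show "f - g = f + - g"
    by (simp add: minus_L2_def)
  show "a *\<^sub>R (f + g) = a *\<^sub>R f + a *\<^sub>R g"
    by transfer (auto simp: L2_rel_def distrib_left square_integrable_add square_integrable_cmult)
  show "(a + b) *\<^sub>R f = a *\<^sub>R f + b *\<^sub>R f"
    by transfer (auto simp: L2_rel_def distrib_right square_integrable_add square_integrable_cmult)
  show "a *\<^sub>R b *\<^sub>R f = (a * b) *\<^sub>R f"
    by transfer (auto simp: L2_rel_def mult.assoc square_integrable_cmult)
  show "1 *\<^sub>R f = f"
    by transfer (auto simp: L2_rel_def)
qed

end

lift_definition scaleC :: "complex \<Rightarrow> 'd::finite L2 \<Rightarrow> 'd L2" (infixr "*\<^sub>C" 75) is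
  "\<lambda>c f t. c * f t"
  by (auto simp: L2_rel_def square_integrable_cmult)

lift_definition cinner :: "'d::finite L2 \<Rightarrow> 'd L2 \<Rightarrow> complex" is
  "\<lambda>f g. \<integral>t. f t * cnj (g t) \<partial>lborel"
  subgoal premises prems for f1 f2 g1 g2
  proof (rule integral_cong_AE)
    have [measurable]: "f1 \<in> borel_measurable borel" "f2 \<in> borel_measurable borel"
      "g1 \<in> borel_measurable borel" "g2 \<in> borel_measurable borel"
      using prems by (auto simp: L2_rel_def square_integrable_def)
    show "(\<lambda>t. f1 t * cnj (g1 t)) \<in> borel_measurable lborel"
      "(\<lambda>t. f2 t * cnj (g2 t)) \<in> borel_measurable lborel"
      by measurable
    show "AE t in lborel. f1 t * cnj (g1 t) = f2 t * cnj (g2 t)"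
      using prems by (auto simp: L2_rel_def)
  qed
  done

lemma cinner_add_left: "cinner (f + g) h = cinner f h + cinner g h"
  by transfer (auto simp: L2_rel_def distrib_right square_integrable_inner)

lemma cinner_scaleC_left: "cinner (c *\<^sub>C f) g = c * cinner f g"
  by transfer (auto simp: L2_rel_def mult.assoc)

lemma cinner_commute: "cinner g f = cnj (cinner f g)"
proof transfer
  fix f g :: "real ^ 'd \<Rightarrow> complex"
  have "(\<lambda>t. g t * cnj (f t)) = (\<lambda>t. cnj (f t * cnj (g t)))"
    by (simp add: mult.commute)
  then show "(\<integral>t. g t * cnj (f t) \<partial>lborel) = cnj (\<integral>t. f t * cnj (g t) \<partial>lborel)"
    by (simp only: Bochner_Integration.integral_cnj)
qed

lemma scaleR_scaleC: "r *\<^sub>R f = complex_of_real r *\<^sub>C f"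
  by transfer (auto simp: L2_rel_def square_integrable_cmult)

lemma cinner_self: "\<exists>r\<ge>0. cinner f f = complex_of_real r \<and> (r = 0 \<longleftrightarrow> f = 0)"
proof transfer
  fix f :: "real ^ 'd \<Rightarrow> complex"
  assume "L2_rel f f"
  then have f: "square_integrable f" by (simp add: L2_rel_def)
  let ?r = "\<integral>t. (cmod (f t))\<^sup>2 \<partial>lborel"
  have "(\<integral>t. f t * cnj (f t) \<partial>lborel) = complex_of_real ?r"
    unfolding complex_norm_square[symmetric] by (rule integral_complex_of_real)
  moreover have "?r \<ge> 0" by simp
  moreover have "?r = 0 \<longleftrightarrow> L2_rel f (\<lambda>t. 0)"
    using f by (subst integral_nonneg_eq_0_iff_AE)
      (auto simp: square_integrable_def L2_rel_def square_integrable_zero)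
  ultimately show "\<exists>r\<ge>0. (\<integral>t. f t * cnj (f t) \<partial>lborel) = complex_of_real r \<and>
      (r = 0 \<longleftrightarrow> L2_rel f (\<lambda>t. 0))"
    by blast
qed

instantiation L2 :: (finite) real_inner
begin

definition inner_L2 :: "'a L2 \<Rightarrow> 'a L2 \<Rightarrow> real" where
  "inner_L2 f g = Re (cinner f g)"

definition norm_L2 :: "'a L2 \<Rightarrow> real" where
  "norm_L2 f = sqrt (inner f f)"

definition sgn_L2 :: "'a L2 \<Rightarrow> 'a L2" where
  "sgn_L2 f = inverse (norm f) *\<^sub>R f"

definition dist_L2 :: "'a L2 \<Rightarrow> 'a L2 \<Rightarrow> real" where
  "dist_L2 f g = norm (f - g)"

definition uniformity_L2 :: "('a L2 \<times> 'a L2) filter" where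
  "uniformity_L2 = (INF e\<in>{0<..}. principal {(x, y). dist x y < e})"

definition open_L2 :: "'a L2 set \<Rightarrow> bool" where
  "open_L2 U \<longleftrightarrow> (\<forall>x\<in>U. eventually (\<lambda>(x', y). x' = x \<longrightarrow> y \<in> U) uniformity)"

instance
proof
  fix f g h :: "'a L2" and r :: real
  show "inner f g = inner g f"
    using cinner_commute[of f g] by (simp add: inner_L2_def)
  show "inner (f + g) h = inner f h + inner g h"
    by (simp add: inner_L2_def cinner_add_left)
  show "inner (r *\<^sub>R f) g = r * inner f g"
    by (simp add: inner_L2_def scaleR_scaleC cinner_scaleC_left)
  show "0 \<le> inner f f" "(inner f f = 0) = (f = 0)"
    using cinner_self[of f] by (auto simp: inner_L2_def)
qed (simp_all only: norm_L2_def sgn_L2_def dist_L2_def uniformity_L2_def open_L2_def)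

end

lemma norm_scaleC: "norm (c *\<^sub>C f) = cmod c * norm f"
proof -
  have "cinner (c *\<^sub>C f) (c *\<^sub>C f) = c * cnj c * cinner f f"
    using cinner_commute[of f "c *\<^sub>C f"] cinner_commute[of f f]
    by (simp add: cinner_scaleC_left)
  also have "\<dots> = complex_of_real ((cmod c)\<^sup>2) * cinner f f"
    by (simp add: complex_norm_square del: of_real_power)
  finally show ?thesis
    by (simp add: norm_L2_def inner_L2_def real_sqrt_mult)
qed

lemma scaleC_add_left: "(a + b) *\<^sub>C f = a *\<^sub>C f + b *\<^sub>C f"
  by transfer (auto simp: L2_rel_def distrib_right square_integrable_add square_integrable_cmult)

lemma scaleC_scaleC: "a *\<^sub>C b *\<^sub>C f = (a * b) *\<^sub>C f"
  by transfer (auto simp: L2_rel_def mult.assoc square_integrable_cmult)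

lemma cmod_cinner_le: "cmod (cinner f g) \<le> norm f * norm g"
proof -
  obtain u where u: "cmod u = 1" "u * cinner f g = complex_of_real (cmod (cinner f g))"
  proof (cases "cinner f g = 0")
    case True
    then show ?thesis using that[of 1] by simp
  next
    case False
    then show ?thesis
      using that[of "complex_of_real (cmod (cinner f g)) / cinner f g"]
      by (simp add: norm_divide)
  qed
  have "cmod (cinner f g) = inner (u *\<^sub>C f) g"
    using u by (simp add: inner_L2_def cinner_scaleC_left)
  also have "\<dots> \<le> norm (u *\<^sub>C f) * norm g"
    by (rule norm_cauchy_schwarz)
  finally show ?thesis using u by (simp add: norm_scaleC)
qed

type_synonym 'd operator = "'d L2 \<Rightarrow>\<^sub>L 'd L2"

(* \<Rightarrow>\<^sub>L only provides real-linear bounded maps *)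
definition complex_linear :: "'d::finite operator \<Rightarrow> bool" where
  "complex_linear T \<longleftrightarrow> (\<forall>c f. blinfun_apply T (c *\<^sub>C f) = c *\<^sub>C blinfun_apply T f)"

definition op_adjoint :: "'d::finite operator \<Rightarrow> 'd operator" where
  "op_adjoint T =
     (THE B. \<forall>f g. cinner (blinfun_apply T f) g = cinner f (blinfun_apply B g))"

lift_definition rank_one :: "'d::finite L2 \<Rightarrow> 'd L2 \<Rightarrow> 'd operator" is
  "\<lambda>g f h. cinner h f *\<^sub>C g"
proof (rule bounded_linear_intro)
  fix f g h k :: "'d L2" and r :: real
  show "cinner (h + k) f *\<^sub>C g = cinner h f *\<^sub>C g + cinner k f *\<^sub>C g"
    by (simp add: cinner_add_left scaleC_add_left)
  show "cinner (r *\<^sub>R h) f *\<^sub>C g = r *\<^sub>R (cinner h f *\<^sub>C g)"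
    by (simp add: scaleR_scaleC cinner_scaleC_left scaleC_scaleC)
  show "norm (cinner h f *\<^sub>C g) \<le> norm h * (norm f * norm g)"
    using mult_right_mono[OF cmod_cinner_le[of h f] norm_ge_zero[of g]]
    by (simp add: norm_scaleC mult.assoc)
qed

definition orthonormal_on :: "'i set \<Rightarrow> ('i \<Rightarrow> 'd::finite L2) \<Rightarrow> bool" where
  "orthonormal_on N e \<longleftrightarrow> (\<forall>m\<in>N. \<forall>n\<in>N. cinner (e m) (e n) = (if m = n then 1 else 0))"

definition orthonormal_basis :: "'d::finite L2 set \<Rightarrow> bool" where
  "orthonormal_basis E \<longleftrightarrow>
     orthonormal_on E (\<lambda>e. e) \<and> (\<forall>f. (\<forall>e\<in>E. cinner f e = 0) \<longrightarrow> f = 0)"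

definition op_trace :: "'d::finite operator \<Rightarrow> complex" where
  "op_trace T = (THE t. \<forall>E. orthonormal_basis E \<longrightarrow>
     ((\<lambda>e. cinner (blinfun_apply T e) e) has_sum t) E)"

(* T = \<Sum>n\<in>N. s n \<langle>-, e n\<rangle> g n, converging in operator norm. N is an arbitrary subset of the
   naturals so that finite-rank operators are covered with positive singular values; norm
   convergence makes T compact, and every compact operator has such a decomposition. *)
definition singular_value_decomposition ::
  "nat set \<Rightarrow> (nat \<Rightarrow> real) \<Rightarrow> (nat \<Rightarrow> 'd::finite L2) \<Rightarrow> (nat \<Rightarrow> 'd L2) \<Rightarrow> 'd operator \<Rightarrow> bool"
where
  "singular_value_decomposition N s e g T \<longleftrightarrow>
     (\<forall>n\<in>N. 0 < s n) \<and> orthonormal_on N e \<and> orthonormal_on N g \<and>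
     ((\<lambda>n. s n *\<^sub>R rank_one (g n) (e n)) has_sum T) N"

definition schatten_class :: "ennreal \<Rightarrow> 'd::finite operator set" where
  "schatten_class p =
     (if p = \<infinity> then {T. complex_linear T}
      else {T. \<exists>N s e g. singular_value_decomposition N s e g T \<and>
                 (\<lambda>n. s n powr enn2real p) summable_on N})"

(* The positive singular values are unique up to reordering, so THE is well defined. *)
definition schatten_norm :: "ennreal \<Rightarrow> 'd::finite operator \<Rightarrow> real" where
  "schatten_norm p T =
     (if p = \<infinity> then norm T
      else (THE r. \<exists>N s e g. singular_value_decomposition N s e g T \<and>
              r = (\<Sum>\<^sub>\<infinity>n\<in>N. s n powr enn2real p) powr (1 / enn2real p)))"

lemma affine_unitary:
  fixes f g :: "real ^ 'd \<Rightarrow> complex"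
  assumes "L2_rel f g" "\<bar>c\<bar> = 1" "u \<in> borel_measurable borel" "\<And>t. cmod (u t) = 1"
  shows "L2_rel (\<lambda>t. u t * f (a + c *\<^sub>R t)) (\<lambda>t. u t * g (a + c *\<^sub>R t))"
    and "(\<integral>t. (u t * f (a + c *\<^sub>R t)) * cnj (u t * f (a + c *\<^sub>R t)) \<partial>lborel) =
         (\<integral>t. f t * cnj (f t) \<partial>lborel)"
proof -
  have "L2_rel (\<lambda>t. f (a + c *\<^sub>R t)) (\<lambda>t. g (a + c *\<^sub>R t))"
    using assms by (intro L2_rel_comp_affine)
  then show "L2_rel (\<lambda>t. u t * f (a + c *\<^sub>R t)) (\<lambda>t. u t * g (a + c *\<^sub>R t))"
    unfolding L2_rel_def
    by (intro conjI square_integrable_mult_bounded[where B = 1])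
      (use assms in \<open>auto elim: AE_mp\<close>)
  have [measurable]: "f \<in> borel_measurable borel"
    using assms by (auto simp: L2_rel_def square_integrable_def)
  have "(\<integral>t. (u t * f (a + c *\<^sub>R t)) * cnj (u t * f (a + c *\<^sub>R t)) \<partial>lborel) =
        (\<integral>t. f (a + c *\<^sub>R t) * cnj (f (a + c *\<^sub>R t)) \<partial>lborel)"
    unfolding complex_norm_square[symmetric] using assms by (simp add: norm_mult)
  also have "\<dots> = (\<integral>t. f t * cnj (f t) \<partial>distr lborel borel (\<lambda>t. a + c *\<^sub>R t))"
    by (subst integral_distr) auto
  finally show "(\<integral>t. (u t * f (a + c *\<^sub>R t)) * cnj (u t * f (a + c *\<^sub>R t)) \<partial>lborel) =
        (\<integral>t. f t * cnj (f t) \<partial>lborel)"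
    using assms by (simp add: lborel_distr_affine)
qed

lemma tf_shift_rel:
  fixes f g :: "real ^ 'd \<Rightarrow> complex" and x \<omega> :: "real ^ 'd"
  assumes "L2_rel f g"
  defines "U \<equiv> \<lambda>f t. exp (2 * of_real pi * \<i> * of_real (\<omega> \<bullet> t)) * f (t - x)"
  shows "L2_rel (U f) (U g)"
    and "(\<integral>t. U f t * cnj (U f t) \<partial>lborel) = (\<integral>t. f t * cnj (f t) \<partial>lborel)"
proof -
  let ?u = "\<lambda>t. exp (2 * of_real pi * \<i> * of_real (\<omega> \<bullet> t)) :: complex"
  have m: "?u \<in> borel_measurable borel"
    by (intro borel_measurable_continuous_onI continuous_intros)
  have n: "cmod (?u t) = 1" for t
    by (simp add: norm_exp_eq_Re)
  have U: "U f = (\<lambda>t. ?u t * f (- x + 1 *\<^sub>R t))" for f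
    by (simp add: U_def)
  show "L2_rel (U f) (U g)"
    unfolding U by (rule affine_unitary(1)[OF assms(1) _ m n]) simp
  show "(\<integral>t. U f t * cnj (U f t) \<partial>lborel) = (\<integral>t. f t * cnj (f t) \<partial>lborel)"
    unfolding U by (rule affine_unitary(2)[OF assms(1) _ m n]) simp
qed

lift_definition tf_shift_fun :: "(real ^ 'd) \<times> (real ^ 'd) \<Rightarrow> 'd::finite L2 \<Rightarrow> 'd L2" is
  "\<lambda>z \<psi> t. exp (2 * of_real pi * \<i> * of_real (snd z \<bullet> t)) * \<psi> (t - fst z)"
  by (rule tf_shift_rel)

lift_definition tf_shift :: "(real ^ 'd) \<times> (real ^ 'd) \<Rightarrow> 'd::finite operator" is tf_shift_fun
proof (rule bounded_linear_intro)
  fix z :: "(real ^ 'd) \<times> (real ^ 'd)" and f g :: "'d L2" and r :: real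
  show "tf_shift_fun z (f + g) = tf_shift_fun z f + tf_shift_fun z g"
  proof transfer
    fix z :: "(real ^ 'd) \<times> (real ^ 'd)" and f g :: "real ^ 'd \<Rightarrow> complex"
    let ?U = "\<lambda>(f :: real ^ 'd \<Rightarrow> complex) t.
      exp (2 * of_real pi * \<i> * of_real (snd z \<bullet> t)) * f (t - fst z)"
    assume "L2_rel f f" "L2_rel g g"
    then have "L2_rel (?U (\<lambda>t. f t + g t)) (?U (\<lambda>t. f t + g t))"
      by (intro tf_shift_rel) (simp add: L2_rel_def square_integrable_add)
    then show "L2_rel (?U (\<lambda>t. f t + g t)) (\<lambda>t. ?U f t + ?U g t)"
      by (simp only: distrib_left)
  qed
  show "tf_shift_fun z (r *\<^sub>R f) = r *\<^sub>R tf_shift_fun z f"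
  proof transfer
    fix z :: "(real ^ 'd) \<times> (real ^ 'd)" and r :: real and f :: "real ^ 'd \<Rightarrow> complex"
    let ?U = "\<lambda>(f :: real ^ 'd \<Rightarrow> complex) t.
      exp (2 * of_real pi * \<i> * of_real (snd z \<bullet> t)) * f (t - fst z)"
    assume "L2_rel f f"
    then have "L2_rel (?U (\<lambda>t. complex_of_real r * f t)) (?U (\<lambda>t. complex_of_real r * f t))"
      by (intro tf_shift_rel) (simp add: L2_rel_def square_integrable_cmult)
    then show "L2_rel (?U (\<lambda>t. complex_of_real r * f t)) (\<lambda>t. complex_of_real r * ?U f t)"
      by (simp only: mult.left_commute)
  qed
  have "cinner (tf_shift_fun z f) (tf_shift_fun z f) = cinner f f"
    by transfer (rule tf_shift_rel)
  then show "norm (tf_shift_fun z f) \<le> norm f * 1"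
    by (simp add: norm_L2_def inner_L2_def)
qed

lift_definition parity_fun :: "'d::finite L2 \<Rightarrow> 'd L2" is "\<lambda>\<psi> t. \<psi> (- t)"
  using L2_rel_comp_affine[of _ _ "-1" 0] by simp

lift_definition parity :: "'d::finite operator" is parity_fun
proof (rule bounded_linear_intro)
  fix f g :: "'d L2" and r :: real
  have rel: "L2_rel (\<lambda>t. f (- t)) (\<lambda>t. f (- t))" if "L2_rel f f" for f :: "real ^ 'd \<Rightarrow> complex"
    using L2_rel_comp_affine[OF that, of "-1" 0] by simp
  show "parity_fun (f + g) = parity_fun f + parity_fun g"
    by transfer (use rel square_integrable_add in \<open>auto simp: L2_rel_def\<close>)
  show "parity_fun (r *\<^sub>R f) = r *\<^sub>R parity_fun f"
    by transfer (use rel square_integrable_cmult in \<open>auto simp: L2_rel_def\<close>)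
  have "cinner (parity_fun f) (parity_fun f) = cinner f f"
  proof transfer
    fix f :: "real ^ 'd \<Rightarrow> complex"
    assume "L2_rel f f"
    from affine_unitary(2)[OF this, of "-1" "\<lambda>_. 1" 0]
    show "(\<integral>t. f (- t) * cnj (f (- t)) \<partial>lborel) = (\<integral>t. f t * cnj (f t) \<partial>lborel)"
      by simp
  qed
  then show "norm (parity_fun f) \<le> norm f * 1"
    by (simp add: norm_L2_def inner_L2_def)
qed

definition op_check :: "'d::finite operator \<Rightarrow> 'd operator" where
  "op_check T = parity o\<^sub>L T o\<^sub>L parity"

definition op_conv ::
  "'d::finite operator \<Rightarrow> 'd operator \<Rightarrow> (real ^ 'd) \<times> (real ^ 'd) \<Rightarrow> complex" where
  "op_conv A B z = op_trace (A o\<^sub>L tf_shift z o\<^sub>L op_check B o\<^sub>L op_adjoint (tf_shift z))"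

definition complex_measure :: "('a::topological_space set \<Rightarrow> complex) \<Rightarrow> bool" where
  "complex_measure \<mu> \<longleftrightarrow> \<mu> {} = 0 \<and>
     (\<forall>A :: nat \<Rightarrow> 'a set. range A \<subseteq> sets borel \<longrightarrow> disjoint_family A \<longrightarrow>
        (\<lambda>n. \<mu> (A n)) sums \<mu> (\<Union>n. A n))"

definition total_variation :: "('a::topological_space set \<Rightarrow> complex) \<Rightarrow> 'a measure" where
  "total_variation \<mu> = measure_of UNIV (sets borel)
     (\<lambda>E. SUP A \<in> {A :: nat \<Rightarrow> 'a set. range A \<subseteq> sets borel \<and> disjoint_family A \<and> (\<Union>n. A n) = E}.
        \<Sum>n. ennreal (cmod (\<mu> (A n))))"

definition total_variation_norm :: "('a::topological_space set \<Rightarrow> complex) \<Rightarrow> real" where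
  "total_variation_norm \<mu> = measure (total_variation \<mu>) UNIV"

(* Any two choices agree |mu|-almost everywhere, so integrals against mu do not depend on it. *)
definition polar_density :: "('a::topological_space set \<Rightarrow> complex) \<Rightarrow> 'a \<Rightarrow> complex" where
  "polar_density \<mu> = (SOME h. h \<in> borel_measurable borel \<and> (\<forall>x. cmod (h x) = 1) \<and>
     (\<forall>E\<in>sets borel. \<mu> E = set_lebesgue_integral (total_variation \<mu>) E h))"

definition complex_measure_integral ::
  "('a::topological_space set \<Rightarrow> complex) \<Rightarrow> ('a \<Rightarrow> complex) \<Rightarrow> complex" where
  "complex_measure_integral \<mu> F = (\<integral>x. F x * polar_density \<mu> x \<partial>total_variation \<mu>)"

definition schatten_pairing :: "'d::finite operator \<Rightarrow> 'd operator \<Rightarrow> complex" where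
  "schatten_pairing A B = op_trace (A o\<^sub>L op_adjoint B)"

definition measure_pairing ::
  "('a::topological_space set \<Rightarrow> complex) \<Rightarrow> ('a \<Rightarrow> complex) \<Rightarrow> complex" where
  "measure_pairing \<mu> F = complex_measure_integral \<mu> (\<lambda>z. cnj (F z))"

definition measure_conv ::
  "(((real ^ 'd) \<times> (real ^ 'd)) set \<Rightarrow> complex) \<Rightarrow> 'd::finite operator \<Rightarrow> 'd operator" where
  "measure_conv \<mu> T = (THE A. A \<in> schatten_class \<infinity> \<and>
     (\<forall>R \<in> schatten_class 1.
        schatten_pairing A R = measure_pairing \<mu> (op_conv R (op_adjoint (op_check T)))))"

end

theory Submission
  imports Defs
begin

text \<open>The matrix coefficients of \<open>\<mu> \<star> S\<close> are the \<open>\<mu>\<close>-averages of those of the shifted operators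
  \<open>\<pi>(z) S \<pi>(z)*\<close>; for \<open>p = \<infinity>\<close> this gives the bound at once. For finite \<open>p\<close> the key
  is that \<open>\<Sum> \<bar>\<langle>S e n, g n\<rangle>\<bar> powr p \<le> \<parallel>S\<parallel> powr p\<close> (with the Schatten norm on the right) for all
  orthonormal families \<open>e\<close>, \<open>g\<close>, with equality for those of a singular value decomposition. Hence the
  singular values determine the norm, and, averaging with Jensen's inequality, the diagonals of
  \<open>\<mu> \<star> S\<close> obey the claimed bound. An operator whose diagonals are bounded in this way is compact;
  diagonalising \<open>A* A\<close> gives it a singular value decomposition, to which the bound applies.\<close>

section \<open>Total variation and polar density\<close>

text \<open>Averaging Schatten norms directly would need their triangle inequality and an
  operator-valued integral. Diagonals replace both by scalar estimates: Jensen's inequality for a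
  measure of mass m costs m^(p-1), integrating the constant bound costs one more m, and the p-th
  root of m^p is the factor claimed. The two orthonormal families must be arbitrary, because the
  singular vectors of the convolution are not those of \<open>S\<close>. Compactness is unavoidable:
  membership in a Schatten class demands a decomposition that converges in operator norm and is
  indexed by naturals, whereas \<open>measure_conv\<close> is given only weakly, through pairings.
  The natural-number index is the reason for proving separability; Riesz representation and the
  diagonalisation rest on completeness. Three descriptions must also be shown to denote something:
  \<open>polar_density\<close> by existence, \<open>op_trace\<close> by independence of the basis,
  and \<open>measure_conv\<close> by a bounded sesquilinear form (existence) and rank-one operators
  (uniqueness).\<close>

lemma complex_measure_UN:
  assumes "complex_measure \<mu>" "\<And>n. A n \<in> sets borel" "disjoint_family (A :: nat \<Rightarrow> _)"
  shows "(\<lambda>n. \<mu> (A n)) sums \<mu> (\<Union>n. A n)"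
  using assms by (auto simp: complex_measure_def)

lemma complex_measure_Un:
  assumes "complex_measure \<mu>" "A \<in> sets borel" "B \<in> sets borel" "A \<inter> B = {}"
  shows "\<mu> (A \<union> B) = \<mu> A + \<mu> B"
proof -
  have "(\<lambda>n. \<mu> (binaryset A B n)) sums \<mu> (\<Union>n. binaryset A B n)"
    using assms by (intro complex_measure_UN)
      (auto simp: binaryset_def disjoint_family_on_def)
  moreover have "(\<lambda>n. \<mu> (binaryset A B n)) sums (\<Sum>n\<in>{0,1}. \<mu> (binaryset A B n))"
    by (rule sums_finite) (use assms in \<open>auto simp: binaryset_def complex_measure_def\<close>)
  ultimately show ?thesis
    by (simp add: UN_binaryset_eq sums_iff binaryset_def)
qed

lemma complex_measure_Diff:
  assumes "complex_measure \<mu>" "A \<in> sets borel" "B \<in> sets borel" "B \<subseteq> A"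
  shows "\<mu> (A - B) = \<mu> A - \<mu> B"
  using complex_measure_Un[OF assms(1), of B "A - B"] assms by (simp add: Un_absorb1)

lemma complex_measure_finite_UN:
  assumes \<mu>: "complex_measure \<mu>" and "finite I" "\<And>i. i \<in> I \<Longrightarrow> A i \<in> sets borel"
    "disjoint_family_on A I"
  shows "\<mu> (\<Union>i\<in>I. A i) = (\<Sum>i\<in>I. \<mu> (A i))"
  using assms(2-)
proof (induction I)
  case empty
  then show ?case using \<mu> by (simp add: complex_measure_def)
next
  case (insert i I)
  have "\<mu> (A i \<union> (\<Union>j\<in>I. A j)) = \<mu> (A i) + \<mu> (\<Union>j\<in>I. A j)"
    using insert by (intro complex_measure_Un[OF \<mu>]) (auto simp: disjoint_family_on_def)
  also have "\<mu> (\<Union>j\<in>I. A j) = (\<Sum>j\<in>I. \<mu> (A j))"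
    using insert by (intro insert.IH) (auto simp: disjoint_family_on_def)
  finally show ?case using insert by simp
qed

text \<open>If \<mu> is unbounded on the subsets of a set, that set splits into a part with the same
  defect and a part of modulus at least 1. Removing such parts forever gives disjoint sets whose
  values do not tend to 0, against countable additivity.\<close>

lemma complex_measure_bounded:
  assumes \<mu>: "complex_measure \<mu>"
  obtains K where "0 \<le> K" "\<And>B. B \<in> sets borel \<Longrightarrow> cmod (\<mu> B) \<le> K"
proof -
  define bad where "bad E \<longleftrightarrow> E \<in> sets borel \<and>
    (\<forall>K. \<exists>B\<in>sets borel. B \<subseteq> E \<and> K < cmod (\<mu> B))" for E
  have split: "\<exists>E'. bad E' \<and> E' \<subseteq> E \<and> 1 \<le> cmod (\<mu> (E - E'))" if E: "bad E" for E
  proof -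
    \<comment> \<open>The margin gives both \<open>B\<close> and \<open>E - B\<close> modulus at
      least 1, so whichever of them is bad, the other can be split off.\<close>
    obtain B where B: "B \<in> sets borel" "B \<subseteq> E" "cmod (\<mu> E) + 1 < cmod (\<mu> B)"
      using E by (auto simp: bad_def)
    have sets: "E \<in> sets borel" "E - B \<in> sets borel" using E B by (auto simp: bad_def)
    have eq: "\<mu> (E - B) = \<mu> E - \<mu> B" using complex_measure_Diff[OF \<mu>] E B by (auto simp: bad_def)
    have "cmod (\<mu> B) - cmod (\<mu> E) \<le> cmod (\<mu> E - \<mu> B)"
      using norm_triangle_ineq2[of "\<mu> B" "\<mu> E"] by (simp add: norm_minus_commute)
    then have ge: "1 \<le> cmod (\<mu> (E - B))" "1 \<le> cmod (\<mu> B)"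
      using B(3) norm_ge_zero[of "\<mu> E"] unfolding eq by linarith+
    have "bad B \<or> bad (E - B)"
    proof (rule ccontr)
      assume "\<not> ?thesis"
      then obtain K1 K2 where K: "\<And>C. C \<in> sets borel \<Longrightarrow> C \<subseteq> B \<Longrightarrow> cmod (\<mu> C) \<le> K1"
        "\<And>C. C \<in> sets borel \<Longrightarrow> C \<subseteq> E - B \<Longrightarrow> cmod (\<mu> C) \<le> K2"
        using B sets by (force simp: bad_def not_less)
      obtain C where C: "C \<in> sets borel" "C \<subseteq> E" "K1 + K2 < cmod (\<mu> C)"
        using E unfolding bad_def by blast
      have "\<mu> C = \<mu> ((C \<inter> B) \<union> (C - B))" by (rule arg_cong[of _ _ \<mu>]) blast
      also have "\<dots> = \<mu> (C \<inter> B) + \<mu> (C - B)"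
        using C B by (intro complex_measure_Un[OF \<mu>]) auto
      finally have "cmod (\<mu> C) \<le> cmod (\<mu> (C \<inter> B)) + cmod (\<mu> (C - B))"
        by (simp add: norm_triangle_ineq)
      also have "\<dots> \<le> K1 + K2" using C B by (intro add_mono K) auto
      finally show False using C by simp
    qed
    moreover have "E - (E - B) = B" using B by blast
    ultimately show ?thesis using ge B by (metis Diff_subset)
  qed
  have "\<not> bad UNIV"
  proof
    assume "bad UNIV"
    obtain F where F: "F 0 = UNIV" "\<And>n. bad (F n)"
      "\<And>n. F (Suc n) \<subseteq> F n \<and> 1 \<le> cmod (\<mu> (F n - F (Suc n)))"
      using dependent_nat_choice[of "\<lambda>n E. bad E \<and> (n = 0 \<longrightarrow> E = UNIV)"
          "\<lambda>n E E'. E' \<subseteq> E \<and> 1 \<le> cmod (\<mu> (E - E'))"] split \<open>bad UNIV\<close> by (metis nat.distinct(1))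
    have anti: "F n \<subseteq> F m" if "m \<le> n" for m n
      using lift_Suc_antimono_le[of F, OF _ that] F(3) by blast
    have "disjoint_family (\<lambda>n. F n - F (Suc n))"
      unfolding disjoint_family_on_def
    proof (intro ballI impI)
      fix m n :: nat assume "m \<noteq> n"
      then show "(F m - F (Suc m)) \<inter> (F n - F (Suc n)) = {}"
        using anti[of "Suc m" n] anti[of "Suc n" m] by (cases "m < n") (force simp: Suc_le_eq)+
    qed
    moreover have "F n - F (Suc n) \<in> sets borel" for n using F(2) by (auto simp: bad_def)
    ultimately have "(\<lambda>n. \<mu> (F n - F (Suc n))) sums \<mu> (\<Union>n. F n - F (Suc n))"
      by (intro complex_measure_UN[OF \<mu>])
    then have "(\<lambda>n. \<mu> (F n - F (Suc n))) \<longlonglongrightarrow> 0"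
      by (intro summable_LIMSEQ_zero) (rule sums_summable)
    then have "\<forall>\<^sub>F n in sequentially. cmod (\<mu> (F n - F (Suc n))) < 1"
      by (auto simp: tendsto_iff dist_norm)
    then show False using F(3) by (auto simp: eventually_sequentially simp flip: not_le)
  qed
  then obtain K where K: "\<And>B. B \<in> sets borel \<Longrightarrow> cmod (\<mu> B) \<le> K"
    by (force simp: bad_def not_less)
  moreover have "0 \<le> K" using K[of "{}"] norm_ge_zero order_trans by blast
  ultimately show ?thesis using that by blast
qed

text \<open>The supremum inside \<open>total_variation\<close>, kept as a bare set function because
  its additivity must be known before \<open>measure_of\<close> yields its values.\<close>

definition variation :: "('a::topological_space set \<Rightarrow> complex) \<Rightarrow> 'a set \<Rightarrow> ennreal" where
  "variation \<mu> E =
     (SUP A \<in> {A :: nat \<Rightarrow> 'a set. range A \<subseteq> sets borel \<and> disjoint_family A \<and> (\<Union>n. A n) = E}.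
        \<Sum>n. ennreal (cmod (\<mu> (A n))))"

lemma variation_upper:
  assumes "\<And>n. A n \<in> sets borel" "disjoint_family (A :: nat \<Rightarrow> _)" "(\<Union>n. A n) = E"
  shows "(\<Sum>n. ennreal (cmod (\<mu> (A n)))) \<le> variation \<mu> E"
  unfolding variation_def using assms by (intro SUP_upper) auto

lemma variation_least:
  assumes "\<And>A :: nat \<Rightarrow> _. (\<And>n. A n \<in> sets borel) \<Longrightarrow> disjoint_family A \<Longrightarrow> (\<Union>n. A n) = E \<Longrightarrow>
    (\<Sum>n. ennreal (cmod (\<mu> (A n)))) \<le> c"
  shows "variation \<mu> E \<le> c"
  unfolding variation_def using assms by (intro SUP_least) auto

text \<open>Real and imaginary parts, each split by sign, give four subfamilies of constant sign,
  and each contributes at most \<open>K\<close>.\<close>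

lemma sum_abs_Re_Im_le:
  assumes "finite I" "\<And>J. J \<subseteq> I \<Longrightarrow> cmod (\<Sum>i\<in>J. f i) \<le> K"
  shows "(\<Sum>i\<in>I. cmod (f i)) \<le> 4 * K"
proof -
  have *: "(\<Sum>i\<in>I. \<bar>g i\<bar>) \<le> 2 * K"
    if g: "\<And>J. J \<subseteq> I \<Longrightarrow> \<bar>\<Sum>i\<in>J. g i\<bar> \<le> K" for g :: "_ \<Rightarrow> real"
  proof -
    have "(\<Sum>i\<in>I. \<bar>g i\<bar>) = (\<Sum>i\<in>{i\<in>I. g i \<ge> 0} \<union> {i\<in>I. g i < 0}. \<bar>g i\<bar>)"
      by (intro sum.cong) auto
    also have "\<dots> = (\<Sum>i\<in>{i\<in>I. g i \<ge> 0}. \<bar>g i\<bar>) + (\<Sum>i\<in>{i\<in>I. g i < 0}. \<bar>g i\<bar>)"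
      using assms(1) by (intro sum.union_disjoint) auto
    also have "\<dots> = (\<Sum>i\<in>{i\<in>I. g i \<ge> 0}. g i) - (\<Sum>i\<in>{i\<in>I. g i < 0}. g i)"
      by (simp add: sum_negf)
    also have "\<dots> \<le> 2 * K"
      using g[of "{i\<in>I. g i \<ge> 0}"] g[of "{i\<in>I. g i < 0}"] by auto
    finally show ?thesis .
  qed
  have "(\<Sum>i\<in>I. cmod (f i)) \<le> (\<Sum>i\<in>I. \<bar>Re (f i)\<bar> + \<bar>Im (f i)\<bar>)"
    by (intro sum_mono cmod_le)
  also have "\<dots> = (\<Sum>i\<in>I. \<bar>Re (f i)\<bar>) + (\<Sum>i\<in>I. \<bar>Im (f i)\<bar>)"
    by (rule sum.distrib)
  also have "\<dots> \<le> 2 * K + 2 * K"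
    using assms(2) abs_Re_le_cmod abs_Im_le_cmod
    by (intro add_mono *; simp flip: Re_sum Im_sum) (meson order_trans)+
  finally show ?thesis by simp
qed

text \<open>Subsums over a finite part of a partition are values of \<mu> on unions, so a uniform
  bound on the values bounds every partition sum by four times as much.\<close>

lemma variation_finite:
  assumes \<mu>: "complex_measure \<mu>"
  shows "variation \<mu> E < \<infinity>"
proof -
  obtain K where K: "0 \<le> K" "\<And>B. B \<in> sets borel \<Longrightarrow> cmod (\<mu> B) \<le> K"
    using complex_measure_bounded[OF \<mu>] by blast
  have "variation \<mu> E \<le> ennreal (4 * K)"
  proof (rule variation_least)
    fix A :: "nat \<Rightarrow> 'a set"
    assume A: "\<And>n. A n \<in> sets borel" "disjoint_family A"
    have "(\<Sum>i\<in>I. cmod (\<mu> (A i))) \<le> 4 * K" if "finite I" for I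
    proof (rule sum_abs_Re_Im_le[OF that])
      fix J assume "J \<subseteq> I"
      then have "finite J" using that finite_subset by blast
      then have "(\<Sum>i\<in>J. \<mu> (A i)) = \<mu> (\<Union>i\<in>J. A i)"
        using A by (intro complex_measure_finite_UN[OF \<mu>, symmetric])
          (auto simp: disjoint_family_on_def)
      then show "cmod (\<Sum>i\<in>J. \<mu> (A i)) \<le> K" using A \<open>finite J\<close> by (auto intro!: K)
    qed
    then show "(\<Sum>n. ennreal (cmod (\<mu> (A n)))) \<le> ennreal (4 * K)"
      by (intro suminf_le_const summableI) (auto simp: sum_ennreal intro!: ennreal_leI)
  qed
  then show ?thesis by (rule order.strict_trans1) simp
qed

lemma variation_empty: "complex_measure \<mu> \<Longrightarrow> variation \<mu> {} = 0"
proof -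
  assume \<mu>: "complex_measure \<mu>"
  have "variation \<mu> {} \<le> 0"
    by (rule variation_least) (use \<mu> in \<open>auto simp: complex_measure_def\<close>)
  then show ?thesis by simp
qed

lemma norm_le_variation:
  assumes \<mu>: "complex_measure \<mu>" and E: "E \<in> sets borel"
  shows "ennreal (cmod (\<mu> E)) \<le> variation \<mu> E"
proof -
  have "(\<Sum>n. ennreal (cmod (\<mu> (binaryset E {} n)))) \<le> variation \<mu> E"
    using E by (intro variation_upper)
      (auto simp: binaryset_def disjoint_family_on_def split: if_splits)
  moreover have "(\<Sum>n. ennreal (cmod (\<mu> (binaryset E {} n)))) =
      (\<Sum>n\<in>{0}. ennreal (cmod (\<mu> (binaryset E {} n))))"
    by (rule suminf_finite) (use \<mu> in \<open>auto simp: binaryset_def complex_measure_def\<close>)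
  ultimately show ?thesis by (simp add: binaryset_def)
qed

lemma suminf_swap_ennreal:
  fixes f :: "nat \<Rightarrow> nat \<Rightarrow> ennreal"
  shows "(\<Sum>n. \<Sum>i. f n i) = (\<Sum>i. \<Sum>n. f n i)"
proof -
  have "(\<Sum>n. \<Sum>i. f n i) = (\<Sum>n. \<integral>\<^sup>+i. f n i \<partial>count_space UNIV)"
    by (simp add: nn_integral_count_space_nat)
  also have "\<dots> = (\<integral>\<^sup>+i. (\<Sum>n. f n i) \<partial>count_space UNIV)"
    by (simp add: nn_integral_suminf)
  also have "\<dots> = (\<Sum>i. \<Sum>n. f n i)"
    by (rule nn_integral_count_space_nat)
  finally show ?thesis .
qed

text \<open>For one inequality, any partition of the union is refined by the sets
  \<open>E i\<close>. For the other, near-optimal partitions of the \<open>E i\<close> are merged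
  into a single partition of the union.\<close>

lemma variation_countably_additive:
  assumes \<mu>: "complex_measure \<mu>"
  shows "countably_additive (sets borel) (variation \<mu>)"
proof (rule countably_additiveI)
  fix E :: "nat \<Rightarrow> 'a set"
  assume "range E \<subseteq> sets borel" and dE: "disjoint_family E"
  then have E: "E n \<in> sets borel" for n by auto
  show "(\<Sum>i. variation \<mu> (E i)) = variation \<mu> (\<Union>i. E i)"
  proof (rule antisym)
    show "variation \<mu> (\<Union>i. E i) \<le> (\<Sum>i. variation \<mu> (E i))"
    proof (rule variation_least)
      fix A :: "nat \<Rightarrow> 'a set"
      assume A: "\<And>n. A n \<in> sets borel" "disjoint_family A" "(\<Union>n. A n) = (\<Union>i. E i)"
      have "ennreal (cmod (\<mu> (A n))) \<le> (\<Sum>i. ennreal (cmod (\<mu> (A n \<inter> E i))))" for n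
      \<comment> \<open>Without real summability the extended sum is \<open>top\<close> and the
        inequality is trivial.\<close>
      proof (cases "summable (\<lambda>i. cmod (\<mu> (A n \<inter> E i)))")
        case True
        have "(\<lambda>i. \<mu> (A n \<inter> E i)) sums \<mu> (\<Union>i. A n \<inter> E i)"
        proof (rule complex_measure_UN[OF \<mu>])
          show "disjoint_family (\<lambda>i. A n \<inter> E i)"
            using dE unfolding disjoint_family_on_def by blast
        qed (use A E in auto)
        moreover have "(\<Union>i. A n \<inter> E i) = A n" using A(3) by blast
        ultimately have "cmod (\<mu> (A n)) \<le> (\<Sum>i. cmod (\<mu> (A n \<inter> E i)))"
          using summable_norm[OF True] by (simp add: sums_iff)
        then show ?thesis
          using True by (subst suminf_ennreal2) (auto intro: ennreal_leI)
      next
        case False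
        then have "(\<Sum>i. ennreal (cmod (\<mu> (A n \<inter> E i)))) = top"
          by (metis norm_ge_zero summable_suminf_not_top)
        then show ?thesis by simp
      qed
      then have "(\<Sum>n. ennreal (cmod (\<mu> (A n)))) \<le> (\<Sum>n. \<Sum>i. ennreal (cmod (\<mu> (A n \<inter> E i))))"
        by (intro suminf_le) auto
      also have "\<dots> = (\<Sum>i. \<Sum>n. ennreal (cmod (\<mu> (A n \<inter> E i))))"
        by (rule suminf_swap_ennreal)
      also have "\<dots> \<le> (\<Sum>i. variation \<mu> (E i))"
      proof (intro suminf_le variation_upper summableI)
        fix i
        show "disjoint_family (\<lambda>n. A n \<inter> E i)" using A(2) by (auto simp: disjoint_family_on_def)
        show "(\<Union>n. A n \<inter> E i) = E i" using A(3) by blast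
      qed (use A E in auto)
      finally show "(\<Sum>n. ennreal (cmod (\<mu> (A n)))) \<le> (\<Sum>i. variation \<mu> (E i))" .
    qed
    show "(\<Sum>i. variation \<mu> (E i)) \<le> variation \<mu> (\<Union>i. E i)"
    proof (rule ennreal_le_epsilon)
      fix e :: real assume "0 < e"
      \<comment> \<open>The errors \<open>e / 2 ^ (i + 1)\<close> add up to \<open>e\<close>;
        finiteness of the variation is what makes a near-optimal partition available.\<close>
      have "\<exists>A :: nat \<Rightarrow> 'a set. (\<forall>n. A n \<in> sets borel) \<and> disjoint_family A \<and> (\<Union>n. A n) = E i \<and>
          variation \<mu> (E i) \<le> (\<Sum>n. ennreal (cmod (\<mu> (A n)))) + ennreal (e * (1/2) ^ Suc i)" for i
      proof -
        have "binaryset (E i) {} \<in>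
            {A. range A \<subseteq> sets borel \<and> disjoint_family A \<and> (\<Union>n. A n) = E i}"
          using E by (auto simp: binaryset_def disjoint_family_on_def split: if_splits)
        then have ne: "{A :: nat \<Rightarrow> 'a set. range A \<subseteq> sets borel \<and> disjoint_family A \<and> (\<Union>n. A n) = E i} \<noteq> {}"
          by (metis empty_iff)
        have pos: "0 < e * (1/2) ^ Suc i" using \<open>0 < e\<close> by simp
        have fin: "variation \<mu> (E i) \<noteq> \<infinity>" using variation_finite[OF \<mu>, of "E i"] by simp
        obtain A :: "nat \<Rightarrow> 'a set" where
          "A \<in> {A. range A \<subseteq> sets borel \<and> disjoint_family A \<and> (\<Union>n. A n) = E i}"
          "variation \<mu> (E i) < (\<Sum>n. ennreal (cmod (\<mu> (A n)))) + ennreal (e * (1/2) ^ Suc i)"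
          using SUP_approx_ennreal[OF pos ne variation_def fin] by (elim bexE)
        then show ?thesis by (intro exI[of _ A]) (simp add: less_imp_le image_subset_iff)
      qed
      then obtain A :: "nat \<Rightarrow> nat \<Rightarrow> 'a set" where A: "\<And>i n. A i n \<in> sets borel"
        "\<And>i. disjoint_family (A i)" "\<And>i. (\<Union>n. A i n) = E i"
        "\<And>i. variation \<mu> (E i) \<le> (\<Sum>n. ennreal (cmod (\<mu> (A i n)))) + ennreal (e * (1/2) ^ Suc i)"
        by metis
      have "(\<Sum>i. variation \<mu> (E i)) \<le>
          (\<Sum>i. (\<Sum>n. ennreal (cmod (\<mu> (A i n)))) + ennreal (e * (1/2) ^ Suc i))"
        by (intro suminf_le A summableI)
      also have "\<dots> = (\<Sum>i. \<Sum>n. ennreal (cmod (\<mu> (A i n)))) + (\<Sum>i. ennreal (e * (1/2) ^ Suc i))"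
        by (intro suminf_add[symmetric] summableI)
      also have "(\<Sum>i. ennreal (e * (1/2) ^ Suc i)) = ennreal e"
      proof (rule suminf_ennreal_eq)
        show "(\<lambda>i. e * (1/2) ^ Suc i) sums e"
          using sums_mult[OF power_half_series, of e] by simp
      qed (use \<open>0 < e\<close> in auto)
      also have "(\<Sum>i. \<Sum>n. ennreal (cmod (\<mu> (A i n)))) =
          (\<Sum>k. ennreal (cmod (\<mu> (case_prod A (prod_decode k)))))"
        by (rule suminf_ennreal_2dimen[symmetric]) simp
      also have "\<dots> \<le> variation \<mu> (\<Union>i. E i)"
      proof (rule variation_upper)
        show "disjoint_family (\<lambda>k. case_prod A (prod_decode k))"
          unfolding disjoint_family_on_def
        proof (intro ballI impI)
          fix k l :: nat assume "k \<noteq> l"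
          then have "prod_decode k \<noteq> prod_decode l" by (metis prod_decode_inverse)
          moreover obtain i n j m where "prod_decode k = (i, n)" "prod_decode l = (j, m)"
            by (metis surj_pair)
          moreover have "A i n \<inter> A j m = {}" if "(i, n) \<noteq> (j, m)"
          proof (cases "i = j")
            case True
            then show ?thesis using A(2)[of i] that by (auto simp: disjoint_family_on_def)
          next
            case False
            then have "E i \<inter> E j = {}" using dE by (auto simp: disjoint_family_on_def)
            then show ?thesis using A(3) by blast
          qed
          ultimately show "case_prod A (prod_decode k) \<inter> case_prod A (prod_decode l) = {}" by simp
        qed
        have "(\<Union>k. case_prod A (prod_decode k)) = (\<Union>(i, n)\<in>range prod_decode. A i n)" by auto
        then show "(\<Union>k. case_prod A (prod_decode k)) = (\<Union>i. E i)"
          using A(3)[symmetric] by (auto simp: surj_prod_decode)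
      qed (auto simp: A split: prod.split)
      finally show "(\<Sum>i. variation \<mu> (E i)) \<le> variation \<mu> (\<Union>i. E i) + ennreal e"
        by (simp add: add_right_mono)
    qed
  qed
qed

lemma sets_total_variation [measurable_cong, simp]: "sets (total_variation \<mu>) = sets borel"
  and space_total_variation [simp]: "space (total_variation \<mu>) = UNIV"
  by (simp_all add: total_variation_def sets.sigma_sets_eq[of borel, simplified])
 
lemma emeasure_total_variation:
  assumes "complex_measure \<mu>" "E \<in> sets borel"
  shows "emeasure (total_variation \<mu>) E = variation \<mu> E"
  unfolding total_variation_def variation_def[symmetric]
proof (rule emeasure_measure_of_sigma)
  show "sigma_algebra UNIV (sets borel :: 'a set set)"
    using sets.sigma_algebra_axioms[of "borel :: 'a measure"] by simp
qed (use assms variation_countably_additive variation_empty in \<open>auto simp: positive_def\<close>)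

lemma finite_measure_total_variation:
  "complex_measure \<mu> \<Longrightarrow> finite_measure (total_variation \<mu>)"
  using variation_finite[of \<mu> UNIV]
  by (intro finite_measureI) (simp add: emeasure_total_variation)

lemma measure_total_variation_ge:
  assumes "complex_measure \<mu>" "E \<in> sets borel"
  shows "cmod (\<mu> E) \<le> measure (total_variation \<mu>) E"
proof -
  interpret finite_measure "total_variation \<mu>" by (rule finite_measure_total_variation) fact
  show ?thesis
    using norm_le_variation[OF assms] assms
    by (simp flip: emeasure_total_variation add: emeasure_eq_measure)
qed

text \<open>Adding the variation turns a real part of the measure into a positive measure, to which the
  Radon--Nikodym theorem applies.\<close>

lemma real_part_density:
  fixes \<mu> :: "'a::topological_space set \<Rightarrow> complex"
  assumes \<mu>: "complex_measure \<mu>" and \<phi>: "bounded_linear \<phi>" "\<And>z. \<bar>\<phi> z\<bar> \<le> cmod z"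
  obtains g :: "'a \<Rightarrow> real" where "integrable (total_variation \<mu>) g"
    "\<And>E. E \<in> sets borel \<Longrightarrow> \<phi> (\<mu> E) = set_lebesgue_integral (total_variation \<mu>) E g"
proof -
  let ?M = "total_variation \<mu>"
  interpret finite_measure ?M by (rule finite_measure_total_variation) fact
  interpret \<phi>: bounded_linear \<phi> by fact
  define f where "f E = \<phi> (\<mu> E) + measure ?M E" for E
  define N where "N = measure_of UNIV (sets borel) (\<lambda>E. ennreal (f E))"
  have f_nonneg: "0 \<le> f E" if "E \<in> sets borel" for E
    using measure_total_variation_ge[OF \<mu> that] \<phi>(2)[of "\<mu> E"] by (simp add: f_def)
  have sets_N [simp, measurable_cong]: "sets N = sets borel"
    by (simp add: N_def sets.sigma_sets_eq[of borel, simplified])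
  have N: "emeasure N E = ennreal (f E)" if "E \<in> sets borel" for E
    unfolding N_def
  proof (rule emeasure_measure_of_sigma)
    show "sigma_algebra UNIV (sets borel :: 'a set set)"
      using sets.sigma_algebra_axioms[of "borel :: 'a measure"] by simp
    show "positive (sets borel) (\<lambda>E. ennreal (f E))"
      using \<mu> by (simp add: positive_def f_def complex_measure_def \<phi>.zero)
    show "countably_additive (sets borel) (\<lambda>E. ennreal (f E))"
    proof (rule countably_additiveI)
      fix A :: "nat \<Rightarrow> 'a set"
      assume A: "range A \<subseteq> sets borel" "disjoint_family A"
      have "(\<lambda>n. f (A n)) sums f (\<Union>n. A n)"
        unfolding f_def using A
        by (intro sums_add \<phi>.sums complex_measure_UN[OF \<mu>] finite_measure_UNION) auto
      then show "(\<Sum>n. ennreal (f (A n))) = ennreal (f (\<Union>n. A n))"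
        using A by (intro suminf_ennreal_eq f_nonneg) auto
    qed
  qed fact
  have "space N = UNIV" by (simp add: N_def)
  then have "finite_measure N" by (intro finite_measureI) (simp add: N)
  then interpret N: finite_measure N .
  have ac: "absolutely_continuous ?M N"
    unfolding absolutely_continuous_def
  proof
    fix E assume "E \<in> null_sets ?M"
    then have "E \<in> sets borel" "measure ?M E = 0" by (auto simp: measure_def)
    then show "E \<in> null_sets N"
      using measure_total_variation_ge[OF \<mu>, of E] by (auto simp: null_sets_def N f_def \<phi>.zero)
  qed
  obtain D where D [measurable]: "D \<in> borel_measurable ?M" and
    RN: "AE x in ?M. RN_deriv ?M N x = ennreal (D x)" and "\<And>x. 0 \<le> D x"
    using real_RN_deriv[OF \<open>finite_measure N\<close> ac] by auto
  have "density ?M (RN_deriv ?M N) = N"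
    using ac by (intro density_RN_deriv) simp_all
  also have "density ?M (RN_deriv ?M N) = density ?M D"
    using RN by (intro density_cong) auto
  finally have dens: "density ?M D = N" .
  have "integrable N (\<lambda>_. 1 :: real)" by simp
  then have intD: "integrable ?M D"
    unfolding dens[symmetric] using \<open>\<And>x. 0 \<le> D x\<close> by (subst (asm) integrable_real_density) auto
  \<comment> \<open>The variation that was added in \<open>f\<close> has density 1 with respect to
    itself, so subtracting 1 from the density removes it again.\<close>
  have "\<phi> (\<mu> E) = set_lebesgue_integral ?M E (\<lambda>x. D x - 1)" if E: "E \<in> sets borel" for E
  proof -
    have "f E = measure N E" using N[OF E] f_nonneg[OF E] by (simp add: measure_def)
    also have "\<dots> = (\<integral>x. indicator E x \<partial>N)" using E by (simp add: \<open>space N = UNIV\<close>)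
    also have "\<dots> = set_lebesgue_integral ?M E D"
      unfolding dens[symmetric] set_lebesgue_integral_def using E \<open>\<And>x. 0 \<le> D x\<close>
      by (subst integral_real_density) (auto simp: mult.commute)
    finally have "set_lebesgue_integral ?M E D - measure ?M E = \<phi> (\<mu> E)" by (simp add: f_def)
    moreover have "set_lebesgue_integral ?M E (\<lambda>x. D x - 1) =
        set_lebesgue_integral ?M E D - set_lebesgue_integral ?M E (\<lambda>x. 1)"
      using E intD by (intro set_integral_diff; unfold set_integrable_def;
        intro integrable_mult_indicator) auto
    ultimately show ?thesis using E by (simp add: set_integral_const)
  qed
  then show ?thesis using intD by (intro that[of "\<lambda>x. D x - 1"]) auto
qed

text \<open>The densities of real and imaginary part combine to \<open>h\<close>. Its averages lie
  in the unit disc, so its modulus is at most 1 almost everywhere; conversely the variation is at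
  most the integral of the modulus, so the modulus is at least 1.\<close>

lemma polar_density_exists:
  fixes \<mu> :: "'a::topological_space set \<Rightarrow> complex"
  assumes \<mu>: "complex_measure \<mu>"
  shows "\<exists>h. h \<in> borel_measurable borel \<and> (\<forall>x. cmod (h x) = 1) \<and>
     (\<forall>E\<in>sets borel. \<mu> E = set_lebesgue_integral (total_variation \<mu>) E h)"
proof -
  let ?M = "total_variation \<mu>"
  interpret finite_measure ?M by (rule finite_measure_total_variation) fact
  obtain g1 where g1: "integrable ?M g1"
    "\<And>E. E \<in> sets borel \<Longrightarrow> Re (\<mu> E) = set_lebesgue_integral ?M E g1"
    using real_part_density[OF \<mu> bounded_linear_Re abs_Re_le_cmod] by blast
  obtain g2 where g2: "integrable ?M g2"
    "\<And>E. E \<in> sets borel \<Longrightarrow> Im (\<mu> E) = set_lebesgue_integral ?M E g2"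
    using real_part_density[OF \<mu> bounded_linear_Im abs_Im_le_cmod] by blast
  define h where "h x = Complex (g1 x) (g2 x)" for x
  have h_eq: "h = (\<lambda>x. complex_of_real (g1 x) + \<i> * complex_of_real (g2 x))"
    by (auto simp: h_def complex_eq_iff)
  have int_h: "integrable ?M h"
    unfolding h_eq using g1 g2 by (intro Bochner_Integration.integrable_add integrable_mult_right integrable_of_real)
  have ind: "integrable ?M (\<lambda>x. indicator E x *\<^sub>R h x)" if "E \<in> sets borel" for E
    using that int_h by (intro integrable_mult_indicator) auto
  have \<mu>h: "\<mu> E = set_lebesgue_integral ?M E h" if E: "E \<in> sets borel" for E
  proof (rule complex_eqI)
    show "Re (\<mu> E) = Re (set_lebesgue_integral ?M E h)"
      unfolding g1(2)[OF E] set_lebesgue_integral_def integral_Re[OF ind[OF E], symmetric]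
      by (simp add: h_def)
    show "Im (\<mu> E) = Im (set_lebesgue_integral ?M E h)"
      unfolding g2(2)[OF E] set_lebesgue_integral_def integral_Im[OF ind[OF E], symmetric]
      by (simp add: h_def)
  qed
  have "AE x in ?M. h x \<in> cball 0 1"
  proof (rule averaging_theorem[OF int_h])
    fix A assume A: "A \<in> sets ?M" "measure ?M A > 0"
    then have "cmod (\<mu> A) \<le> measure ?M A" using measure_total_variation_ge[OF \<mu>, of A] by simp
    then show "(1 / measure ?M A) *\<^sub>R set_lebesgue_integral ?M A h \<in> cball 0 1"
      using A by (simp add: \<mu>h divide_le_eq)
  qed simp
  moreover have "AE x in ?M. 0 \<le> cmod (h x) - 1"
  proof (rule density_nonneg)
    show "integrable ?M (\<lambda>x. cmod (h x) - 1)" using int_h by auto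
    fix E assume "E \<in> sets ?M"
    then have E: "E \<in> sets borel" by simp
    have set_h: "set_integrable ?M A (\<lambda>x. cmod (h x))" if "A \<in> sets borel" for A
      unfolding set_integrable_def using that int_h by (intro integrable_mult_indicator) auto
    let ?D = "density ?M (\<lambda>x. ennreal (cmod (h x)))"
    have D: "emeasure ?D A = ennreal (set_lebesgue_integral ?M A (\<lambda>x. cmod (h x)))"
      if "A \<in> sets borel" for A
      using that int_h set_h[OF that]
      by (subst emeasure_density) (auto simp: nn_set_integral_eq_set_integral[symmetric] intro!: nn_set_integral_eq_set_integral)
    have "variation \<mu> E \<le> ennreal (set_lebesgue_integral ?M E (\<lambda>x. cmod (h x)))"
    proof (rule variation_least)
      fix A :: "nat \<Rightarrow> 'a set"
      assume A: "\<And>n. A n \<in> sets borel" "disjoint_family A" "(\<Union>n. A n) = E"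
      have "(\<Sum>n. ennreal (cmod (\<mu> (A n)))) \<le>
          (\<Sum>n. ennreal (set_lebesgue_integral ?M (A n) (\<lambda>x. cmod (h x))))"
      proof (intro suminf_le summableI ennreal_leI)
        fix n
        have "cmod (set_lebesgue_integral ?M (A n) h) \<le>
            (\<integral>x. norm (indicator (A n) x *\<^sub>R h x) \<partial>?M)"
          unfolding set_lebesgue_integral_def by (rule integral_norm_bound)
        then show "cmod (\<mu> (A n)) \<le> set_lebesgue_integral ?M (A n) (\<lambda>x. cmod (h x))"
          by (simp add: \<mu>h[OF A(1)] set_lebesgue_integral_def)
      qed
      also have "\<dots> = ennreal (set_lebesgue_integral ?M E (\<lambda>x. cmod (h x)))"
        using suminf_emeasure[of A ?D] A E by (simp add: D image_subset_iff)
      finally show "(\<Sum>n. ennreal (cmod (\<mu> (A n)))) \<le>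
        ennreal (set_lebesgue_integral ?M E (\<lambda>x. cmod (h x)))" .
    qed
    then have "measure ?M E \<le> set_lebesgue_integral ?M E (\<lambda>x. cmod (h x))"
      by (simp flip: emeasure_total_variation[OF \<mu> E] add: emeasure_eq_measure
          set_lebesgue_integral_def ennreal_le_iff)
    moreover have "set_lebesgue_integral ?M E (\<lambda>x. cmod (h x) - 1) =
        set_lebesgue_integral ?M E (\<lambda>x. cmod (h x)) - set_lebesgue_integral ?M E (\<lambda>x. 1)"
      using E int_h by (intro set_integral_diff; unfold set_integrable_def;
        intro integrable_mult_indicator) auto
    ultimately show "0 \<le> set_lebesgue_integral ?M E (\<lambda>x. cmod (h x) - 1)"
      using E by (simp add: set_integral_const)
  qed
  ultimately have norm_h: "AE x in ?M. cmod (h x) = 1" by eventually_elim simp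
  \<comment> \<open>\<open>polar_density\<close> asks for modulus 1 at every point, so
    \<open>h\<close> is replaced by 1 on the exceptional null set.\<close>
  define k where "k x = (if cmod (h x) = 1 then h x else 1)" for x
  have [measurable]: "h \<in> borel_measurable borel"
    using borel_measurable_integrable[OF int_h] by (simp cong: measurable_cong_sets)
  have [measurable]: "k \<in> borel_measurable borel"
    unfolding k_def by measurable
  have "\<mu> E = set_lebesgue_integral ?M E k" if [measurable]: "E \<in> sets borel" for E
    unfolding \<mu>h[OF that] set_lebesgue_integral_def
    by (intro integral_cong_AE) (use norm_h in \<open>auto simp: k_def elim: AE_mp\<close>)
  moreover have "cmod (k x) = 1" for x by (simp add: k_def)
  ultimately show ?thesis using \<open>k \<in> borel_measurable borel\<close> by blast
qed

lemma polar_density: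
  assumes "complex_measure \<mu>"
  shows borel_measurable_polar_density: "polar_density \<mu> \<in> borel_measurable borel"
    and norm_polar_density: "cmod (polar_density \<mu> x) = 1"
  using someI_ex[OF polar_density_exists[OF assms]] unfolding polar_density_def by blast+

section \<open>The Hilbert space of square-integrable functions\<close>

lemma cinner_add_right: "cinner f (g + h) = cinner f g + cinner f h"
  by (metis cinner_add_left cinner_commute complex_cnj_add)

lemma cinner_scaleC_right: "cinner f (c *\<^sub>C g) = cnj c * cinner f g"
  by (metis cinner_commute cinner_scaleC_left complex_cnj_mult)

lemma scaleC_add_right: "c *\<^sub>C (f + g) = c *\<^sub>C f + c *\<^sub>C g"
  by transfer (auto simp: L2_rel_def distrib_left square_integrable_add square_integrable_cmult)

text \<open>Over the reals the form is bilinear, although it is conjugate linear in the second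
  argument over the complex numbers. This supplies the rules for sums, differences and
  continuity.\<close>

interpretation cinner: bounded_bilinear cinner
proof
  fix f g h :: "'a L2" and r :: real
  show "cinner (f + g) h = cinner f h + cinner g h" by (rule cinner_add_left)
  show "cinner f (g + h) = cinner f g + cinner f h" by (rule cinner_add_right)
  show "cinner (r *\<^sub>R f) g = r *\<^sub>R cinner f g"
    by (simp add: scaleR_scaleC cinner_scaleC_left scaleR_conv_of_real)
  show "cinner f (r *\<^sub>R g) = r *\<^sub>R cinner f g"
    by (simp add: scaleR_scaleC cinner_scaleC_right scaleR_conv_of_real)
  show "\<exists>K. \<forall>f g :: 'a L2. cmod (cinner f g) \<le> norm f * norm g * K"
    by (intro exI[of _ 1]) (simp add: cmod_cinner_le)
qed

interpretation scaleC: bounded_bilinear scaleC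
proof
  fix f g :: "'a L2" and a b :: complex and r :: real
  show "(a + b) *\<^sub>C f = a *\<^sub>C f + b *\<^sub>C f" by (rule scaleC_add_left)
  show "a *\<^sub>C (f + g) = a *\<^sub>C f + a *\<^sub>C g" by (rule scaleC_add_right)
  show "(r *\<^sub>R a) *\<^sub>C f = r *\<^sub>R (a *\<^sub>C f)"
    by (simp add: scaleR_scaleC scaleC_scaleC scaleR_conv_of_real)
  show "a *\<^sub>C (r *\<^sub>R f) = r *\<^sub>R (a *\<^sub>C f)"
    by (simp add: scaleR_scaleC scaleC_scaleC mult.commute)
  show "\<exists>K. \<forall>a (f :: 'a L2). norm (a *\<^sub>C f) \<le> norm a * norm f * K"
    by (intro exI[of _ 1]) (simp add: norm_scaleC)
qed

lemma cinner_same: "cinner f f = complex_of_real ((norm f)\<^sup>2)"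
  using cinner_self[of f] by (auto simp: norm_L2_def inner_L2_def simp flip: of_real_power)

lemma cinner_eqI: "(\<And>h. cinner f h = cinner g h) \<Longrightarrow> f = g"
  using cinner_same[of "f - g"] by (simp add: cinner.diff_left)

section \<open>Representatives and completeness\<close>

lemma L2_abs_cases:
  fixes f :: "'d::finite L2"
  obtains F where "square_integrable F" "f = abs_L2 F"
  using Quotient3_rep_reflp[OF Quotient3_L2, of f] Quotient3_abs_rep[OF Quotient3_L2, of f]
  by (metis L2_rel_def)

lemma L2_rel_refl: "square_integrable F \<Longrightarrow> L2_rel F F"
  by (simp add: L2_rel_def)

lemma abs_L2_diff:
  assumes "square_integrable F" "square_integrable G"
  shows "abs_L2 (\<lambda>t. F t - G t) = abs_L2 F - abs_L2 G"
proof -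
  have "abs_L2 F - abs_L2 G = abs_L2 (\<lambda>t. F t + complex_of_real (-1) * G t)"
    unfolding minus_L2_def uminus_L2_def using assms
    by (simp only: scaleR_L2.abs_eq plus_L2.abs_eq L2_rel_refl square_integrable_cmult)
  then show ?thesis by simp
qed

lemma cinner_abs_L2:
  assumes "square_integrable F" "square_integrable G"
  shows "cinner (abs_L2 F) (abs_L2 G) = (\<integral>t. F t * cnj (G t) \<partial>lborel)"
  using assms by (simp add: cinner.abs_eq L2_rel_refl)

lemma norm_abs_L2:
  assumes "square_integrable F"
  shows "(norm (abs_L2 F))\<^sup>2 = (\<integral>t. (cmod (F t))\<^sup>2 \<partial>lborel)"
proof -
  have "complex_of_real ((norm (abs_L2 F))\<^sup>2) = (\<integral>t. complex_of_real ((cmod (F t))\<^sup>2) \<partial>lborel)"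
    using assms unfolding cinner_same[symmetric] complex_norm_square by (simp add: cinner_abs_L2)
  also have "\<dots> = complex_of_real (\<integral>t. (cmod (F t))\<^sup>2 \<partial>lborel)"
    by (rule integral_complex_of_real)
  finally show ?thesis by (simp only: of_real_eq_iff)
qed

text \<open>Phrased with the nonnegative integral so that the outcome of Fatou's lemma yields square
  integrability and the norm bound at once.\<close>

lemma norm_abs_L2_le:
  assumes "F \<in> borel_measurable borel" "0 \<le> c"
    and "(\<integral>\<^sup>+t. ennreal ((cmod (F t))\<^sup>2) \<partial>lborel) \<le> ennreal (c\<^sup>2)"
  shows "square_integrable F" "norm (abs_L2 F) \<le> c"
proof -
  have [measurable]: "F \<in> borel_measurable borel" by fact
  have fin: "(\<integral>\<^sup>+t. ennreal ((cmod (F t))\<^sup>2) \<partial>lborel) < \<infinity>"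
    using assms(3) by (rule order.strict_trans1) simp
  then show sq: "square_integrable F"
    using assms(1) unfolding square_integrable_def by (auto intro!: integrableI_nonneg)
  have "ennreal ((norm (abs_L2 F))\<^sup>2) = (\<integral>\<^sup>+t. ennreal ((cmod (F t))\<^sup>2) \<partial>lborel)"
    using sq unfolding norm_abs_L2[OF sq]
    by (intro nn_integral_eq_integral[symmetric]) (auto simp: square_integrable_def)
  then have "(norm (abs_L2 F))\<^sup>2 \<le> c\<^sup>2"
    using assms(3) by (metis ennreal_le_iff zero_le_power2)
  then show "norm (abs_L2 F) \<le> c" using assms(2) power2_le_imp_le by blast
qed

text \<open>Lebesgue measure is sigma-finite, so a strictly positive function of finite integral
  exists; \<open>w\<close> is its square root.\<close>

lemma positive_square_integrable:
  obtains w :: "real ^ 'd \<Rightarrow> real" where "\<And>t. 0 < w t"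
    "square_integrable (\<lambda>t. complex_of_real (w t))"
proof -
  obtain h :: "real ^ 'd \<Rightarrow> ennreal" where h: "h \<in> borel_measurable lborel"
    "integral\<^sup>N lborel h \<noteq> \<infinity>" "\<And>x. 0 < h x" "\<And>x. h x < \<infinity>"
    using sigma_finite_measure.Ex_finite_integrable_function[OF sigma_finite_lborel] by auto
  define w where "w t = sqrt (enn2real (h t))" for t
  have [measurable]: "h \<in> borel_measurable borel" using h(1) by simp
  have [measurable]: "w \<in> borel_measurable borel" unfolding w_def by measurable
  have pos: "0 < w t" for t
    using h(3,4)[of t] by (simp add: w_def enn2real_positive_iff)
  have "(\<integral>\<^sup>+t. ennreal ((cmod (complex_of_real (w t)))\<^sup>2) \<partial>lborel) = (\<integral>\<^sup>+t. h t \<partial>lborel)"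
    using h(4) by (intro nn_integral_cong) (auto simp: w_def power2_eq_square)
  then have "square_integrable (\<lambda>t. complex_of_real (w t))"
    using h(2) unfolding square_integrable_def
    by (auto intro!: integrableI_nonneg simp: less_top)
  with pos show ?thesis by (rule that)
qed

text \<open>Weighting by a positive square-integrable function turns an \<open>L\<^sup>2\<close>-Cauchy sequence into an
  \<open>L\<^sup>1\<close>-Cauchy one, which has an almost everywhere convergent subsequence.\<close>

lemma L2_Cauchy_convergent:
  fixes X :: "nat \<Rightarrow> 'd::finite L2"
  assumes X: "Cauchy X"
  shows "convergent X"
proof -
  have "\<exists>F. square_integrable F \<and> X n = abs_L2 F" for n by (meson L2_abs_cases)
  then obtain F where F: "\<And>n. square_integrable (F n)" "\<And>n. X n = abs_L2 (F n)" by metis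
  have [measurable]: "F n \<in> borel_measurable borel" for n
    using F(1) by (simp add: square_integrable_def)
  have sqd: "square_integrable (\<lambda>t. F i t - F j t)" for i j
    using square_integrable_add[OF F(1)[of i] square_integrable_cmult[OF F(1)[of j], of "-1"]] by simp
  have dist: "X i - X j = abs_L2 (\<lambda>t. F i t - F j t)" for i j
    by (simp add: F abs_L2_diff)
  obtain w :: "real ^ 'd \<Rightarrow> real" where w: "\<And>t. 0 < w t"
    "square_integrable (\<lambda>t. complex_of_real (w t))"
    using positive_square_integrable by blast
  define W where "W = abs_L2 (\<lambda>t. complex_of_real (w t))"
  define s where "s n t = F n t * complex_of_real (w t)" for n t
  have int_s: "integrable lborel (s n)" for n
    using square_integrable_inner[OF F(1) w(2), of n] by (simp add: s_def[abs_def])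
  have L1: "(LINT t|lborel. norm (s i t - s j t)) \<le> norm (X i - X j) * norm W" for i j
  proof -
    let ?D = "\<lambda>t. complex_of_real (cmod (F i t - F j t))"
    have sqD: "square_integrable ?D"
      using sqd[of i j] by (simp add: square_integrable_def)
    have "norm (s i t - s j t) = cmod (F i t - F j t) * w t" for t
      using w(1)[of t] by (simp add: s_def norm_mult flip: left_diff_distrib)
    then have "complex_of_real (LINT t|lborel. norm (s i t - s j t)) = cinner (abs_L2 ?D) W"
      unfolding W_def cinner_abs_L2[OF sqD w(2)] by (simp flip: integral_complex_of_real)
    moreover have "norm (abs_L2 ?D) = norm (X i - X j)"
    proof -
      have "(norm (abs_L2 ?D))\<^sup>2 = (norm (X i - X j))\<^sup>2"
        unfolding dist norm_abs_L2[OF sqD] norm_abs_L2[OF sqd] by simp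
      then show ?thesis by simp
    qed
    moreover have "Re (cinner (abs_L2 ?D) W) \<le> norm (abs_L2 ?D) * norm W"
      using cmod_cinner_le complex_Re_le_cmod by (rule order_trans[rotated])
    ultimately show ?thesis by (metis Re_complex_of_real)
  qed
  have "\<exists>N. \<forall>i\<ge>N. \<forall>j\<ge>N. (LINT t|lborel. norm (s i t - s j t)) < e" if "e > 0" for e
  proof -
    \<comment> \<open>The summand 1 keeps the quotient meaningful without knowing that
      \<open>W\<close> is nonzero.\<close>
    have "0 < e / (norm W + 1)" using that by (simp add: add_nonneg_pos)
    then obtain N where N: "\<And>i j. i \<ge> N \<Longrightarrow> j \<ge> N \<Longrightarrow> norm (X i - X j) < e / (norm W + 1)"
      using X unfolding Cauchy_iff by metis
    have "(LINT t|lborel. norm (s i t - s j t)) < e" if ij: "i \<ge> N" "j \<ge> N" for i j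
    proof -
      have "(LINT t|lborel. norm (s i t - s j t)) \<le> norm (X i - X j) * (norm W + 1)"
        using L1[of i j] norm_ge_zero[of "X i - X j"] unfolding distrib_left by linarith
      also have "\<dots> < e / (norm W + 1) * (norm W + 1)"
        using N[OF ij] by (intro mult_strict_right_mono) (auto simp: add_nonneg_pos)
      also have "\<dots> = e" using norm_ge_zero[of W] by (simp add: add_nonneg_eq_0_iff)
      finally show ?thesis .
    qed
    then show ?thesis by blast
  qed
  then obtain r where r: "strict_mono r" "AE t in lborel. Cauchy (\<lambda>i. s (r i) t)"
    using cauchy_L1_AE_cauchy_subseq[of lborel s] int_s by blast
  define G where "G t = lim (\<lambda>i. F (r i) t)" for t
  have [measurable]: "G \<in> borel_measurable borel" unfolding G_def by measurable
  have lim: "AE t in lborel. (\<lambda>i. F (r i) t) \<longlonglongrightarrow> G t"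
    using r(2)
  proof eventually_elim
    case (elim t)
    then obtain L where "(\<lambda>i. s (r i) t) \<longlonglongrightarrow> L"
      using Cauchy_convergent by (auto simp: convergent_def)
    then have "(\<lambda>i. s (r i) t / complex_of_real (w t)) \<longlonglongrightarrow> L / complex_of_real (w t)"
      using w(1)[of t] by (intro tendsto_divide) auto
    then have "convergent (\<lambda>i. s (r i) t / complex_of_real (w t))" by (rule convergentI)
    then have "convergent (\<lambda>i. F (r i) t)" using w(1)[of t] by (simp add: s_def)
    then show ?case by (simp add: G_def convergent_LIMSEQ_iff)
  qed
  \<comment> \<open>Fatou's lemma along the subsequence: \<open>G - F n\<close> is the pointwise
    limit of \<open>F (r i) - F n\<close>, whose norms are eventually below
    \<open>e\<close>.\<close>
  have close: "\<exists>N. \<forall>n\<ge>N. square_integrable (\<lambda>t. G t - F n t) \<and> norm (abs_L2 (\<lambda>t. G t - F n t)) \<le> e"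
    if e: "e > 0" for e
  proof -
    obtain N where N: "\<And>i j. i \<ge> N \<Longrightarrow> j \<ge> N \<Longrightarrow> norm (X i - X j) < e"
      using X e unfolding Cauchy_iff by metis
    have "(\<integral>\<^sup>+t. ennreal ((cmod (G t - F n t))\<^sup>2) \<partial>lborel) \<le> ennreal (e\<^sup>2)" if n: "n \<ge> N" for n
    proof -
      have "(\<integral>\<^sup>+t. ennreal ((cmod (G t - F n t))\<^sup>2) \<partial>lborel) =
          (\<integral>\<^sup>+t. liminf (\<lambda>i. ennreal ((cmod (F (r i) t - F n t))\<^sup>2)) \<partial>lborel)"
      proof (rule nn_integral_cong_AE, use lim in eventually_elim)
        fix t assume "(\<lambda>i. F (r i) t) \<longlonglongrightarrow> G t"
        then have "(\<lambda>i. ennreal ((cmod (F (r i) t - F n t))\<^sup>2)) \<longlonglongrightarrow> ennreal ((cmod (G t - F n t))\<^sup>2)"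
          by (intro tendsto_intros)
        then show "ennreal ((cmod (G t - F n t))\<^sup>2) = liminf (\<lambda>i. ennreal ((cmod (F (r i) t - F n t))\<^sup>2))"
          using lim_imp_Liminf[OF sequentially_bot] by metis
      qed
      also have "\<dots> \<le> liminf (\<lambda>i. \<integral>\<^sup>+t. ennreal ((cmod (F (r i) t - F n t))\<^sup>2) \<partial>lborel)"
        by (rule nn_integral_liminf) measurable
      also have "\<dots> \<le> ennreal (e\<^sup>2)"
      proof (rule order_trans[OF Liminf_le_Limsup[OF sequentially_bot] Limsup_bounded])
        show "\<forall>\<^sub>F i in sequentially. (\<integral>\<^sup>+t. ennreal ((cmod (F (r i) t - F n t))\<^sup>2) \<partial>lborel) \<le> ennreal (e\<^sup>2)"
          using eventually_ge_at_top[of N]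
        proof eventually_elim
          case (elim i)
          then have "norm (X (r i) - X n) < e"
            using N n seq_suble[OF r(1), of i] by simp
          then have "(norm (X (r i) - X n))\<^sup>2 \<le> e\<^sup>2"
            by (intro power_mono) auto
          then have "(\<integral>t. (cmod (F (r i) t - F n t))\<^sup>2 \<partial>lborel) \<le> e\<^sup>2"
            unfolding dist norm_abs_L2[OF sqd] .
          then show ?case
            using sqd[of "r i" n]
            by (subst nn_integral_eq_integral) (auto simp: square_integrable_def)
        qed
      qed
      finally show ?thesis .
    qed
    then show ?thesis
      using e by (intro exI[of _ N] allI impI conjI norm_abs_L2_le[where c = e]) auto
  qed
  obtain N where "square_integrable (\<lambda>t. G t - F N t)" using close[of 1] by auto
  from square_integrable_add[OF this F(1)[of N]] have G: "square_integrable G" by simp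
  have "X \<longlonglongrightarrow> abs_L2 G"
  proof (rule LIMSEQ_I)
    fix e :: real assume "e > 0"
    then obtain N where N: "\<And>n. n \<ge> N \<Longrightarrow> norm (abs_L2 (\<lambda>t. G t - F n t)) \<le> e / 2"
      using close[of "e/2"] by auto
    have "norm (X n - abs_L2 G) < e" if "n \<ge> N" for n
      using N[OF that] \<open>e > 0\<close> G F
      by (simp add: abs_L2_diff norm_minus_commute)
    then show "\<exists>no. \<forall>n\<ge>no. norm (X n - abs_L2 G) < e" by blast
  qed
  then show ?thesis by (rule convergentI)
qed

instance L2 :: (finite) banach
  by standard (rule L2_Cauchy_convergent)

text \<open>The Cauchy criterion for unordered sums: two partial sums over sets containing
  \<open>F0\<close> differ only by sums outside \<open>F0\<close>.\<close>

lemma summable_on_banachI: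
  fixes f :: "'i \<Rightarrow> 'b::banach"
  assumes "\<And>e. e > 0 \<Longrightarrow> \<exists>F0. finite F0 \<and> F0 \<subseteq> A \<and>
    (\<forall>F. finite F \<longrightarrow> F \<subseteq> A - F0 \<longrightarrow> norm (sum f F) < e)"
  shows "f summable_on A"
proof -
  have "\<exists>P. eventually P (finite_subsets_at_top A) \<and>
      (\<forall>F F'. P F \<and> P F' \<longrightarrow> dist (sum f F) (sum f F') < e)" if "e > 0" for e
  proof -
    obtain F0 where F0: "finite F0" "F0 \<subseteq> A"
      "\<And>F. finite F \<Longrightarrow> F \<subseteq> A - F0 \<Longrightarrow> norm (sum f F) < e / 2"
      using assms[of "e/2"] \<open>e > 0\<close> by auto
    let ?P = "\<lambda>F. finite F \<and> F0 \<subseteq> F \<and> F \<subseteq> A"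
    have "dist (sum f F) (sum f F') < e" if "?P F" "?P F'" for F F'
    proof -
      have "sum f F - sum f F' = sum f (F - F0) - sum f (F' - F0)"
        using that by (simp add: sum_diff)
      also have "norm \<dots> \<le> norm (sum f (F - F0)) + norm (sum f (F' - F0))"
        by (rule norm_triangle_ineq4)
      also have "\<dots> < e / 2 + e / 2"
        using that by (intro add_strict_mono F0) auto
      finally show ?thesis by (simp add: dist_norm)
    qed
    moreover have "eventually ?P (finite_subsets_at_top A)"
      using F0 by (auto simp: eventually_finite_subsets_at_top)
    ultimately show ?thesis by (intro exI[of _ ?P]) blast
  qed
  then have "cauchy_filter (filtermap (sum f) (finite_subsets_at_top A))"
    by (simp add: cauchy_filter_metric_filtermap)
  moreover have "complete (UNIV :: 'b set)"
    by (meson Cauchy_convergent UNIV_I complete_def convergent_def)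
  ultimately obtain L where "(sum f \<longlongrightarrow> L) (finite_subsets_at_top A)"
    using complete_uniform[where S = UNIV] by (force simp: filterlim_def)
  then show ?thesis by (auto simp: summable_on_def has_sum_def)
qed

section \<open>Orthonormal families and bases\<close>

lemma orthonormal_on_subset: "orthonormal_on N e \<Longrightarrow> M \<subseteq> N \<Longrightarrow> orthonormal_on M e"
  unfolding orthonormal_on_def by blast

lemma orthonormal_cinner:
  "orthonormal_on N e \<Longrightarrow> m \<in> N \<Longrightarrow> n \<in> N \<Longrightarrow> cinner (e m) (e n) = (if m = n then 1 else 0)"
  by (simp add: orthonormal_on_def)

lemma orthonormal_norm:
  assumes "orthonormal_on N e" "n \<in> N"
  shows "norm (e n) = 1"
proof -
  have "complex_of_real ((norm (e n))\<^sup>2) = complex_of_real 1"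
    using orthonormal_cinner[OF assms assms(2)] by (simp add: cinner_same[symmetric] del: of_real_power)
  then have "(norm (e n))\<^sup>2 = 1\<^sup>2" by (simp only: of_real_eq_iff) simp
  then show ?thesis by (rule power2_eq_imp_eq) simp_all
qed

lemma norm_orthonormal_sum:
  assumes e: "orthonormal_on F e" and "finite F"
  shows "(norm (\<Sum>n\<in>F. c n *\<^sub>C e n))\<^sup>2 = (\<Sum>n\<in>F. (cmod (c n))\<^sup>2)"
proof -
  have "complex_of_real ((norm (\<Sum>n\<in>F. c n *\<^sub>C e n))\<^sup>2) =
      (\<Sum>n\<in>F. \<Sum>m\<in>F. c n * cnj (c m) * cinner (e n) (e m))"
    unfolding cinner_same[symmetric]
    by (simp add: cinner.sum_left cinner.sum_right cinner_scaleC_left cinner_scaleC_right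
        sum_distrib_left mult.assoc mult.left_commute) (rule sum.swap)
  also have "\<dots> = (\<Sum>n\<in>F. \<Sum>m\<in>F. if m = n then c n * cnj (c n) else 0)"
    by (intro sum.cong refl) (auto simp: orthonormal_cinner[OF e])
  also have "\<dots> = (\<Sum>n\<in>F. complex_of_real ((cmod (c n))\<^sup>2))"
    using \<open>finite F\<close> by (simp add: complex_norm_square del: of_real_power)
  finally show ?thesis by (simp only: of_real_sum[symmetric] of_real_eq_iff)
qed

lemma Bessel_finite:
  assumes e: "orthonormal_on F e" and "finite F"
  shows "(\<Sum>n\<in>F. (cmod (cinner x (e n)))\<^sup>2) \<le> (norm x)\<^sup>2"
proof -
  let ?y = "\<Sum>n\<in>F. cinner x (e n) *\<^sub>C e n"
  have xy: "cinner x ?y = (\<Sum>n\<in>F. complex_of_real ((cmod (cinner x (e n)))\<^sup>2))"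
    by (simp add: cinner.sum_right cinner_scaleC_right complex_norm_square mult.commute del: of_real_power)
  have "0 \<le> (norm (x - ?y))\<^sup>2" by simp
  also have "(norm (x - ?y))\<^sup>2 = (norm x)\<^sup>2 - 2 * Re (cinner x ?y) + (norm ?y)\<^sup>2"
    by (simp add: power2_norm_eq_inner inner_diff_left inner_diff_right inner_commute)
      (simp add: inner_L2_def)
  also have "\<dots> = (norm x)\<^sup>2 - (\<Sum>n\<in>F. (cmod (cinner x (e n)))\<^sup>2)"
    unfolding xy norm_orthonormal_sum[OF assms] by (simp del: of_real_power)
  finally show ?thesis by simp
qed

lemma Bessel_summable:
  assumes e: "orthonormal_on N e"
  shows "(\<lambda>n. (cmod (cinner x (e n)))\<^sup>2) summable_on N"
proof -
  have "(\<Sum>n\<in>F. (cmod (cinner x (e n)))\<^sup>2) \<le> (norm x)\<^sup>2" if "finite F" "F \<subseteq> N" for F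
    using that orthonormal_on_subset[OF e] by (intro Bessel_finite) auto
  then show ?thesis by (intro nonneg_bdd_above_summable_on) (auto simp: bdd_above_def)
qed

lemma nonneg_summable_tail:
  fixes f :: "'i \<Rightarrow> real"
  assumes "f summable_on A" "\<And>x. x \<in> A \<Longrightarrow> 0 \<le> f x" "e > 0"
  obtains F0 where "finite F0" "F0 \<subseteq> A" "\<And>F. finite F \<Longrightarrow> F \<subseteq> A - F0 \<Longrightarrow> sum f F < e"
proof -
  have "(sum f \<longlongrightarrow> infsum f A) (finite_subsets_at_top A)"
    using assms(1) infsum_tendsto by blast
  then have "\<forall>\<^sub>F F in finite_subsets_at_top A. dist (sum f F) (infsum f A) < e"
    using assms(3) by (simp add: tendsto_iff)
  then obtain F0 where F0: "finite F0" "F0 \<subseteq> A"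
    "\<And>F. finite F \<Longrightarrow> F0 \<subseteq> F \<Longrightarrow> F \<subseteq> A \<Longrightarrow> dist (sum f F) (infsum f A) < e"
    by (auto simp: eventually_finite_subsets_at_top)
  have "sum f F < e" if F: "finite F" "F \<subseteq> A - F0" for F
  proof -
    have "sum f (F \<union> F0) \<le> infsum f A"
      using F F0 assms by (intro finite_sum_le_infsum) auto
    moreover have "sum f (F \<union> F0) = sum f F + sum f F0"
      using F F0 by (intro sum.union_disjoint) auto
    moreover have "dist (sum f F0) (infsum f A) < e" using F0 by auto
    ultimately show ?thesis by (simp add: dist_real_def)
  qed
  with F0 that show ?thesis by blast
qed

lemma orthonormal_summable:
  assumes e: "orthonormal_on N e" and c: "(\<lambda>n. (cmod (c n))\<^sup>2) summable_on N"
  shows "(\<lambda>n. c n *\<^sub>C e n) summable_on N"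
proof (rule summable_on_banachI)
  fix \<epsilon> :: real assume "\<epsilon> > 0"
  then obtain F0 where F0: "finite F0" "F0 \<subseteq> N"
    "\<And>F. finite F \<Longrightarrow> F \<subseteq> N - F0 \<Longrightarrow> (\<Sum>n\<in>F. (cmod (c n))\<^sup>2) < \<epsilon>\<^sup>2"
    using nonneg_summable_tail[OF c, of "\<epsilon>\<^sup>2"] by auto
  have "norm (\<Sum>n\<in>F. c n *\<^sub>C e n) < \<epsilon>" if "finite F" "F \<subseteq> N - F0" for F
  proof -
    have "orthonormal_on F e" using that by (intro orthonormal_on_subset[OF e]) auto
    then have "(norm (\<Sum>n\<in>F. c n *\<^sub>C e n))\<^sup>2 < \<epsilon>\<^sup>2"
      using F0(3)[OF that] that by (simp add: norm_orthonormal_sum)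
    then show ?thesis using \<open>\<epsilon> > 0\<close> by (simp add: power2_less_imp_less)
  qed
  with F0 show "\<exists>F0. finite F0 \<and> F0 \<subseteq> N \<and>
      (\<forall>F. finite F \<longrightarrow> F \<subseteq> N - F0 \<longrightarrow> norm (\<Sum>n\<in>F. c n *\<^sub>C e n) < \<epsilon>)" by blast
qed

text \<open>Zorn's lemma applies because any two vectors from the union of a chain lie in one of its
  members. \<open>V\<close> is left arbitrary: \<open>UNIV\<close> gives orthonormal bases, a set of
  eigenvectors gives singular vectors.\<close>

lemma maximal_orthonormal_subset:
  fixes V :: "'d::finite L2 set"
  obtains E where "E \<subseteq> V" "orthonormal_on E (\<lambda>e. e)"
    "\<And>f. f \<in> V \<Longrightarrow> norm f = 1 \<Longrightarrow> (\<And>e. e \<in> E \<Longrightarrow> cinner f e = 0) \<Longrightarrow> False"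
proof -
  let ?A = "{E. E \<subseteq> V \<and> orthonormal_on E (\<lambda>e. e)}"
  have "\<exists>M\<in>?A. \<forall>X\<in>?A. M \<subseteq> X \<longrightarrow> X = M"
  proof (rule subset_Zorn')
    fix C assume C: "subset.chain ?A C"
    have "cinner e f = (if e = f then 1 else 0)" if "e \<in> \<Union>C" "f \<in> \<Union>C" for e f
    proof -
      obtain X where X: "X \<in> C" "e \<in> X" "f \<in> X"
      proof -
        obtain X Y where "X \<in> C" "Y \<in> C" "e \<in> X" "f \<in> Y" using \<open>e \<in> \<Union>C\<close> \<open>f \<in> \<Union>C\<close> by blast
        moreover from this have "X \<subseteq> Y \<or> Y \<subseteq> X" using C by (simp add: subset_chain_def)
        ultimately show thesis using that by blast
      qed
      moreover from X C have "orthonormal_on X (\<lambda>e. e)" by (auto simp: subset.chain_def)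
      ultimately show ?thesis by (simp add: orthonormal_on_def)
    qed
    moreover have "\<Union>C \<subseteq> V" using C by (auto simp: subset.chain_def)
    ultimately show "\<Union>C \<in> ?A" by (simp add: orthonormal_on_def)
  qed
  then obtain E where EA: "E \<in> ?A" and max: "\<forall>X\<in>?A. E \<subseteq> X \<longrightarrow> X = E" by (rule bexE)
  have E: "E \<subseteq> V" "orthonormal_on E (\<lambda>e. e)" using EA by simp_all
  show ?thesis
  proof (rule that[OF E(1,2)])
    fix f assume f: "f \<in> V" "norm f = 1" "\<And>e. e \<in> E \<Longrightarrow> cinner f e = 0"
    have f1: "cinner f f = 1" using f by (simp add: cinner_same)
    then have "f \<notin> E" using f(3) by fastforce
    have f3': "cinner e f = 0" if "e \<in> E" for e
      using f(3)[OF that] cinner_commute[of e f] by simp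
    have "orthonormal_on (insert f E) (\<lambda>e. e)"
      using E(2) f(3) f1 \<open>f \<notin> E\<close> f3' unfolding orthonormal_on_def by auto
    then have "insert f E \<in> ?A" using E(1) f(1) by simp
    then have "insert f E = E" using max by (meson subset_insertI)
    then show False using \<open>f \<notin> E\<close> by blast
  qed
qed

lemma orthonormal_basis_exists: "\<exists>E :: 'd::finite L2 set. orthonormal_basis E"
proof -
  obtain E :: "'d L2 set" where E: "orthonormal_on E (\<lambda>e. e)"
    "\<And>f. norm f = 1 \<Longrightarrow> (\<And>e. e \<in> E \<Longrightarrow> cinner f e = 0) \<Longrightarrow> False"
    using maximal_orthonormal_subset[of UNIV] by auto
  have "f = 0" if "\<And>e. e \<in> E \<Longrightarrow> cinner f e = 0" for f
  proof (rule ccontr)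
    assume "f \<noteq> 0"
    then have "norm ((1 / norm f) *\<^sub>R f) = 1" by simp
    moreover have "cinner ((1 / norm f) *\<^sub>R f) e = 0" if "e \<in> E" for e
      using \<open>\<And>e. e \<in> E \<Longrightarrow> cinner f e = 0\<close>[OF that] by (simp only: cinner.scaleR_left) simp
    ultimately show False using E(2) by blast
  qed
  with E(1) show ?thesis unfolding orthonormal_basis_def by blast
qed

text \<open>Bessel's inequality makes the series converge; \<open>x\<close> minus its sum is
  orthogonal to the whole basis and therefore 0.\<close>

lemma orthonormal_basis_expansion:
  assumes E: "orthonormal_basis E"
  shows "((\<lambda>e. cinner x e *\<^sub>C e) has_sum x) E"
proof -
  have on: "orthonormal_on E (\<lambda>e. e)" using E by (simp add: orthonormal_basis_def)
  have "(\<lambda>e. cinner x e *\<^sub>C e) summable_on E"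
    by (intro orthonormal_summable[OF on] Bessel_summable[OF on])
  then obtain y where y: "((\<lambda>e. cinner x e *\<^sub>C e) has_sum y) E" by (auto simp: summable_on_def)
  have "cinner (x - y) e = 0" if e: "e \<in> E" for e
  proof -
    have "((\<lambda>f. cinner (cinner x f *\<^sub>C f) e) has_sum cinner y e) E"
      by (rule has_sum_bounded_linear[OF cinner.bounded_linear_left y])
    moreover have "((\<lambda>f. cinner (cinner x f *\<^sub>C f) e) has_sum cinner x e) E"
      using e by (intro has_sum_finite_neutralI[of "{e}"])
        (auto simp: cinner_scaleC_left orthonormal_cinner[OF on])
    ultimately show ?thesis using has_sum_unique by (fastforce simp: cinner.diff_left)
  qed
  then have "x - y = 0" using E unfolding orthonormal_basis_def by blast
  then show ?thesis using y by simp
qed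

lemma Parseval:
  assumes "orthonormal_basis E"
  shows "((\<lambda>e. cinner x e * cinner e y) has_sum cinner x y) E"
  using has_sum_bounded_linear[OF cinner.bounded_linear_left orthonormal_basis_expansion[OF assms],
      of x y] by (simp add: cinner_scaleC_left)

section \<open>Separability\<close>

text \<open>The indicators of the bounded pieces of a countable, intersection-stable generator of the
  Borel sets form a total set.\<close>

lemma L2_countable_total:
  obtains D :: "'d::finite L2 set" where "countable D"
    "\<And>f. (\<And>g. g \<in> D \<Longrightarrow> cinner f g = 0) \<Longrightarrow> f = 0"
proof -
  obtain B :: "(real ^ 'd) set set" where B: "countable B" "topological_basis B"
    using ex_countable_basis by blast
  \<comment> \<open>Closure under finite intersections is what the Dynkin argument requires; the
    empty intersection contributes \<open>UNIV\<close>, which settles the case of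
    complements.\<close>
  define J where "J = Inter ` {F. finite F \<and> F \<subseteq> B}"
  have countable_J: "countable J"
    unfolding J_def using B(1) by (intro countable_image countable_Collect_finite_subset)
  have open_J: "open U" if "U \<in> J" for U
    using that topological_basis_open[OF B(2)] by (auto simp: J_def)
  have UNIV_J: "UNIV \<in> J" unfolding J_def by (rule image_eqI[of _ _ "{}"]) auto
  have stable_J: "Int_stable J"
  proof (rule Int_stableI)
    fix U V assume "U \<in> J" "V \<in> J"
    then obtain F G where "U = \<Inter>F" "V = \<Inter>G" "finite F" "F \<subseteq> B" "finite G" "G \<subseteq> B"
      by (auto simp: J_def)
    then show "U \<inter> V \<in> J" unfolding J_def by (intro image_eqI[of _ _ "F \<union> G"]) auto
  qed
  have sets_J: "sets borel = sigma_sets UNIV J"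
  proof
    have "B \<subseteq> J" unfolding J_def by (auto intro: image_eqI[of _ _ "{U}" for U])
    then have "sigma_sets UNIV B \<subseteq> sigma_sets UNIV J" by (rule sigma_sets_mono')
    then show "sets borel \<subseteq> sigma_sets UNIV J" by (simp add: borel_eq_countable_basis[OF B])
    show "sigma_sets UNIV J \<subseteq> sets borel"
      using open_J by (intro sets.sigma_sets_subset[of J borel, simplified]) auto
  qed
  \<comment> \<open>Cutting with balls makes the indicators square integrable even for sets of
    infinite measure, and the balls exhaust the space.\<close>
  define ind :: "nat \<Rightarrow> (real ^ 'd) set \<Rightarrow> real ^ 'd \<Rightarrow> complex"
    where "ind n U t = indicator (U \<inter> ball 0 (real n)) t" for n U t
  have sq_ind: "square_integrable (ind n U)" if "U \<in> J" for n U
  proof -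
    have m: "U \<inter> ball 0 (real n) \<in> sets borel" using open_J[OF that] by (intro sets.Int) auto
    have "emeasure lborel (U \<inter> ball 0 (real n)) \<le> emeasure lborel (ball 0 (real n) :: (real ^ 'd) set)"
      by (intro emeasure_mono) auto
    also have "\<dots> < \<infinity>" by (rule emeasure_bounded_finite) simp
    finally have "integrable lborel (indicator (U \<inter> ball 0 (real n)) :: real ^ 'd \<Rightarrow> real)"
      using m by (simp add: integrable_indicator_iff)
    moreover have "(\<lambda>t. (cmod (ind n U t))\<^sup>2) = indicator (U \<inter> ball 0 (real n))"
      by (auto simp: ind_def indicator_def)
    ultimately show ?thesis
      using m unfolding square_integrable_def ind_def[abs_def] by auto
  qed
  define D where "D = (\<lambda>(n, U). abs_L2 (ind n U)) ` (UNIV \<times> J)"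
  have "f = 0" if f: "\<And>g. g \<in> D \<Longrightarrow> cinner f g = 0" for f
  proof -
    obtain F where F: "square_integrable F" "f = abs_L2 F" by (meson L2_abs_cases)
    have [measurable]: "F \<in> borel_measurable borel" using F(1) by (simp add: square_integrable_def)
    \<comment> \<open>A function with zero integral over every Borel set vanishes almost everywhere,
      and the sets with zero integral form a Dynkin system containing \<open>J\<close>.\<close>
    have "AE t in lborel. indicator (ball 0 (real n)) t *\<^sub>R F t = 0" for n
    proof (rule sigma_finite_measure.density_zero[OF sigma_finite_lborel])
      let ?\<phi> = "\<lambda>t. indicator (ball 0 (real n)) t *\<^sub>R F t"
      have "integrable lborel (\<lambda>t. F t * cnj (ind n UNIV t))"
        by (intro square_integrable_inner F sq_ind UNIV_J)
      also have "(\<lambda>t. F t * cnj (ind n UNIV t)) = ?\<phi>"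
        by (auto simp: ind_def indicator_def)
      finally show int: "integrable lborel ?\<phi>" .
      have set_int: "set_integrable lborel A ?\<phi>" if "A \<in> sets borel" for A
        unfolding set_integrable_def by (rule integrable_mult_indicator[OF _ int]) (simp add: that)
      have basic: "set_lebesgue_integral lborel U ?\<phi> = 0" if U: "U \<in> J" for U
      proof -
        have "cinner f (abs_L2 (ind n U)) = 0" using U by (intro f) (auto simp: D_def)
        then have "(\<integral>t. F t * cnj (ind n U t) \<partial>lborel) = 0"
          using F sq_ind[OF U] by (simp add: cinner_abs_L2)
        also have "(\<lambda>t. F t * cnj (ind n U t)) = (\<lambda>t. indicator U t *\<^sub>R ?\<phi> t)"
          by (auto simp: ind_def indicator_def)
        finally show ?thesis by (simp add: set_lebesgue_integral_def)
      qed
      fix A :: "(real ^ 'd) set" assume "A \<in> sets lborel"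
      then have A: "A \<in> sigma_sets UNIV J" by (simp add: sets_J)
      have "J \<subseteq> Pow UNIV" by simp
      from stable_J this A show "set_lebesgue_integral lborel A ?\<phi> = 0"
      proof (induction rule: sigma_sets_induct_disjoint)
        case (compl A)
        then have A: "A \<in> sets borel" by (simp add: sets_J)
        have "set_lebesgue_integral lborel (A \<union> (UNIV - A)) ?\<phi> =
            set_lebesgue_integral lborel A ?\<phi> + set_lebesgue_integral lborel (UNIV - A) ?\<phi>"
          using A by (intro set_integral_Un set_int) auto
        then show ?case using compl basic[OF UNIV_J] by simp
      next
        case (union A)
        then have A: "A i \<in> sets borel" for i by (auto simp: sets_J)
        have "set_lebesgue_integral lborel (\<Union>i. A i) ?\<phi> = (\<Sum>i. set_lebesgue_integral lborel (A i) ?\<phi>)"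
          using A union by (intro lebesgue_integral_countable_add set_int) (auto simp: disjoint_family_on_def)
        then show ?case using union by simp
      qed (use basic in \<open>auto simp: set_lebesgue_integral_def\<close>)
    qed
    then have "AE t in lborel. \<forall>n. indicator (ball 0 (real n)) t *\<^sub>R F t = 0"
      by (simp only: AE_all_countable) blast
    then have "AE t in lborel. (cmod (F t))\<^sup>2 = 0"
    proof eventually_elim
      case (elim t)
      obtain n where "norm t < real n" using reals_Archimedean2 by blast
      then show ?case using elim[rule_format, of n] by simp
    qed
    then have "(norm f)\<^sup>2 = 0" unfolding F(2) norm_abs_L2[OF F(1)] by (rule integral_eq_zero_AE)
    then show ?thesis by simp
  qed
  moreover have "countable D" unfolding D_def using countable_J by auto
  ultimately show ?thesis using that by blast
qed

text \<open>Each vector of \<open>E\<close> has a nonzero coefficient against some member of a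
  countable total set, and by Bessel each such member meets only countably many vectors of
  \<open>E\<close>. Indexing singular values by naturals and measurability of sums over a basis
  depend on this.\<close>

lemma orthonormal_countable:
  fixes E :: "'d::finite L2 set"
  assumes E: "orthonormal_on E (\<lambda>e. e)"
  shows "countable E"
proof -
  obtain D :: "'d L2 set" where D: "countable D" "\<And>f. (\<And>g. g \<in> D \<Longrightarrow> cinner f g = 0) \<Longrightarrow> f = 0"
    using L2_countable_total by blast
  have "countable {e \<in> E. cinner g e \<noteq> 0}" for g
    using abs_summable_countable[of "\<lambda>e. (cmod (cinner g e))\<^sup>2" E] Bessel_summable[OF E, of g] by simp
  then have "countable (\<Union>g\<in>D. {e \<in> E. cinner g e \<noteq> 0})" using D(1) by blast
  moreover have "E \<subseteq> (\<Union>g\<in>D. {e \<in> E. cinner g e \<noteq> 0})"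
  proof
    fix e assume e: "e \<in> E"
    then have "e \<noteq> 0" using orthonormal_norm[OF E e] by auto
    then obtain g where "g \<in> D" "cinner e g \<noteq> 0" using D(2) by blast
    then show "e \<in> (\<Union>g\<in>D. {e \<in> E. cinner g e \<noteq> 0})"
      using e cinner_commute[of g e] by (auto intro!: bexI[of _ g])
  qed
  ultimately show ?thesis by (rule countable_subset[rotated])
qed

section \<open>Riesz representation, adjoints and traces\<close>

lemma Riesz:
  fixes \<phi> :: "'d::finite L2 \<Rightarrow> complex"
  assumes add: "\<And>x y. \<phi> (x + y) = \<phi> x + \<phi> y" and scale: "\<And>c x. \<phi> (c *\<^sub>C x) = c * \<phi> x"
    and bound: "\<And>x. cmod (\<phi> x) \<le> K * norm x" and "0 \<le> K"
  obtains y where "\<And>x. \<phi> x = cinner x y" "norm y \<le> K"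
proof -
  have lin: "bounded_linear \<phi>"
    by (rule bounded_linear_intro[of _ K])
      (auto simp: add scale scaleR_scaleC scaleR_conv_of_real mult.commute[of _ K] intro: bound)
  interpret \<phi>: bounded_linear \<phi> by fact
  obtain E :: "'d L2 set" where E: "orthonormal_basis E" using orthonormal_basis_exists by blast
  then have on: "orthonormal_on E (\<lambda>e. e)" by (simp add: orthonormal_basis_def)
  \<comment> \<open>On a partial sum \<open>?y\<close> of the future representing vector, \<phi>
    takes the value \<open>(norm ?y) ^ 2\<close>, which is at most \<open>K * norm ?y\<close>; so
    the coefficients are square summable.\<close>
  have bdd: "(\<Sum>e\<in>F. (cmod (cnj (\<phi> e)))\<^sup>2) \<le> K\<^sup>2" if F: "finite F" "F \<subseteq> E" for F
  proof -
    let ?y = "\<Sum>e\<in>F. cnj (\<phi> e) *\<^sub>C e" and ?s = "\<Sum>e\<in>F. (cmod (cnj (\<phi> e)))\<^sup>2"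
    have "orthonormal_on F (\<lambda>e. e)" using on F orthonormal_on_subset by blast
    then have y: "(norm ?y)\<^sup>2 = ?s" by (rule norm_orthonormal_sum) fact
    have "\<phi> ?y = complex_of_real ?s"
      by (simp add: \<phi>.sum scale complex_norm_square mult.commute del: of_real_power)
    then have "cmod (\<phi> ?y) = ?s" by (simp add: sum_nonneg del: of_real_sum)
    then have "(norm ?y)\<^sup>2 \<le> K * norm ?y" using bound[of ?y] y by simp
    then have "norm ?y \<le> K" using \<open>0 \<le> K\<close> by (cases "norm ?y = 0") (auto simp: power2_eq_square)
    then show ?thesis unfolding y[symmetric] by (intro power_mono) auto
  qed
  then have "(\<lambda>e. (cmod (cnj (\<phi> e)))\<^sup>2) summable_on E"
    by (intro nonneg_bdd_above_summable_on) (auto simp: bdd_above_def)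
  then have "(\<lambda>e. cnj (\<phi> e) *\<^sub>C e) summable_on E" by (rule orthonormal_summable[OF on])
  then obtain y where y: "((\<lambda>e. cnj (\<phi> e) *\<^sub>C e) has_sum y) E" by (auto simp: summable_on_def)
  have eq: "\<phi> x = cinner x y" for x
  proof -
    have "((\<lambda>e. cinner x (cnj (\<phi> e) *\<^sub>C e)) has_sum cinner x y) E"
      by (rule has_sum_bounded_linear[OF cinner.bounded_linear_right y])
    moreover have "((\<lambda>e. \<phi> (cinner x e *\<^sub>C e)) has_sum \<phi> x) E"
      by (rule has_sum_bounded_linear[OF lin orthonormal_basis_expansion[OF E]])
    ultimately show ?thesis
      using has_sum_unique by (fastforce simp: scale cinner_scaleC_right mult.commute)
  qed
  have "(norm y)\<^sup>2 \<le> K * norm y" using bound[of y] by (simp add: eq cinner_same norm_power)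
  then have "norm y \<le> K" using \<open>0 \<le> K\<close> by (cases "norm y = 0") (auto simp: power2_eq_square)
  with eq show ?thesis by (rule that)
qed

text \<open>For fixed \<open>x\<close> the functional \<open>cnj (B x z)\<close> is linear in
  \<open>z\<close>, and its Riesz vector is the value of the operator at \<open>x\<close>. Adjoints
  and \<open>measure_conv\<close> are both obtained in this way.\<close>

lemma sesquilinear_operator:
  fixes B :: "'d::finite L2 \<Rightarrow> 'd L2 \<Rightarrow> complex"
  assumes "\<And>x y z. B (x + y) z = B x z + B y z" "\<And>c x z. B (c *\<^sub>C x) z = c * B x z"
    and "\<And>x y z. B x (y + z) = B x y + B x z" "\<And>c x z. B x (c *\<^sub>C z) = cnj c * B x z"
    and bound: "\<And>x y. cmod (B x y) \<le> K * norm x * norm y" and "0 \<le> K"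
  obtains A where "complex_linear A" "\<And>x y. cinner (blinfun_apply A x) y = B x y" "norm A \<le> K"
proof -
  have "\<exists>y. (\<forall>z. cnj (B x z) = cinner z y) \<and> norm y \<le> K * norm x" for x
    by (rule Riesz[of "\<lambda>z. cnj (B x z)" "K * norm x"]) (use assms in auto)
  then obtain A where A: "\<And>x z. cnj (B x z) = cinner z (A x)" "\<And>x. norm (A x) \<le> K * norm x"
    by metis
  have AB: "cinner (A x) z = B x z" for x z
    by (metis A(1) cinner_commute complex_cnj_cnj)
  have "bounded_linear A"
  proof (rule bounded_linear_intro)
    show "A (x + y) = A x + A y" for x y by (rule cinner_eqI) (simp add: AB cinner_add_left assms)
    show "A (r *\<^sub>R x) = r *\<^sub>R A x" for r x
      by (rule cinner_eqI) (simp add: AB scaleR_scaleC cinner_scaleC_left assms)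
    show "norm (A x) \<le> norm x * K" for x using A(2)[of x] by (simp add: mult.commute)
  qed
  then have app: "blinfun_apply (Blinfun A) = A" by (rule bounded_linear_Blinfun_apply)
  show ?thesis
  proof (rule that[of "Blinfun A"])
    show "complex_linear (Blinfun A)"
      unfolding complex_linear_def app
      by (intro allI cinner_eqI) (simp add: AB cinner_scaleC_left assms)
    show "norm (Blinfun A) \<le> K"
      using A(2) \<open>0 \<le> K\<close> by (intro norm_blinfun_bound) (auto simp: app)
  qed (simp add: app AB)
qed

lemma op_adjoint_eqI:
  assumes "\<And>f g. cinner (blinfun_apply T f) g = cinner f (blinfun_apply B g)"
  shows "op_adjoint T = B"
  unfolding op_adjoint_def
proof (rule the_equality)
  fix C assume C: "\<forall>f g. cinner (blinfun_apply T f) g = cinner f (blinfun_apply C g)"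
  have "blinfun_apply C g = blinfun_apply B g" for g
    by (rule cinner_eqI) (metis C assms cinner_commute)
  then show "C = B" by (intro blinfun_eqI)
qed (use assms in blast)

lemma
  assumes T: "complex_linear T"
  shows cinner_adjoint: "cinner (blinfun_apply T f) g = cinner f (blinfun_apply (op_adjoint T) g)"
    and complex_linear_adjoint: "complex_linear (op_adjoint T)"
proof -
  have "cmod (cinner g (blinfun_apply T f)) \<le> norm T * norm g * norm f" for f g
  proof -
    have "cmod (cinner g (blinfun_apply T f)) \<le> norm g * norm (blinfun_apply T f)"
      by (rule cmod_cinner_le)
    also have "\<dots> \<le> norm g * (norm T * norm f)" by (intro mult_left_mono norm_blinfun) auto
    finally show ?thesis by (simp add: mult_ac)
  qed
  note bound = this
  obtain B where B: "complex_linear B"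
    "\<And>g f. cinner (blinfun_apply B g) f = cinner g (blinfun_apply T f)"
  proof (rule sesquilinear_operator[of "\<lambda>g f. cinner g (blinfun_apply T f)" "norm T"])
    show "cinner x (blinfun_apply T (c *\<^sub>C z)) = cnj c * cinner x (blinfun_apply T z)" for x c z
      using T by (simp add: complex_linear_def cinner_scaleC_right)
  qed (use bound in \<open>auto simp: cinner_add_left cinner_add_right cinner_scaleC_left blinfun.add_right\<close>)
  have "op_adjoint T = B"
    by (rule op_adjoint_eqI) (metis B(2) cinner_commute)
  moreover have "cinner (blinfun_apply T f) g = cinner f (blinfun_apply B g)" for f g
    by (metis B(2) cinner_commute)
  ultimately show "cinner (blinfun_apply T f) g = cinner f (blinfun_apply (op_adjoint T) g)"
    "complex_linear (op_adjoint T)" using B(1) by auto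
qed

lemma cinner_adjoint':
  "complex_linear T \<Longrightarrow> cinner f (blinfun_apply T g) = cinner (blinfun_apply (op_adjoint T) f) g"
  by (metis cinner_adjoint cinner_commute)

text \<open>Cauchy-Schwarz for finite sums, then Bessel for both families. For unit vectors it
  bounds the row and column sums of the matrix of coefficient products by 1.\<close>

lemma Bessel_Cauchy_Schwarz:
  assumes "finite F" "orthonormal_on F e" "orthonormal_on F g"
  shows "(\<Sum>n\<in>F. cmod (cinner x (e n)) * cmod (cinner (g n) y)) \<le> norm x * norm y"
proof -
  have *: "L2_set (\<lambda>n. cmod (cinner z (h n))) F \<le> norm z" if "orthonormal_on F h" for h z
    unfolding L2_set_def using Bessel_finite[OF that assms(1), of z] real_le_lsqrt by force
  have "(\<Sum>n\<in>F. cmod (cinner x (e n)) * cmod (cinner (g n) y)) =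
      (\<Sum>n\<in>F. \<bar>cmod (cinner x (e n))\<bar> * \<bar>cmod (cinner y (g n))\<bar>)"
    by (intro sum.cong refl) (metis abs_norm_cancel cinner_commute complex_mod_cnj)
  also have "\<dots> \<le> L2_set (\<lambda>n. cmod (cinner x (e n))) F * L2_set (\<lambda>n. cmod (cinner y (g n))) F"
    by (rule L2_set_mult_ineq)
  also have "\<dots> \<le> norm x * norm y"
    using assms by (intro mult_mono * L2_set_nonneg) auto
  finally show ?thesis .
qed

text \<open>By \<open>Bessel_Cauchy_Schwarz\<close> the double family over \<open>N\<close> and a
  basis is absolutely summable, so the summations can be exchanged. The sum over \<open>N\<close>
  does not mention the basis, which is why \<open>op_trace\<close> is well defined here.\<close>

lemma nuclear_trace_has_sum:
  fixes T :: "'d::finite operator"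
  assumes T: "\<And>x y. ((\<lambda>n. cinner x (u n) * cinner (v n) y) has_sum cinner (blinfun_apply T x) y) N"
    and summable: "(\<lambda>n. norm (u n) * norm (v n)) summable_on N"
  shows "((\<lambda>n. cinner (v n) (u n)) has_sum op_trace T) N"
proof -
  have "(\<lambda>n. cinner (v n) (u n)) summable_on N"
    using summable by (rule abs_summable_summable[OF summable_on_comparison_test])
      (auto simp: mult.commute intro: cmod_cinner_le[THEN order_trans])
  then obtain s where s: "((\<lambda>n. cinner (v n) (u n)) has_sum s) N" by (auto simp: summable_on_def)
  have *: "((\<lambda>e. cinner (blinfun_apply T e) e) has_sum s) E" if E: "orthonormal_basis E" for E
  proof -
    have on: "orthonormal_on E (\<lambda>e. e)" using E by (simp add: orthonormal_basis_def)
    define f where "f = (\<lambda>(n, e). cinner (v n) e * cinner e (u n))"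
    have bdd: "(\<Sum>e\<in>F. norm (f (n, e))) \<le> norm (u n) * norm (v n)" if "finite F" "F \<subseteq> E" for n F
      using Bessel_Cauchy_Schwarz[of F "\<lambda>e. e" "\<lambda>e. e" "v n" "u n"] that orthonormal_on_subset[OF on]
      by (simp add: f_def norm_mult mult.commute)
    have fsum: "(\<lambda>e. norm (f (n, e))) summable_on E" for n
      using bdd by (intro nonneg_bdd_above_summable_on) (auto simp: bdd_above_def)
    have "(\<Sum>\<^sub>\<infinity>e\<in>E. norm (f (n, e))) \<le> norm (u n) * norm (v n)" for n
      using fsum bdd by (rule infsum_le_finite_sums)
    then have "(\<lambda>n. \<Sum>\<^sub>\<infinity>e\<in>E. norm (f (n, e))) summable_on N"
      using summable by (intro summable_on_comparison_test[OF summable]) (auto intro: infsum_nonneg)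
    then have "(\<lambda>p. norm (f p)) summable_on N \<times> E"
      unfolding Infinite_Sum.abs_summable_on_Sigma_iff using fsum by (auto simp: infsum_nonneg)
    then have "f summable_on N \<times> E" by (rule abs_summable_summable)
    then have hs: "(f has_sum s) (N \<times> E)"
      using s by (intro has_sum_SigmaI[where g = "\<lambda>n. cinner (v n) (u n)"])
        (auto simp: f_def intro: Parseval[OF E])
    have "((\<lambda>(e, n). f (n, e)) has_sum s) (E \<times> N)"
      using hs by (subst (asm) has_sum_swap)
    then show ?thesis
      by (rule has_sum_SigmaD) (use T in \<open>auto simp: f_def mult.commute\<close>)
  qed
  have "op_trace T = s"
    unfolding op_trace_def
  proof (rule the_equality)
    fix t assume t: "\<forall>E. orthonormal_basis E \<longrightarrow> ((\<lambda>e. cinner (blinfun_apply T e) e) has_sum t) E"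
    obtain E :: "'d L2 set" where "orthonormal_basis E" using orthonormal_basis_exists by blast
    then show "t = s" using * t has_sum_unique by blast
  qed (use * in blast)
  with s show "((\<lambda>n. cinner (v n) (u n)) has_sum op_trace T) N" by simp
qed

section \<open>Singular values\<close>

text \<open>This is Young's inequality for \<open>t * m powr (p - 1)\<close>.\<close>

lemma powr_tangent_le:
  fixes p m t :: real
  assumes "1 \<le> p" "0 \<le> m" "0 \<le> t"
  shows "m powr p + p * m powr (p - 1) * (t - m) \<le> t powr p"
\<comment> \<open>The conjugate exponent exists only for \<open>p > 1\<close>; at
  \<open>m = 0\<close> both powers of \<open>m\<close> vanish because \<open>0 powr x = 0\<close>
  for every \<open>x\<close>.\<close>
proof (cases "m = 0 \<or> p = 1")
  case True
  then show ?thesis using assms by (cases "m = 0") auto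
next
  case False
  then have "1 < p" "0 < m" using assms by auto
  define q where "q = p / (p - 1)"
  have q: "1 < q" "1/p + 1/q = 1" using \<open>1 < p\<close> by (auto simp: q_def field_simps)
  have "(p - 1) * q = p" using \<open>1 < p\<close> by (simp add: q_def)
  then have "t * m powr (p - 1) \<le> t powr p / p + m powr p / q"
    using Youngs_inequality[of p q t "m powr (p - 1)"] \<open>1 < p\<close> q assms by (simp add: powr_powr)
  then have "p * (t * m powr (p - 1)) \<le> p * (t powr p / p + m powr p / q)"
    using \<open>1 < p\<close> by (intro mult_left_mono) auto
  also have "\<dots> = t powr p + (p / q) * m powr p" using \<open>1 < p\<close> by (simp add: field_simps)
  also have "p / q = p - 1" using \<open>1 < p\<close> by (simp add: q_def)
  finally have "p * (t * m powr (p - 1)) \<le> t powr p + (p - 1) * m powr p" .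
  moreover have "m powr (p - 1) * m = m powr p"
    using powr_mult_base[of m "p - 1"] \<open>0 < m\<close> by (simp add: mult.commute)
  ultimately show ?thesis by (simp add: algebra_simps)
qed

text \<open>Jensen's inequality for weights of total mass at most 1, by summing the tangent
  inequality at the mean \<open>m\<close>.\<close>

lemma sum_powr_le:
  fixes a t :: "'i \<Rightarrow> real"
  assumes "1 \<le> p" "\<And>k. k \<in> K \<Longrightarrow> 0 \<le> a k" "\<And>k. k \<in> K \<Longrightarrow> 0 \<le> t k" "(\<Sum>k\<in>K. a k) \<le> 1"
  shows "(\<Sum>k\<in>K. t k * a k) powr p \<le> (\<Sum>k\<in>K. t k powr p * a k)"
proof -
  define m where "m = (\<Sum>k\<in>K. t k * a k)"
  have "0 \<le> m" unfolding m_def using assms by (intro sum_nonneg) auto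
  have m: "m powr (p - 1) * m = m powr p"
    using powr_mult_base[of m "p - 1"] \<open>0 \<le> m\<close> by (simp add: mult.commute)
  \<comment> \<open>Missing mass does no harm: since the weights add up to at most 1, the second
    factor is at least 1.\<close>
  have "m powr p \<le> m powr p * (p - (p - 1) * (\<Sum>k\<in>K. a k))"
    using assms(1,4) mult_left_mono[of "\<Sum>k\<in>K. a k" 1 "p - 1"]
    by (intro mult_le_cancel_left1[THEN iffD2]) auto
  also have "\<dots> = m powr p * (\<Sum>k\<in>K. a k) + p * m powr (p - 1) * (m - m * (\<Sum>k\<in>K. a k))"
    by (simp add: algebra_simps flip: m)
  also have "\<dots> = (\<Sum>k\<in>K. (m powr p + p * m powr (p - 1) * (t k - m)) * a k)"
  proof -
    have "(\<Sum>k\<in>K. (m powr p + p * m powr (p - 1) * (t k - m)) * a k) =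
        (\<Sum>k\<in>K. m powr p * a k + p * m powr (p - 1) * (t k * a k - m * a k))"
      by (simp add: algebra_simps)
    then show ?thesis
      by (simp only: sum.distrib sum_subtractf flip: sum_distrib_left m_def)
  qed
  also have "\<dots> \<le> (\<Sum>k\<in>K. t k powr p * a k)"
    using assms \<open>0 \<le> m\<close> by (intro sum_mono mult_right_mono powr_tangent_le) auto
  finally show ?thesis by (simp add: m_def)
qed

text \<open>The matrix of the numbers \<open>\<bar>\<langle>e n, f k\<rangle> \<langle>h k, g n\<rangle>\<bar>\<close> is doubly substochastic by
  Bessel's inequality, so Jensen's inequality applies to its rows and its columns can be summed.\<close>

lemma sum_powr_diagonal_le:
  fixes t :: "'k \<Rightarrow> real" and w :: "'n \<Rightarrow> complex"
  assumes p: "1 \<le> p" and f: "orthonormal_on K f" and h: "orthonormal_on K h"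
    and t: "\<And>k. k \<in> K \<Longrightarrow> 0 \<le> t k" "(\<lambda>k. t k powr p) summable_on K"
    and F: "finite F" "orthonormal_on F e" "orthonormal_on F g"
    and w: "\<And>n. n \<in> F \<Longrightarrow>
      ((\<lambda>k. complex_of_real (t k) * cinner (e n) (f k) * cinner (h k) (g n)) has_sum w n) K"
  shows "(\<Sum>n\<in>F. cmod (w n) powr p) \<le> (\<Sum>\<^sub>\<infinity>k\<in>K. t k powr p)"
proof -
  let ?c = "\<lambda>n k. complex_of_real (t k) * cinner (e n) (f k) * cinner (h k) (g n)"
  let ?a = "\<lambda>n k. cmod (cinner (e n) (f k)) * cmod (cinner (h k) (g n))"
  \<comment> \<open>Finite index sets \<open>L\<close> allow the order of summation to be exchanged
    freely; the limit over \<open>L\<close> is taken at the end.\<close>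
  have partial: "(\<Sum>n\<in>F. cmod (\<Sum>k\<in>L. ?c n k) powr p) \<le> (\<Sum>\<^sub>\<infinity>k\<in>K. t k powr p)"
    if L: "finite L" "L \<subseteq> K" for L
  proof -
    have "(\<Sum>n\<in>F. cmod (\<Sum>k\<in>L. ?c n k) powr p) \<le> (\<Sum>n\<in>F. \<Sum>k\<in>L. t k powr p * ?a n k)"
    proof (rule sum_mono)
      fix n assume n: "n \<in> F"
      have "cmod (\<Sum>k\<in>L. ?c n k) \<le> (\<Sum>k\<in>L. cmod (?c n k))" by (rule norm_sum)
      also have "\<dots> = (\<Sum>k\<in>L. t k * ?a n k)"
        using L t(1) by (intro sum.cong refl) (auto simp: norm_mult)
      finally have "cmod (\<Sum>k\<in>L. ?c n k) powr p \<le> (\<Sum>k\<in>L. t k * ?a n k) powr p"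
        using p by (intro powr_mono2) auto
      also have "\<dots> \<le> (\<Sum>k\<in>L. t k powr p * ?a n k)"
      proof (rule sum_powr_le[OF p])
        have "(\<Sum>k\<in>L. ?a n k) \<le> norm (e n) * norm (g n)"
          using L orthonormal_on_subset[OF f] orthonormal_on_subset[OF h]
          by (intro Bessel_Cauchy_Schwarz) auto
        then show "(\<Sum>k\<in>L. ?a n k) \<le> 1" using n F by (simp add: orthonormal_norm)
      qed (use L t in auto)
      finally show "cmod (\<Sum>k\<in>L. ?c n k) powr p \<le> (\<Sum>k\<in>L. t k powr p * ?a n k)" .
    qed
    also have "\<dots> = (\<Sum>k\<in>L. t k powr p * (\<Sum>n\<in>F. ?a n k))"
      by (subst sum.swap) (simp add: sum_distrib_left)
    also have "\<dots> \<le> (\<Sum>k\<in>L. t k powr p * 1)"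
    proof (intro sum_mono mult_left_mono)
      fix k assume k: "k \<in> L"
      \<comment> \<open>For the column sums the two pairs of families exchange their roles in
        Bessel's inequality.\<close>
      have "(\<Sum>n\<in>F. ?a n k) = (\<Sum>n\<in>F. cmod (cinner (h k) (g n)) * cmod (cinner (e n) (f k)))"
        by (simp add: mult.commute)
      also have "\<dots> \<le> norm (h k) * norm (f k)" by (rule Bessel_Cauchy_Schwarz[OF F(1,3,2)])
      also have "\<dots> = 1" using k L by (auto simp: orthonormal_norm[OF f] orthonormal_norm[OF h])
      finally show "(\<Sum>n\<in>F. ?a n k) \<le> 1" .
    qed simp
    also have "\<dots> \<le> (\<Sum>\<^sub>\<infinity>k\<in>K. t k powr p)" using L t by (simp add: finite_sum_le_infsum)
    finally show ?thesis .
  qed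
  have "((\<lambda>L. \<Sum>n\<in>F. cmod (\<Sum>k\<in>L. ?c n k) powr p) \<longlongrightarrow> (\<Sum>n\<in>F. cmod (w n) powr p))
      (finite_subsets_at_top K)"
    using w p unfolding has_sum_def
    by (intro tendsto_sum tendsto_powr' tendsto_norm tendsto_const disjI2) auto
  then show ?thesis
  proof (rule tendsto_upperbound)
    show "\<forall>\<^sub>F L in finite_subsets_at_top K.
        (\<Sum>n\<in>F. cmod (\<Sum>k\<in>L. ?c n k) powr p) \<le> (\<Sum>\<^sub>\<infinity>k\<in>K. t k powr p)"
      by (rule eventually_finite_subsets_at_top_weakI) (rule partial)
  qed simp
qed

lemma cinner_eq_0_sym: "cinner f g = 0 \<Longrightarrow> cinner g f = 0"
  by (subst cinner_commute) simp

lemma bounded_linear_cinner_apply: "bounded_linear (\<lambda>T. cinner (blinfun_apply T x) y)"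
  by (rule bounded_linear_compose[OF cinner.bounded_linear_left blinfun.bounded_linear_left])

lemma rank_one_apply: "blinfun_apply (rank_one g f) h = cinner h f *\<^sub>C g"
  by transfer simp

lemma svd_cinner_has_sum:
  assumes "singular_value_decomposition N s e g T"
  shows "((\<lambda>n. complex_of_real (s n) * cinner x (e n) * cinner (g n) y) has_sum
    cinner (blinfun_apply T x) y) N"
proof -
  have "((\<lambda>n. s n *\<^sub>R rank_one (g n) (e n)) has_sum T) N"
    using assms by (simp add: singular_value_decomposition_def)
  from has_sum_bounded_linear[OF bounded_linear_cinner_apply this, of x y] show ?thesis
    by (simp add: rank_one_apply scaleR_blinfun.rep_eq cinner.scaleR_left scaleR_conv_of_real
        cinner_scaleC_left mult.assoc)
qed

lemma svd_complex_linear: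
  assumes "singular_value_decomposition N s e g T"
  shows "complex_linear T"
  unfolding complex_linear_def
proof (intro allI cinner_eqI)
  fix c f h
  have "((\<lambda>n. complex_of_real (s n) * cinner (c *\<^sub>C f) (e n) * cinner (g n) h) has_sum
      c * cinner (blinfun_apply T f) h) N"
    using has_sum_cmult_right[OF svd_cinner_has_sum[OF assms], of c f h]
    by (simp add: cinner_scaleC_left mult_ac)
  then show "cinner (blinfun_apply T (c *\<^sub>C f)) h = cinner (c *\<^sub>C blinfun_apply T f) h"
    using svd_cinner_has_sum[OF assms, of "c *\<^sub>C f" h] has_sum_unique
    by (fastforce simp: cinner_scaleC_left)
qed

text \<open>Orthonormality kills every term but one. Singular values thus become diagonal entries,
  to which \<open>sum_powr_diagonal_le\<close> applies.\<close>

lemma svd_diagonal: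
  assumes svd: "singular_value_decomposition N s e g T" and n: "n \<in> N"
  shows "cinner (blinfun_apply T (e n)) (g n) = complex_of_real (s n)"
proof -
  have e: "orthonormal_on N e" and g: "orthonormal_on N g"
    using svd by (auto simp: singular_value_decomposition_def)
  have "((\<lambda>k. complex_of_real (s k) * cinner (e n) (e k) * cinner (g k) (g n)) has_sum
      complex_of_real (s n)) N"
    using n by (intro has_sum_finite_neutralI[of "{n}"])
      (auto simp: orthonormal_cinner[OF e] orthonormal_cinner[OF g])
  with svd_cinner_has_sum[OF svd] show ?thesis by (rule has_sum_unique)
qed

text \<open>The primed singular values are diagonal entries of \<open>T\<close>, and those are
  controlled by any other decomposition of \<open>T\<close>.\<close>

lemma svd_sum_powr_le:
  assumes p: "1 \<le> p" and svd: "singular_value_decomposition N s e g T"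
    and svd': "singular_value_decomposition N' s' e' g' T"
    and summable: "(\<lambda>n. s n powr p) summable_on N"
  shows "(\<lambda>n. s' n powr p) summable_on N'"
    "(\<Sum>\<^sub>\<infinity>n\<in>N'. s' n powr p) \<le> (\<Sum>\<^sub>\<infinity>n\<in>N. s n powr p)"
proof -
  have *: "(\<Sum>n\<in>F. s' n powr p) \<le> (\<Sum>\<^sub>\<infinity>n\<in>N. s n powr p)" if F: "finite F" "F \<subseteq> N'" for F
  proof -
    have "(\<Sum>n\<in>F. s' n powr p) = (\<Sum>n\<in>F. cmod (cinner (blinfun_apply T (e' n)) (g' n)) powr p)"
      using F svd' by (intro sum.cong refl)
        (auto simp: svd_diagonal[OF svd'] singular_value_decomposition_def less_imp_le)
    also have "\<dots> \<le> (\<Sum>\<^sub>\<infinity>n\<in>N. s n powr p)"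
    proof (rule sum_powr_diagonal_le[OF p _ _ _ summable, where f = e and h = g])
      show "orthonormal_on F e'" "orthonormal_on F g'"
        using svd' orthonormal_on_subset[OF _ F(2)] by (auto simp: singular_value_decomposition_def)
    qed (use F svd svd_cinner_has_sum[OF svd] in
        \<open>auto simp: singular_value_decomposition_def less_imp_le\<close>)
    finally show ?thesis .
  qed
  show **: "(\<lambda>n. s' n powr p) summable_on N'"
    using * by (intro nonneg_bdd_above_summable_on) (auto simp: bdd_above_def)
  show "(\<Sum>\<^sub>\<infinity>n\<in>N'. s' n powr p) \<le> (\<Sum>\<^sub>\<infinity>n\<in>N. s n powr p)"
    using ** * by (rule infsum_le_finite_sums)
qed

text \<open>Comparing two decompositions in both directions shows that their power sums agree, so
  the definite description in \<open>schatten_norm\<close> is determined.\<close>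

lemma schatten_norm_svd:
  assumes p: "1 \<le> p" "p \<noteq> \<infinity>" and svd: "singular_value_decomposition N s e g T"
    and summable: "(\<lambda>n. s n powr enn2real p) summable_on N"
  shows "schatten_norm p T = (\<Sum>\<^sub>\<infinity>n\<in>N. s n powr enn2real p) powr (1 / enn2real p)"
proof -
  have "1 \<le> enn2real p" using p by (metis enn2real_1 enn2real_mono infinity_ennreal_def top.not_eq_extremum)
  then have "(\<Sum>\<^sub>\<infinity>n\<in>N'. s' n powr enn2real p) = (\<Sum>\<^sub>\<infinity>n\<in>N. s n powr enn2real p)"
    if svd': "singular_value_decomposition N' s' e' g' T" for N' s' e' g'
    using svd_sum_powr_le[OF _ svd svd' summable] svd_sum_powr_le(2)[OF _ svd' svd]
    by (intro antisym) auto
  then have "(THE r. \<exists>N s e g. singular_value_decomposition N s e g T \<and>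
      r = (\<Sum>\<^sub>\<infinity>n\<in>N. s n powr enn2real p) powr (1 / enn2real p)) =
      (\<Sum>\<^sub>\<infinity>n\<in>N. s n powr enn2real p) powr (1 / enn2real p)"
    using svd by (intro the_equality) (blast, metis)
  then show ?thesis using p by (simp add: schatten_norm_def)
qed

section \<open>Operators with bounded diagonals\<close>

text \<open>Each further vector adds the compact set of its bounded multiples, and sums of compact
  sets are compact. Used for the finite-dimensional parts of the image of the unit ball.\<close>

lemma compact_linear_combinations:
  fixes u :: "nat \<Rightarrow> 'd::finite L2"
  shows "\<exists>K. compact K \<and> (\<forall>c. (\<forall>i<n. cmod (c i) \<le> M) \<longrightarrow> (\<Sum>i<n. c i *\<^sub>C u i) \<in> K)"
proof (induction n)
  case 0
  show ?case by (intro exI[of _ "{0}"]) simp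
next
  case (Suc n)
  then obtain K where K: "compact K"
    "\<And>c. (\<forall>i<n. cmod (c i) \<le> M) \<Longrightarrow> (\<Sum>i<n. c i *\<^sub>C u i) \<in> K" by blast
  have "compact ((\<lambda>c. c *\<^sub>C u n) ` cball 0 M)"
    by (intro compact_continuous_image scaleC.continuous_on continuous_intros) auto
  with K(1) have "compact {x + y |x y. x \<in> K \<and> y \<in> (\<lambda>c. c *\<^sub>C u n) ` cball 0 M}"
    by (rule compact_sums)
  moreover have "(\<Sum>i<Suc n. c i *\<^sub>C u i) \<in> {x + y |x y. x \<in> K \<and> y \<in> (\<lambda>c. c *\<^sub>C u n) ` cball 0 M}"
    if "\<forall>i<Suc n. cmod (c i) \<le> M" for c
    using that K(2)[of c] unfolding sum.lessThan_Suc by (intro CollectI exI conjI refl) auto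
  ultimately show ?case by blast
qed

lemma orthogonal_remainder:
  assumes e: "orthonormal_on {..<n::nat} e" and "i < n"
  shows "cinner (x - (\<Sum>j<n. cinner x (e j) *\<^sub>C e j)) (e i) = 0"
proof -
  have "(\<Sum>j<n. cinner x (e j) * cinner (e j) (e i)) = (\<Sum>j<n. if j = i then cinner x (e i) else 0)"
    using \<open>i < n\<close> by (intro sum.cong refl) (auto simp: orthonormal_cinner[OF e])
  then show ?thesis
    using \<open>i < n\<close> by (simp add: cinner.diff_left cinner.sum_left cinner_scaleC_left)
qed

lemma norm_remainder_le:
  assumes e: "orthonormal_on {..<n::nat} e"
  shows "norm (x - (\<Sum>j<n. cinner x (e j) *\<^sub>C e j)) \<le> norm x"
proof -
  let ?y = "\<Sum>j<n. cinner x (e j) *\<^sub>C e j"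
  have "cinner (x - ?y) ?y = 0"
    by (simp only: cinner.sum_right cinner_scaleC_right)
      (simp add: orthogonal_remainder[OF e])
  then have "inner (x - ?y) ?y = 0" by (simp add: inner_L2_def)
  then have "(norm x)\<^sup>2 = (norm (x - ?y))\<^sup>2 + (norm ?y)\<^sup>2"
    using norm_add_Pythagorean[of "x - ?y" ?y] by (simp add: orthogonal_def)
  then have "(norm (x - ?y))\<^sup>2 \<le> (norm x)\<^sup>2" using zero_le_power2[of "norm ?y"] by linarith
  then show ?thesis by (rule power2_le_imp_le) simp
qed

lemma norm_diff_scaleR_square:
  fixes u v :: "'b::real_inner"
  shows "(norm (u - a *\<^sub>R v))\<^sup>2 = (norm u)\<^sup>2 - 2 * (a * inner u v) + a\<^sup>2 * (norm v)\<^sup>2"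
  unfolding power2_norm_eq_inner
  by (simp add: inner_diff_left inner_diff_right inner_commute) (simp add: power2_eq_square)

lemma has_sum_norm_le:
  fixes f :: "'i \<Rightarrow> 'b::real_normed_vector"
  assumes "(f has_sum S) M" "\<And>F. finite F \<Longrightarrow> F \<subseteq> M \<Longrightarrow> norm (sum f F) \<le> c"
  shows "norm S \<le> c"
proof (rule tendsto_upperbound)
  show "((\<lambda>F. norm (sum f F)) \<longlongrightarrow> norm S) (finite_subsets_at_top M)"
    using assms(1) unfolding has_sum_def by (rule tendsto_norm)
  show "\<forall>\<^sub>F F in finite_subsets_at_top M. norm (sum f F) \<le> c"
    by (rule eventually_finite_subsets_at_top_weakI) (rule assms(2))
qed simp

section \<open>Compactness and singular value decomposition from bounded diagonals\<close>

context
  fixes A :: "'d::finite operator" and p C :: real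
  assumes lin: "complex_linear A" and p: "1 \<le> p"
    and diag: "\<And>F e g. finite F \<Longrightarrow> orthonormal_on F e \<Longrightarrow> orthonormal_on F g \<Longrightarrow>
      (\<Sum>n\<in>(F :: nat set). cmod (cinner (blinfun_apply A (e n)) (g n)) powr p) \<le> C"
begin

lemma apply_scaleC: "blinfun_apply A (c *\<^sub>C f) = c *\<^sub>C blinfun_apply A f"
  using lin by (simp add: complex_linear_def)

text \<open>A maximal pair of orthonormal families on whose diagonal \<open>A\<close> exceeds \<open>\<epsilon>\<close> is finite, and \<open>A\<close>
  is small between the orthogonal complements.\<close>

lemma small_off_finite:
  assumes "0 < \<epsilon>"
  obtains n e g where "orthonormal_on {..<n::nat} e" "orthonormal_on {..<n} g"
    "\<And>x y. (\<And>i. i < n \<Longrightarrow> cinner x (e i) = 0) \<Longrightarrow> (\<And>i. i < n \<Longrightarrow> cinner y (g i) = 0) \<Longrightarrow>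
      cmod (cinner (blinfun_apply A x) y) \<le> \<epsilon> * norm x * norm y"
proof -
  define P where "P n e g \<longleftrightarrow> orthonormal_on {..<n} e \<and> orthonormal_on {..<n} g \<and>
    (\<forall>i<n. \<epsilon> \<le> cmod (cinner (blinfun_apply A (e i)) (g i)))" for n :: nat and e g
  have "\<exists>n e g. P n e g \<and> (\<forall>x y. (\<forall>i<n. cinner x (e i) = 0) \<longrightarrow> (\<forall>i<n. cinner y (g i) = 0) \<longrightarrow>
      cmod (cinner (blinfun_apply A x) y) \<le> \<epsilon> * norm x * norm y)"
  proof (rule ccontr)
    assume *: "\<not> ?thesis"
    \<comment> \<open>If no pair of families were final, each could be lengthened by a normalised
      bad pair \<open>x'\<close>, \<open>y'\<close>, giving pairs of every length.\<close>
    have ex: "\<exists>e g. P n e g" for n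
    proof (induction n)
      case 0
      show ?case by (simp add: P_def orthonormal_on_def)
    next
      case (Suc n)
      then obtain e g where P: "P n e g" by blast
      then have "\<not> (\<forall>x y. (\<forall>i<n. cinner x (e i) = 0) \<longrightarrow> (\<forall>i<n. cinner y (g i) = 0) \<longrightarrow>
          cmod (cinner (blinfun_apply A x) y) \<le> \<epsilon> * norm x * norm y)"
        using * by blast
      then obtain x y where xy: "\<And>i. i < n \<Longrightarrow> cinner x (e i) = 0" "\<And>i. i < n \<Longrightarrow> cinner y (g i) = 0"
        "\<epsilon> * norm x * norm y < cmod (cinner (blinfun_apply A x) y)"
        unfolding not_all not_imp not_le by blast
      have nz: "norm x \<noteq> 0" "norm y \<noteq> 0" using xy(3) by (auto simp: cinner.zero_left cinner.zero_right)
      define x' where "x' = (1 / norm x) *\<^sub>R x"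
      define y' where "y' = (1 / norm y) *\<^sub>R y"
      have n': "cinner x' x' = 1" "cinner y' y' = 1" using nz by (simp_all add: cinner_same x'_def y'_def)
      have o': "cinner x' (e i) = 0" "cinner (e i) x' = 0" "cinner y' (g i) = 0" "cinner (g i) y' = 0"
        if "i < n" for i
        using xy(1,2)[OF that]
        by (simp_all add: x'_def y'_def cinner.scaleR_left cinner.scaleR_right cinner_eq_0_sym)
      have "cinner (blinfun_apply A x') y' =
          complex_of_real (1 / norm x * (1 / norm y)) * cinner (blinfun_apply A x) y"
        by (simp add: x'_def y'_def cinner.scaleR_left cinner.scaleR_right blinfun.scaleR_right
            scaleR_conv_of_real)
      then have "cmod (cinner (blinfun_apply A x') y') =
          cmod (cinner (blinfun_apply A x) y) / (norm x * norm y)"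
        by (simp add: norm_mult norm_divide)
      then have "\<epsilon> \<le> cmod (cinner (blinfun_apply A x') y')"
        using xy(3) nz by (simp add: pos_le_divide_eq mult.assoc less_imp_le)
      then have "P (Suc n) (e(n := x')) (g(n := y'))"
        using P n' o' by (auto simp: P_def orthonormal_on_def less_Suc_eq)
      then show ?case by blast
    qed
    \<comment> \<open>A pair of length \<open>n\<close> has \<open>n\<close> diagonal entries of
      modulus at least \<epsilon>, so the diagonal bound caps the length.\<close>
    have "real n * \<epsilon> powr p \<le> C" for n
    proof -
      obtain e g where "P n e g" using ex by blast
      then have P: "orthonormal_on {..<n} e" "orthonormal_on {..<n} g"
        "\<And>i. i < n \<Longrightarrow> \<epsilon> \<le> cmod (cinner (blinfun_apply A (e i)) (g i))" by (auto simp: P_def)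
      have "real n * \<epsilon> powr p = (\<Sum>i<n. \<epsilon> powr p)" by simp
      also have "\<dots> \<le> (\<Sum>i<n. cmod (cinner (blinfun_apply A (e i)) (g i)) powr p)"
        using P(3) p assms by (intro sum_mono powr_mono2) auto
      also have "\<dots> \<le> C" using P by (intro diag) auto
      finally show ?thesis .
    qed
    moreover obtain n where "C / \<epsilon> powr p < real n" using reals_Archimedean2 by blast
    ultimately show False using assms by (auto simp: field_simps not_le[symmetric])
  qed
  then show ?thesis using that unfolding P_def by blast
qed

text \<open>Up to a small remainder, \<open>A x\<close> is a combination of the
  \<open>A (e i)\<close> plus a combination of the \<open>g i\<close>, with bounded coefficients;
  such combinations stay in a compact set.\<close>

lemma compact_image_cball: "compact (closure (blinfun_apply A ` cball 0 1))"
  unfolding compact_eq_totally_bounded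
proof (intro conjI allI impI)
  show "complete (closure (blinfun_apply A ` cball 0 1))" by (simp add: complete_eq_closed)
  fix \<epsilon> :: real assume "0 < \<epsilon>"
  \<comment> \<open>Half of \<epsilon> is spent on passing to the closure; the other half is shared
    by the finite net of the compact sum and the remainder.\<close>
  then have "0 < \<epsilon> / 4" by simp
  then obtain n e g where eg: "orthonormal_on {..<n::nat} e" "orthonormal_on {..<n} g"
    "\<And>x y. (\<And>i. i < n \<Longrightarrow> cinner x (e i) = 0) \<Longrightarrow> (\<And>i. i < n \<Longrightarrow> cinner y (g i) = 0) \<Longrightarrow>
      cmod (cinner (blinfun_apply A x) y) \<le> \<epsilon> / 4 * norm x * norm y"
    using small_off_finite by blast
  obtain K1 where K1: "compact K1"
    "\<And>c. (\<forall>i<n. cmod (c i) \<le> 1) \<Longrightarrow> (\<Sum>i<n. c i *\<^sub>C blinfun_apply A (e i)) \<in> K1"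
    using compact_linear_combinations[of n 1 "\<lambda>i. blinfun_apply A (e i)"] by blast
  obtain K2 where K2: "compact K2" "\<And>c. (\<forall>i<n. cmod (c i) \<le> norm A) \<Longrightarrow> (\<Sum>i<n. c i *\<^sub>C g i) \<in> K2"
    using compact_linear_combinations[of n "norm A" g] by blast
  have "compact {x + y |x y. x \<in> K1 \<and> y \<in> K2}" using K1(1) K2(1) by (rule compact_sums)
  then obtain k where k: "finite k" "{x + y |x y. x \<in> K1 \<and> y \<in> K2} \<subseteq> (\<Union>x\<in>k. ball x (\<epsilon>/4))"
    using \<open>0 < \<epsilon> / 4\<close> unfolding compact_eq_totally_bounded by blast
  have near: "\<exists>z\<in>k. dist z (blinfun_apply A x) < \<epsilon> / 2" if x: "norm x \<le> 1" for x
  proof -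
    define x' where "x' = x - (\<Sum>i<n. cinner x (e i) *\<^sub>C e i)"
    define y where "y = blinfun_apply A x'"
    define y' where "y' = y - (\<Sum>i<n. cinner y (g i) *\<^sub>C g i)"
    have x': "norm x' \<le> 1" using norm_remainder_le[OF eg(1), of x] x by (simp add: x'_def)
    have "norm y \<le> norm A * norm x'" unfolding y_def by (rule norm_blinfun)
    also have "\<dots> \<le> norm A" using x' by (simp add: mult_left_le)
    finally have ny: "norm y \<le> norm A" .
    have coeff: "cmod (cinner v (h i)) \<le> norm v" if "orthonormal_on {..<n} h" "i < n" for v h i
      using cmod_cinner_le[of v "h i"] orthonormal_norm[OF that(1), of i] that(2) by simp
    \<comment> \<open>Pairing \<open>A x'\<close> with the remainder \<open>y'\<close> itself bounds
      \<open>y'\<close>, because \<open>x'\<close> is orthogonal to the family \<open>e\<close> and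
      \<open>y'\<close> to the family \<open>g\<close>.\<close>
    have "cinner y y' = cinner y' y'"
    proof -
      have "cinner (\<Sum>i<n. cinner y (g i) *\<^sub>C g i) y' = 0"
      proof -
        have "cinner (g i) y' = 0" if "i < n" for i
          unfolding y'_def by (rule cinner_eq_0_sym) (rule orthogonal_remainder[OF eg(2) that])
        then show ?thesis by (simp add: cinner.sum_left cinner_scaleC_left)
      qed
      then show ?thesis by (simp add: y'_def cinner.diff_left)
    qed
    then have "(norm y')\<^sup>2 = cmod (cinner y y')" by (simp add: cinner_same norm_power)
    also have "\<dots> \<le> \<epsilon> / 4 * norm x' * norm y'"
      unfolding y_def using orthogonal_remainder[OF eg(1)] orthogonal_remainder[OF eg(2)]
      by (intro eg(3)) (auto simp: x'_def y'_def)
    also have "\<dots> \<le> \<epsilon> / 4 * norm y'" using x' \<open>0 < \<epsilon>\<close> by (simp add: mult_right_mono mult_left_le)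
    finally have ny': "norm y' \<le> \<epsilon> / 4"
      using \<open>0 < \<epsilon>\<close> by (cases "norm y' = 0") (auto simp: power2_eq_square)
    let ?a = "\<Sum>i<n. cinner x (e i) *\<^sub>C blinfun_apply A (e i)" and ?b = "\<Sum>i<n. cinner y (g i) *\<^sub>C g i"
    have "?a \<in> K1"
      using x coeff[OF eg(1)] by (intro K1(2) allI impI) (rule order_trans)
    moreover have "?b \<in> K2"
      using ny coeff[OF eg(2)] by (intro K2(2) allI impI) (rule order_trans)
    ultimately have "?a + ?b \<in> {x + y |x y. x \<in> K1 \<and> y \<in> K2}" by blast
    then obtain z where z: "z \<in> k" "dist z (?a + ?b) < \<epsilon> / 4" using k(2) by force
    have "blinfun_apply A x = ?a + y"
      by (simp add: y_def x'_def blinfun.diff_right blinfun.sum_right apply_scaleC)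
    then have "blinfun_apply A x = ?a + ?b + y'" by (simp add: y'_def)
    then have "dist (?a + ?b) (blinfun_apply A x) \<le> \<epsilon> / 4" using ny' by (simp add: dist_norm)
    then have "dist z (blinfun_apply A x) < \<epsilon> / 2"
      using z(2) dist_triangle[of z "blinfun_apply A x" "?a + ?b"] by linarith
    with z(1) show ?thesis by blast
  qed
  have "closure (blinfun_apply A ` cball 0 1) \<subseteq> (\<Union>x\<in>k. ball x \<epsilon>)"
  proof
    fix v assume "v \<in> closure (blinfun_apply A ` cball 0 1)"
    then obtain x where x: "norm x \<le> 1" "dist (blinfun_apply A x) v < \<epsilon> / 2"
      using \<open>0 < \<epsilon>\<close> unfolding closure_approachable by (force dest: spec[of _ "\<epsilon> / 2"])
    obtain z where "z \<in> k" "dist z (blinfun_apply A x) < \<epsilon> / 2" using near[OF x(1)] by blast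
    then have "dist z v < \<epsilon>" using x(2) dist_triangle[of z v "blinfun_apply A x"] by linarith
    with \<open>z \<in> k\<close> show "v \<in> (\<Union>x\<in>k. ball x \<epsilon>)" by auto
  qed
  with k(1) show "\<exists>k. finite k \<and> closure (blinfun_apply A ` cball 0 1) \<subseteq> (\<Union>x\<in>k. ball x \<epsilon>)" by blast
qed

text \<open>Maximise the norm of \<open>A x\<close> over the unit ball of \<open>V\<close>. A
  maximising sequence is asymptotically an eigenvector of \<open>A\<close> followed by its adjoint,
  and compactness extracts a genuine one.\<close>

lemma norm_attained:
  assumes V: "closed V" "\<And>x r. x \<in> V \<Longrightarrow> r *\<^sub>R x \<in> V"
    and inv: "\<And>x. x \<in> V \<Longrightarrow> blinfun_apply (op_adjoint A) (blinfun_apply A x) \<in> V"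
    and x0: "x0 \<in> V" "blinfun_apply A x0 \<noteq> 0"
  obtains z s where "z \<in> V" "norm z = 1" "0 < s"
    "blinfun_apply (op_adjoint A) (blinfun_apply A z) = s\<^sup>2 *\<^sub>R z"
proof -
  let ?A = "blinfun_apply A" and ?B = "blinfun_apply (op_adjoint A)"
  have adj: "cinner (?B f) g = cinner f (?A g)" for f g by (rule cinner_adjoint'[OF lin, symmetric])
  define S where "S = (\<lambda>x. norm (?A x)) ` (V \<inter> cball 0 1)"
  define L where "L = Sup S"
  have bdd: "bdd_above S"
  proof (rule bdd_aboveI)
    fix v assume "v \<in> S"
    then obtain x where "norm x \<le> 1" "v = norm (?A x)" by (auto simp: S_def)
    then show "v \<le> norm A" using norm_blinfun[of A x] mult_left_le[of "norm x" "norm A"] by simp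
  qed
  have le: "norm (?A x) \<le> L * norm x" if "x \<in> V" for x
  proof (cases "x = 0")
    case False
    have "norm (?A ((1 / norm x) *\<^sub>R x)) \<le> L"
      unfolding L_def using False V(2)[OF that]
      by (intro cSup_upper bdd) (simp add: S_def image_iff del: scaleR_cancel_right,
          intro bexI[of _ "(1 / norm x) *\<^sub>R x"], auto)
    then show ?thesis using False by (simp add: blinfun.scaleR_right field_simps)
  qed (simp add: blinfun.zero_right)
  \<comment> \<open>This is where \<open>x0\<close> enters: positivity of \<open>L\<close> permits
    the later division by its square.\<close>
  have "0 < L * norm x0" using le[OF x0(1)] x0(2) by (meson order.strict_trans2 zero_less_norm_iff)
  then have L: "0 < L" by (simp add: zero_less_mult_iff)
  have S_ne: "S \<noteq> {}" using V(2)[OF x0(1), of 0] by (auto simp: S_def)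
  have "\<exists>x. x \<in> V \<and> norm x \<le> 1 \<and> L - 1 / real (Suc n) < norm (?A x)" for n
  proof -
    have "L - 1 / real (Suc n) < Sup S" unfolding L_def by simp
    then obtain v where "v \<in> S" "L - 1 / real (Suc n) < v" using less_cSup_iff[OF S_ne bdd] by blast
    then show ?thesis by (auto simp: S_def)
  qed
  then obtain x where x: "\<And>n. x n \<in> V" "\<And>n. norm (x n) \<le> 1"
    "\<And>n. L - 1 / real (Suc n) < norm (?A (x n))" by metis
  have x_le: "norm (?A (x n)) \<le> L" for n
  proof -
    have "L * norm (x n) \<le> L * 1" using L x(2) by (intro mult_left_mono) auto
    then show ?thesis using le[OF x(1), of n] by simp
  qed
  have lim_norm: "(\<lambda>n. norm (?A (x n))) \<longlonglongrightarrow> L"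
  proof (rule tendsto_sandwich)
    have "(\<lambda>n. L - 1 / real (Suc n)) \<longlonglongrightarrow> L - 0"
      by (intro tendsto_diff tendsto_const LIMSEQ_Suc[OF lim_1_over_n])
    then show "(\<lambda>n. L - 1 / real (Suc n)) \<longlonglongrightarrow> L" by simp
    show "\<forall>\<^sub>F n in sequentially. L - 1 / real (Suc n) \<le> norm (?A (x n))"
      by (intro always_eventually allI less_imp_le x(3))
  qed (use x_le in auto)
  \<comment> \<open>Expand the square; the first term is bounded by \<open>L ^ 4\<close> because the
    image of \<open>x n\<close> lies in \<open>V\<close> again, so the estimate \<open>le\<close>
    can be reused on it.\<close>
  have near: "(norm (?B (?A (x n)) - L\<^sup>2 *\<^sub>R x n))\<^sup>2 \<le> 2 * L\<^sup>2 * (L\<^sup>2 - (norm (?A (x n)))\<^sup>2)" for n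
  proof -
    let ?u = "?B (?A (x n))"
    have "(norm ?u)\<^sup>2 = cmod (cinner ?u ?u)" by (simp add: cinner_same norm_power)
    also have "\<dots> \<le> norm (?A (x n)) * norm (?A ?u)" unfolding adj by (rule cmod_cinner_le)
    also have "\<dots> \<le> L * (L * norm ?u)"
      using L by (intro mult_mono x_le le inv x(1)) auto
    finally have "norm ?u \<le> L\<^sup>2" by (cases "norm ?u = 0") (auto simp: power2_eq_square)
    then have u: "(norm ?u)\<^sup>2 \<le> (L\<^sup>2)\<^sup>2" by (intro power_mono) auto
    have "inner ?u (x n) = (norm (?A (x n)))\<^sup>2" by (simp add: inner_L2_def adj cinner_same)
    moreover have "(norm (?u - L\<^sup>2 *\<^sub>R x n))\<^sup>2 =
        (norm ?u)\<^sup>2 - 2 * (L\<^sup>2 * inner ?u (x n)) + (L\<^sup>2)\<^sup>2 * (norm (x n))\<^sup>2"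
      using norm_diff_scaleR_square[of ?u "L\<^sup>2" "x n"] .
    moreover have "(L\<^sup>2)\<^sup>2 * (norm (x n))\<^sup>2 \<le> (L\<^sup>2)\<^sup>2"
      using x(2)[of n] by (intro mult_left_le power_le_one) auto
    ultimately show ?thesis using u by (simp add: algebra_simps power2_eq_square)
  qed
  obtain l r where r: "strict_mono (r :: nat \<Rightarrow> nat)" "(\<lambda>n. ?A (x (r n))) \<longlonglongrightarrow> l"
  proof -
    have "?A (x n) \<in> closure (?A ` cball 0 1)" for n
      using x(2)[of n] closure_subset by fastforce
    then show ?thesis
      using compact_image_cball that unfolding compact_eq_seq_compact_metric seq_compact_def o_def
      by meson
  qed
  have Bl: "(\<lambda>n. ?B (?A (x (r n)))) \<longlonglongrightarrow> ?B l"
    by (intro blinfun.tendsto r tendsto_const)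
  have "(\<lambda>n. 2 * L\<^sup>2 * (L\<^sup>2 - (norm (?A (x (r n))))\<^sup>2)) \<longlonglongrightarrow> 2 * L\<^sup>2 * (L\<^sup>2 - L\<^sup>2)"
    using LIMSEQ_subseq_LIMSEQ[OF lim_norm r(1)] by (intro tendsto_intros) (simp add: o_def)
  then have "(\<lambda>n. 2 * L\<^sup>2 * (L\<^sup>2 - (norm (?A (x (r n))))\<^sup>2)) \<longlonglongrightarrow> 0" by simp
  then have "(\<lambda>n. (norm (?B (?A (x (r n))) - L\<^sup>2 *\<^sub>R x (r n)))\<^sup>2) \<longlonglongrightarrow> 0"
    by (rule tendsto_sandwich[OF _ _ tendsto_const, rotated 2]) (use near in auto)
  then have "(\<lambda>n. sqrt ((norm (?B (?A (x (r n))) - L\<^sup>2 *\<^sub>R x (r n)))\<^sup>2)) \<longlonglongrightarrow> sqrt 0"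
    by (rule tendsto_real_sqrt)
  then have "(\<lambda>n. ?B (?A (x (r n))) - L\<^sup>2 *\<^sub>R x (r n)) \<longlonglongrightarrow> 0"
    by (simp add: tendsto_norm_zero_iff)
  \<comment> \<open>The images converge and differ from \<open>L ^ 2\<close> times the sequence by a
    null sequence, so \<open>x (r n)\<close> itself converges.\<close>
  from tendsto_diff[OF Bl this] have "(\<lambda>n. L\<^sup>2 *\<^sub>R x (r n)) \<longlonglongrightarrow> ?B l" by simp
  from tendsto_scaleR[OF tendsto_const this, of "1 / L\<^sup>2"]
  have z: "(\<lambda>n. x (r n)) \<longlonglongrightarrow> (1 / L\<^sup>2) *\<^sub>R ?B l" using L by simp
  define z where "z = (1 / L\<^sup>2) *\<^sub>R ?B l"
  have Az: "(\<lambda>n. ?A (x (r n))) \<longlonglongrightarrow> ?A z"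
    unfolding z_def by (intro blinfun.tendsto z tendsto_const)
  have "norm (?A z) = L"
    using tendsto_norm[OF Az] LIMSEQ_subseq_LIMSEQ[OF lim_norm r(1)]
    by (auto simp: o_def intro: LIMSEQ_unique)
  then have "z \<noteq> 0" using L by (auto simp: blinfun.zero_right)
  have "?A z = l" using Az r(2) by (rule LIMSEQ_unique)
  then have BAz: "?B (?A z) = L\<^sup>2 *\<^sub>R z" using L by (simp add: z_def)
  have "z \<in> V" unfolding z_def by (rule closed_sequentially[OF V(1) x(1) z])
  show ?thesis
  proof (rule that[of "(1 / norm z) *\<^sub>R z" L])
    show "?B (?A ((1 / norm z) *\<^sub>R z)) = L\<^sup>2 *\<^sub>R (1 / norm z) *\<^sub>R z"
      by (simp add: blinfun.scaleR_right BAz)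
  qed (use \<open>z \<in> V\<close> \<open>z \<noteq> 0\<close> V(2) L in auto)
qed

text \<open>\<open>E\<close> is a maximal orthonormal set of eigenvectors with positive eigenvalue.
  Self-adjointness makes its orthogonal complement invariant, so \<open>norm_attained\<close> would
  produce a further eigenvector there unless \<open>A\<close> vanishes on it.\<close>

lemma orthonormal_singular_vectors:
  obtains E where "orthonormal_on E (\<lambda>e. e)"
    "\<And>e. e \<in> E \<Longrightarrow> blinfun_apply A e \<noteq> 0 \<and>
      blinfun_apply (op_adjoint A) (blinfun_apply A e) = (norm (blinfun_apply A e))\<^sup>2 *\<^sub>R e"
    "\<And>x. (\<And>e. e \<in> E \<Longrightarrow> cinner x e = 0) \<Longrightarrow> blinfun_apply A x = 0"
proof -
  let ?A = "blinfun_apply A" and ?B = "blinfun_apply (op_adjoint A)"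
  have adj: "cinner (?B f) g = cinner f (?A g)" for f g by (rule cinner_adjoint'[OF lin, symmetric])
  define W where "W = {e. \<exists>s>0. ?B (?A e) = s\<^sup>2 *\<^sub>R e}"
  obtain E where EW: "E \<subseteq> W" "orthonormal_on E (\<lambda>e. e)"
    "\<And>f. f \<in> W \<Longrightarrow> norm f = 1 \<Longrightarrow> (\<And>e. e \<in> E \<Longrightarrow> cinner f e = 0) \<Longrightarrow> False"
    using maximal_orthonormal_subset[of W] by blast
  note E = EW[unfolded W_def]
  define V where "V = {x. \<forall>e\<in>E. cinner x e = 0}"
  have "V = (\<Inter>e\<in>E. (\<lambda>x. cinner x e) -` {0})" by (auto simp: V_def)
  moreover have "closed (\<Inter>e\<in>E. (\<lambda>x. cinner x e) -` {0})"
    by (intro closed_INT ballI continuous_closed_vimage closed_singleton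
        linear_continuous_at cinner.bounded_linear_left)
  ultimately have V: "closed V" by simp
  have zero: "?A x = 0" if "x \<in> V" for x
  proof (rule ccontr)
    assume "?A x \<noteq> 0"
    obtain z s where "z \<in> V" "norm z = 1" "0 < s" "?B (?A z) = s\<^sup>2 *\<^sub>R z"
    proof (rule norm_attained[OF V _ _ \<open>x \<in> V\<close> \<open>?A x \<noteq> 0\<close>])
      fix x assume x: "x \<in> V"
      show "r *\<^sub>R x \<in> V" for r using x by (simp add: V_def cinner.scaleR_left)
      show "?B (?A x) \<in> V"
        unfolding V_def
      proof (intro CollectI ballI)
        fix e assume e: "e \<in> E"
        then obtain s where "?B (?A e) = s\<^sup>2 *\<^sub>R e" using E(1) by auto
        moreover have "cinner (?B (?A x)) e = cinner x (?B (?A e))"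
          by (metis adj cinner_commute)
        ultimately show "cinner (?B (?A x)) e = 0" using x e by (simp add: V_def cinner.scaleR_right)
      qed
    qed
    then show False using E(3)[of z] by (auto simp: V_def)
  qed
  show ?thesis
  proof (rule that[OF E(2)])
    fix e assume e: "e \<in> E"
    then obtain s where s: "0 < s" "?B (?A e) = s\<^sup>2 *\<^sub>R e" using E(1) by auto
    \<comment> \<open>Pairing the eigenvector equation with \<open>e\<close> identifies the
      eigenvalue as the squared norm of \<open>A e\<close>.\<close>
    have "complex_of_real ((norm (?A e))\<^sup>2) = complex_of_real (s\<^sup>2)"
      using adj[of "?A e" e] orthonormal_cinner[OF E(2) e e]
      by (simp add: cinner_same[symmetric] s cinner.scaleR_left scaleR_conv_of_real del: of_real_power)
    then have "(norm (?A e))\<^sup>2 = s\<^sup>2" by (simp only: of_real_eq_iff)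
    then have "norm (?A e) = s" by (rule power2_eq_imp_eq) (simp_all add: less_imp_le[OF s(1)])
    then show "?A e \<noteq> 0 \<and> ?B (?A e) = (norm (?A e))\<^sup>2 *\<^sub>R e"
      using s by (metis less_irrefl norm_zero)
  next
    fix x assume "\<And>e. e \<in> E \<Longrightarrow> cinner x e = 0"
    then show "?A x = 0" by (intro zero) (simp add: V_def)
  qed
qed

text \<open>The left singular vectors are the normalised images of the right ones, orthonormal by
  the eigenvector equation. Applying \<open>diag\<close> to exactly these two families bounds the
  power sum of the singular values.\<close>

lemma svd_exists:
  obtains N s e g where "singular_value_decomposition N s e g A"
    "(\<lambda>n. s n powr p) summable_on N" "(\<Sum>\<^sub>\<infinity>n\<in>N. s n powr p) \<le> C"
proof -
  let ?A = "blinfun_apply A" and ?B = "blinfun_apply (op_adjoint A)"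
  have adj: "cinner (?B f) g = cinner f (?A g)" for f g by (rule cinner_adjoint'[OF lin, symmetric])
  obtain E where E: "orthonormal_on E (\<lambda>e. e)"
    "\<And>e. e \<in> E \<Longrightarrow> ?A e \<noteq> 0 \<and> ?B (?A e) = (norm (?A e))\<^sup>2 *\<^sub>R e"
    "\<And>x. (\<And>e. e \<in> E \<Longrightarrow> cinner x e = 0) \<Longrightarrow> ?A x = 0"
    using orthonormal_singular_vectors by blast
  have countable: "countable E" by (rule orthonormal_countable[OF E(1)])
  \<comment> \<open>Countability of \<open>E\<close> turns it into a family over a set of naturals,
    as \<open>singular_value_decomposition\<close> requires.\<close>
  define N where "N = to_nat_on E ` E"
  define e where "e = from_nat_into E"
  define s where "s n = norm (?A (e n))" for n
  define g where "g n = (1 / s n) *\<^sub>R ?A (e n)" for n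
  have eE: "e n \<in> E" if "n \<in> N" for n using that countable by (auto simp: N_def e_def)
  have e_surj: "\<exists>n\<in>N. x = e n" if "x \<in> E" for x
    using that countable by (auto simp: N_def e_def intro!: bexI[of _ "to_nat_on E x"])
  have e_inj: "m = n" if "m \<in> N" "n \<in> N" "e m = e n" for m n
    using that countable by (auto simp: N_def e_def)
  have e_on: "orthonormal_on N e"
    unfolding orthonormal_on_def using eE e_inj by (auto simp: orthonormal_cinner[OF E(1)])
  have s_pos: "0 < s n" if "n \<in> N" for n using E(2)[OF eE[OF that]] by (simp add: s_def)
  have g_on: "orthonormal_on N g"
    unfolding orthonormal_on_def
  proof (intro ballI)
    fix m n assume mn: "m \<in> N" "n \<in> N"
    have "cinner (?A (e m)) (?A (e n)) = complex_of_real ((s m)\<^sup>2) * cinner (e m) (e n)"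
      using E(2)[OF eE[OF mn(1)]] by (simp flip: adj add: cinner.scaleR_left s_def scaleR_conv_of_real)
    then show "cinner (g m) (g n) = (if m = n then 1 else 0)"
      using s_pos[OF mn(1)] s_pos[OF mn(2)] mn by (simp add: g_def cinner.scaleR_left cinner.scaleR_right
          orthonormal_cinner[OF e_on] scaleR_conv_of_real power2_eq_square)
  qed
  have Ae: "?A (e n) = s n *\<^sub>R g n" if "n \<in> N" for n using s_pos[OF that] by (simp add: g_def)
  have bound: "(\<Sum>n\<in>F. s n powr p) \<le> C" if F: "finite F" "F \<subseteq> N" for F
  proof -
    have "(\<Sum>n\<in>F. s n powr p) = (\<Sum>n\<in>F. cmod (cinner (?A (e n)) (g n)) powr p)"
    proof (rule sum.cong)
      fix n assume "n \<in> F"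
      then have n: "n \<in> N" using F by blast
      then show "s n powr p = cmod (cinner (?A (e n)) (g n)) powr p"
        using s_pos[OF n] by (simp add: Ae cinner.scaleR_left orthonormal_cinner[OF g_on n n])
    qed simp
    also have "\<dots> \<le> C" using F e_on g_on orthonormal_on_subset by (intro diag) auto
    finally show ?thesis .
  qed
  have summable: "(\<lambda>n. s n powr p) summable_on N"
    using bound by (intro nonneg_bdd_above_summable_on) (auto simp: bdd_above_def)
  have expand: "((\<lambda>n. cinner x (e n) *\<^sub>C ?A (e n)) has_sum ?A x) N" for x
  proof -
    have "(\<lambda>n. cinner x (e n) *\<^sub>C e n) summable_on N"
      by (intro orthonormal_summable[OF e_on] Bessel_summable[OF e_on])
    then obtain y where y: "((\<lambda>n. cinner x (e n) *\<^sub>C e n) has_sum y) N" by (auto simp: summable_on_def)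
    \<comment> \<open>\<open>y\<close> is the projection of \<open>x\<close> onto the closed span of
      \<open>E\<close>; the difference is orthogonal to \<open>E\<close>, so \<open>A\<close> kills
      it.\<close>
    have "?A (x - y) = 0"
    proof (rule E(3))
      fix f assume "f \<in> E"
      then obtain n where n: "n \<in> N" "f = e n" using e_surj by blast
      have "((\<lambda>m. cinner (cinner x (e m) *\<^sub>C e m) (e n)) has_sum cinner y (e n)) N"
        by (rule has_sum_bounded_linear[OF cinner.bounded_linear_left y])
      moreover have "((\<lambda>m. cinner (cinner x (e m) *\<^sub>C e m) (e n)) has_sum cinner x (e n)) N"
        using n by (intro has_sum_finite_neutralI[of "{n}"])
          (auto simp: cinner_scaleC_left orthonormal_cinner[OF e_on])
      ultimately have "cinner y (e n) = cinner x (e n)" by (rule has_sum_unique)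
      then show "cinner (x - y) f = 0" by (simp add: n cinner.diff_left)
    qed
    then have "?A x = ?A y" by (simp add: blinfun.diff_right)
    then show ?thesis
      using has_sum_bounded_linear[OF blinfun.bounded_linear_right y, of A] by (simp add: apply_scaleC)
  qed
  have "((\<lambda>n. s n *\<^sub>R rank_one (g n) (e n)) has_sum A) N"
    unfolding has_sum_def tendsto_iff
  proof (intro allI impI)
    fix \<epsilon> :: real assume "0 < \<epsilon>"
    then have pos: "0 < (\<epsilon> / 2) powr p" by simp
    obtain F0 where F0: "finite F0" "F0 \<subseteq> N"
      "\<And>F. finite F \<Longrightarrow> F \<subseteq> N - F0 \<Longrightarrow> (\<Sum>n\<in>F. s n powr p) < (\<epsilon> / 2) powr p"
      by (rule nonneg_summable_tail[OF summable _ pos]) simp_all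
    \<comment> \<open>A single index already counts as a tail, so one large value would break the
      tail bound. Uniform smallness outside \<open>F0\<close> is what gives convergence in operator
      norm.\<close>
    have small: "s n \<le> \<epsilon> / 2" if "n \<in> N - F0" for n
    proof (rule ccontr)
      assume "\<not> ?thesis"
      then have "(\<epsilon> / 2) powr p \<le> s n powr p" using \<open>0 < \<epsilon>\<close> p by (intro powr_mono2) auto
      then show False using F0(3)[of "{n}"] that by simp
    qed
    have "dist (\<Sum>n\<in>F. s n *\<^sub>R rank_one (g n) (e n)) A < \<epsilon>" if F: "finite F" "F0 \<subseteq> F" "F \<subseteq> N" for F
    proof -
      let ?D = "A - (\<Sum>n\<in>F. s n *\<^sub>R rank_one (g n) (e n))"
      have "norm (blinfun_apply ?D x) \<le> \<epsilon> / 2 * norm x" for x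
      proof (rule has_sum_norm_le)
        let ?f = "\<lambda>n. cinner x (e n) *\<^sub>C ?A (e n)"
        have "(\<Sum>n\<in>F. blinfun_apply (s n *\<^sub>R rank_one (g n) (e n)) x) = sum ?f F"
        proof (rule sum.cong)
          fix n assume "n \<in> F"
          then have "n \<in> N" using F(3) by blast
          then show "blinfun_apply (s n *\<^sub>R rank_one (g n) (e n)) x = ?f n"
            by (simp add: scaleR_blinfun.rep_eq rank_one_apply Ae scaleC.scaleR_right)
        qed simp
        then have "?A x - sum ?f F = blinfun_apply ?D x"
          by (simp add: blinfun.diff_left blinfun.sum_left)
        moreover have "(?f has_sum (?A x - sum ?f F)) (N - F)"
          using expand F by (intro has_sum_Diff has_sum_finite) auto
        ultimately show "(?f has_sum blinfun_apply ?D x) (N - F)" by simp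
        fix H assume H: "finite H" "H \<subseteq> N - F"
        have "sum ?f H = (\<Sum>n\<in>H. (cinner x (e n) * complex_of_real (s n)) *\<^sub>C g n)"
          using H(2) by (intro sum.cong refl) (auto simp: Ae scaleR_scaleC scaleC_scaleC)
        then have "(norm (sum ?f H))\<^sup>2 = (\<Sum>n\<in>H. (cmod (cinner x (e n) * complex_of_real (s n)))\<^sup>2)"
          using H by (simp only:) (intro norm_orthonormal_sum orthonormal_on_subset[OF g_on]; blast)
        also have "\<dots> = (\<Sum>n\<in>H. (s n)\<^sup>2 * (cmod (cinner x (e n)))\<^sup>2)"
          by (simp add: norm_mult power_mult_distrib mult.commute)
        also have "\<dots> \<le> (\<Sum>n\<in>H. (\<epsilon> / 2)\<^sup>2 * (cmod (cinner x (e n)))\<^sup>2)"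
        proof (intro sum_mono mult_right_mono power_mono)
          fix n assume "n \<in> H"
          then have "n \<in> N" "n \<in> N - F0" using H F by auto
          then show "s n \<le> \<epsilon> / 2" "0 \<le> s n" using small s_pos[of n] by auto
        qed simp
        also have "\<dots> \<le> (\<epsilon> / 2)\<^sup>2 * (norm x)\<^sup>2"
          unfolding sum_distrib_left[symmetric] using H orthonormal_on_subset[OF e_on, of H]
          by (intro mult_left_mono Bessel_finite) auto
        finally have "(norm (sum ?f H))\<^sup>2 \<le> (\<epsilon> / 2 * norm x)\<^sup>2"
          by (simp only: power_mult_distrib)
        then show "norm (sum ?f H) \<le> \<epsilon> / 2 * norm x"
          by (rule power2_le_imp_le) (simp add: less_imp_le[OF \<open>0 < \<epsilon>\<close>])
      qed
      then have "norm ?D \<le> \<epsilon> / 2" using \<open>0 < \<epsilon>\<close> by (intro norm_blinfun_bound) auto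
      then show ?thesis using \<open>0 < \<epsilon>\<close> by (simp add: dist_norm norm_minus_commute)
    qed
    then have "\<forall>F. finite F \<and> F0 \<subseteq> F \<and> F \<subseteq> N \<longrightarrow>
        dist (\<Sum>n\<in>F. s n *\<^sub>R rank_one (g n) (e n)) A < \<epsilon>" by simp
    with F0(1,2) show "\<forall>\<^sub>F F in finite_subsets_at_top N. dist (\<Sum>n\<in>F. s n *\<^sub>R rank_one (g n) (e n)) A < \<epsilon>"
      unfolding eventually_finite_subsets_at_top by (intro exI[of _ F0] conjI)
  qed
  then have "singular_value_decomposition N s e g A"
    using s_pos e_on g_on by (simp add: singular_value_decomposition_def)
  then show ?thesis using summable infsum_le_finite_sums[OF summable bound] by (rule that)
qed

end

section \<open>Convolution of measures with operators\<close>

text \<open>Polarisation recovers the real part; the imaginary part is the real part after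
  multiplying the second argument by \<open>\<i>\<close>.\<close>

lemma isometry_cinner:
  assumes U: "complex_linear U" and norm: "\<And>f. norm (blinfun_apply U f) = norm f"
  shows "cinner (blinfun_apply U f) (blinfun_apply U g) = cinner f g"
proof -
  have re: "inner (blinfun_apply U f) (blinfun_apply U g) = inner f g" for f g
    by (simp add: dot_norm norm flip: blinfun.add_right)
  have "Im (cinner f g) = inner f (\<i> *\<^sub>C g)" for f g :: "'a L2"
    by (simp add: inner_L2_def cinner_scaleC_right)
  then have "Im (cinner (blinfun_apply U f) (blinfun_apply U g)) = Im (cinner f g)"
    using re[of f "\<i> *\<^sub>C g"] U by (simp add: complex_linear_def)
  then show ?thesis using re[of f g] by (simp add: complex_eq_iff inner_L2_def)
qed

lemma orthonormal_on_isometry: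
  assumes "complex_linear U" "\<And>f. norm (blinfun_apply U f) = norm f" "orthonormal_on N e"
  shows "orthonormal_on N (\<lambda>n. blinfun_apply U (e n))"
  using assms by (simp add: orthonormal_on_def isometry_cinner)

lemma norm_cinner_eqI: "cinner f f = cinner g g \<Longrightarrow> norm f = norm g"
  by (simp add: norm_L2_def inner_L2_def)

lemma norm_adjoint_isometry_le:
  assumes U: "complex_linear U" and norm: "\<And>f. norm (blinfun_apply U f) = norm f"
  shows "norm (blinfun_apply (op_adjoint U) f) \<le> norm f"
proof -
  let ?v = "blinfun_apply (op_adjoint U) f"
  have "(norm ?v)\<^sup>2 = cmod (cinner (blinfun_apply U ?v) f)"
    by (simp add: cinner_adjoint[OF U] cinner_same norm_power)
  also have "\<dots> \<le> norm ?v * norm f" using cmod_cinner_le[of "blinfun_apply U ?v" f] by (simp add: norm)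
  finally show ?thesis by (cases "norm ?v = 0") (auto simp: power2_eq_square)
qed

section \<open>Time-frequency shifts\<close>

lemma norm_tf_shift [simp]: "norm (blinfun_apply (tf_shift z) f) = norm f"
proof (rule norm_cinner_eqI)
  show "cinner (blinfun_apply (tf_shift z) f) (blinfun_apply (tf_shift z) f) = cinner f f"
    unfolding tf_shift.rep_eq by transfer (rule tf_shift_rel)
qed

lemma tf_shift_abs_L2:
  assumes "square_integrable F"
  shows "blinfun_apply (tf_shift z) (abs_L2 F) =
    abs_L2 (\<lambda>t. exp (2 * of_real pi * \<i> * of_real (snd z \<bullet> t)) * F (t - fst z))"
  unfolding tf_shift.rep_eq using assms by (simp add: tf_shift_fun.abs_eq L2_rel_refl)

lemma square_integrable_tf_shift:
  fixes F :: "real ^ 'd \<Rightarrow> complex"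
  assumes "square_integrable F"
  shows "square_integrable (\<lambda>t. exp (2 * of_real pi * \<i> * of_real (w \<bullet> t)) * F (t - x))"
  using tf_shift_rel(1)[OF L2_rel_refl[OF assms], of w x] by (simp add: L2_rel_def)

lemma complex_linear_tf_shift: "complex_linear (tf_shift z)"
  unfolding complex_linear_def
proof (intro allI)
  fix c and f :: "'a L2"
  obtain F where F: "square_integrable F" "f = abs_L2 F" by (meson L2_abs_cases)
  have "(\<lambda>t. exp (2 * of_real pi * \<i> * of_real (snd z \<bullet> t)) * (c * F (t - fst z))) =
      (\<lambda>t. c * (exp (2 * of_real pi * \<i> * of_real (snd z \<bullet> t)) * F (t - fst z)))"
    by (simp add: mult.left_commute)
  then show "blinfun_apply (tf_shift z) (c *\<^sub>C f) = c *\<^sub>C blinfun_apply (tf_shift z) f"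
    unfolding F(2) using F(1)
    by (simp add: scaleC.abs_eq L2_rel_refl square_integrable_cmult tf_shift_abs_L2
        square_integrable_tf_shift)
qed

text \<open>The coefficient is an integral over \<open>t\<close> of a function jointly measurable in
  \<open>z\<close> and \<open>t\<close>.\<close>

lemma borel_measurable_cinner_tf_shift:
  fixes f g :: "'d::finite L2"
  shows "(\<lambda>z. cinner f (blinfun_apply (tf_shift z) g)) \<in> borel_measurable borel"
proof -
  obtain F where F: "square_integrable F" "f = abs_L2 F" by (meson L2_abs_cases)
  obtain G where G: "square_integrable G" "g = abs_L2 G" by (meson L2_abs_cases)
  have [measurable]: "F \<in> borel_measurable borel" "G \<in> borel_measurable borel"
    using F(1) G(1) by (auto simp: square_integrable_def)
  have [measurable]: "fst \<in> borel_measurable (borel :: ((real ^ 'd) \<times> (real ^ 'd)) measure)"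
    "snd \<in> borel_measurable (borel :: ((real ^ 'd) \<times> (real ^ 'd)) measure)"
    by (intro borel_measurable_continuous_onI continuous_intros)+
  have "(\<lambda>z. \<integral>t. F t * cnj (exp (2 * of_real pi * \<i> * of_real (snd z \<bullet> t)) * G (t - fst z)) \<partial>lborel)
      \<in> borel_measurable (borel :: ((real ^ 'd) \<times> (real ^ 'd)) measure)"
    by (rule lborel.borel_measurable_lebesgue_integral) measurable
  then show ?thesis
    using F G by (simp add: tf_shift_abs_L2 cinner_abs_L2 square_integrable_tf_shift)
qed

section \<open>Sums under measurability and integration, and Jensen's inequality\<close>

lemma has_sum_nat_sums:
  fixes f :: "nat \<Rightarrow> 'b::real_normed_vector"
  assumes "(f has_sum S) N"
  shows "(\<lambda>n. if n \<in> N then f n else 0) sums S"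
proof (rule has_sum_imp_sums)
  show "((\<lambda>n. if n \<in> N then f n else 0) has_sum S) UNIV"
    using assms by (rule has_sum_cong_neutral[THEN iffD1, rotated -1]) auto
qed

lemma borel_measurable_has_sum:
  fixes f :: "'i \<Rightarrow> 'a \<Rightarrow> complex"
  assumes I: "countable I" and f: "\<And>i. i \<in> I \<Longrightarrow> f i \<in> borel_measurable M"
    and g: "\<And>x. ((\<lambda>i. f i x) has_sum g x) I"
  shows "g \<in> borel_measurable M"
proof -
  let ?N = "to_nat_on I ` I"
  have bij: "bij_betw (from_nat_into I) ?N I"
    using I by (intro bij_betw_byWitness[where f' = "to_nat_on I"]) auto
  have "((\<lambda>n. f (from_nat_into I n) x) has_sum g x) ?N" for x
    using g has_sum_reindex_bij_betw[OF bij, of "\<lambda>i. f i x"] by simp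
  then have "(\<lambda>n. if n \<in> ?N then f (from_nat_into I n) x else 0) sums g x" for x
    by (rule has_sum_nat_sums)
  then have "g = (\<lambda>x. \<Sum>n. if n \<in> ?N then f (from_nat_into I n) x else 0)"
    by (auto simp: sums_iff)
  moreover have "(\<lambda>x. if n \<in> ?N then f (from_nat_into I n) x else 0) \<in> borel_measurable M" for n
    using f[of "from_nat_into I n"] I by (cases "n \<in> ?N") auto
  then have "(\<lambda>x. \<Sum>n. if n \<in> ?N then f (from_nat_into I n) x else 0) \<in> borel_measurable M"
    by (rule borel_measurable_suminf)
  ultimately show ?thesis by simp
qed

text \<open>The uniform bounds \<open>c\<close> are integrable constants on a finite measure space
  and are summable, which justifies termwise integration.\<close>

lemma has_sum_integral:
  fixes f :: "nat \<Rightarrow> 'a \<Rightarrow> complex"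
  assumes "finite_measure M" and f: "\<And>n. n \<in> N \<Longrightarrow> f n \<in> borel_measurable M"
    and bound: "\<And>n x. n \<in> N \<Longrightarrow> cmod (f n x) \<le> c n" and c: "c summable_on N"
    and g: "\<And>x. ((\<lambda>n. f n x) has_sum g x) N"
  shows "((\<lambda>n. \<integral>x. f n x \<partial>M) has_sum (\<integral>x. g x \<partial>M)) N"
proof -
  interpret finite_measure M by fact
  define F where "F n x = (if n \<in> N then f n x else 0)" for n x
  define c' where "c' n = (if n \<in> N then c n else 0)" for n
  obtain C where "(c has_sum C) N" using c by (auto simp: summable_on_def)
  then have sc: "summable c'" using has_sum_nat_sums[of c N C] by (auto simp: c'_def[abs_def] sums_iff)
  have Fc: "cmod (F n x) \<le> c' n" for n x by (simp add: F_def c'_def bound)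
  have intF: "integrable M (F n)" for n
  proof (rule integrable_const_bound)
    show "F n \<in> borel_measurable M" unfolding F_def[abs_def] by (cases "n \<in> N") (auto intro: f)
  qed (use Fc in auto)
  have le: "(\<integral>x. cmod (F n x) \<partial>M) \<le> c' n * measure M (space M)" for n
  proof -
    have "(\<integral>x. cmod (F n x) \<partial>M) \<le> (\<integral>x. c' n \<partial>M)"
      using intF Fc by (intro integral_mono) auto
    then show ?thesis by (simp add: mult.commute)
  qed
  have "(\<lambda>n. \<integral>x. F n x \<partial>M) sums (\<integral>x. (\<Sum>n. F n x) \<partial>M)"
  proof (rule sums_integral)
    show "AE x in M. summable (\<lambda>n. norm (F n x))"
      using Fc by (intro AE_I2 summable_comparison_test'[OF sc]) auto
    show "summable (\<lambda>n. \<integral>x. norm (F n x) \<partial>M)"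
      using le by (intro summable_comparison_test'[OF summable_mult2[OF sc]]) auto
  qed (rule intF)
  moreover have "(\<Sum>n. F n x) = g x" for x
    using has_sum_nat_sums[OF g, of x] by (simp add: F_def sums_iff)
  ultimately have sums: "(\<lambda>n. \<integral>x. F n x \<partial>M) sums (\<integral>x. g x \<partial>M)" by simp
  \<comment> \<open>\<open>sums_integral\<close> gives the sum only in the order of the naturals;
    absolute summability upgrades it to an unordered sum.\<close>
  have "cmod (\<integral>x. f n x \<partial>M) \<le> c n * measure M (space M)" if "n \<in> N" for n
  proof -
    have "F n = f n" using that by (auto simp: F_def)
    then have "(\<integral>x. cmod (f n x) \<partial>M) \<le> c n * measure M (space M)"
      using le[of n] that by (simp add: c'_def)
    with integral_norm_bound show ?thesis by (rule order_trans)
  qed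
  then have "(\<lambda>n. cmod (\<integral>x. f n x \<partial>M)) summable_on N"
    by (rule summable_on_comparison_test[OF summable_on_cmult_left[OF c]]) simp_all
  then have "(\<lambda>n. \<integral>x. f n x \<partial>M) summable_on N" by (rule abs_summable_summable)
  then obtain t where t: "((\<lambda>n. \<integral>x. f n x \<partial>M) has_sum t) N" by (auto simp: summable_on_def)
  have "(\<lambda>n. \<integral>x. F n x \<partial>M) = (\<lambda>n. if n \<in> N then (\<integral>x. f n x \<partial>M) else 0)"
    by (auto simp: F_def)
  then have "t = (\<integral>x. g x \<partial>M)" using has_sum_nat_sums[OF t] sums sums_unique2 by metis
  with t show ?thesis by simp
qed

text \<open>Jensen's inequality without normalising the mass: integrate the tangent inequality at
  the mean. The power of the mass on the right becomes part of the power of the variation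
  norm.\<close>

lemma integral_powr_le:
  fixes \<phi> :: "'a \<Rightarrow> real"
  assumes "finite_measure M" and p: "1 \<le> p" and \<phi>: "\<phi> \<in> borel_measurable M" "\<And>x. 0 \<le> \<phi> x" "\<And>x. \<phi> x \<le> b"
  shows "(\<integral>x. \<phi> x \<partial>M) powr p \<le> measure M (space M) powr (p - 1) * (\<integral>x. \<phi> x powr p \<partial>M)"
proof -
  interpret finite_measure M by fact
  let ?m = "measure M (space M)"
  have int: "integrable M \<phi>" using \<phi> by (intro integrable_const_bound[of _ b]) auto
  have int_p: "integrable M (\<lambda>x. \<phi> x powr p)"
    using \<phi> p by (intro integrable_const_bound[of _ "b powr p"]) (auto intro!: AE_I2 powr_mono2)
  have nonneg: "0 \<le> (\<integral>x. \<phi> x \<partial>M)" using \<phi> by (intro integral_nonneg_AE) auto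
  show ?thesis
  proof (cases "?m = 0")
    case True
    have "(\<integral>x. \<phi> x \<partial>M) \<le> (\<integral>x. b \<partial>M)" using int \<phi> by (intro integral_mono) auto
    then show ?thesis using nonneg True by simp
  next
    case False
    then have m: "0 < ?m" using zero_less_measure_iff by blast
    define a where "a = (\<integral>x. \<phi> x \<partial>M) / ?m"
    have a: "0 \<le> a" "?m * a = (\<integral>x. \<phi> x \<partial>M)" using nonneg m by (auto simp: a_def)
    have "(\<integral>x. a powr p + p * a powr (p - 1) * (\<phi> x - a) \<partial>M) \<le> (\<integral>x. \<phi> x powr p \<partial>M)"
      using int int_p powr_tangent_le[OF p a(1) \<phi>(2)] by (intro integral_mono) auto
    also have "(\<integral>x. a powr p + p * a powr (p - 1) * (\<phi> x - a) \<partial>M) = ?m * a powr p"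
      using int a(2) by simp
    finally have "?m powr (p - 1) * (?m * a powr p) \<le> ?m powr (p - 1) * (\<integral>x. \<phi> x powr p \<partial>M)"
      by (intro mult_left_mono) auto
    moreover have "?m powr (p - 1) * ?m = ?m powr p"
      using powr_mult_base[of ?m "p - 1"] m by (simp add: mult.commute)
    moreover have "(\<integral>x. \<phi> x \<partial>M) powr p = ?m powr p * a powr p"
      unfolding a(2)[symmetric] by (rule powr_mult)
    ultimately show ?thesis by (simp add: mult.assoc[symmetric])
  qed
qed

section \<open>Parity\<close>

lemma parity_abs_L2: "square_integrable F \<Longrightarrow> blinfun_apply parity (abs_L2 F) = abs_L2 (\<lambda>t. F (- t))"
  unfolding parity.rep_eq by (simp add: parity_fun.abs_eq L2_rel_refl)

lemma square_integrable_reflect: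
  fixes F :: "real ^ 'd \<Rightarrow> complex"
  shows "square_integrable F \<Longrightarrow> square_integrable (\<lambda>t. F (- t))"
  using square_integrable_comp_affine[of F "-1" 0] by simp

lemma parity_parity [simp]: "blinfun_apply parity (blinfun_apply parity f) = f"
proof -
  obtain F where F: "square_integrable F" "f = abs_L2 F" by (meson L2_abs_cases)
  then show ?thesis by (simp add: parity_abs_L2 square_integrable_reflect)
qed

lemma complex_linear_parity: "complex_linear parity"
  unfolding complex_linear_def
proof (intro allI)
  fix c and f :: "'a L2"
  obtain F where F: "square_integrable F" "f = abs_L2 F" by (meson L2_abs_cases)
  then show "blinfun_apply parity (c *\<^sub>C f) = c *\<^sub>C blinfun_apply parity f"
    by (simp add: scaleC.abs_eq L2_rel_refl square_integrable_cmult parity_abs_L2 square_integrable_reflect)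
qed

lemma norm_parity: "norm (blinfun_apply parity f) = norm f"
proof (rule norm_cinner_eqI)
  obtain F where F: "square_integrable F" "f = abs_L2 F" by (meson L2_abs_cases)
  then show "cinner (blinfun_apply parity f) (blinfun_apply parity f) = cinner f f"
    using affine_unitary(2)[OF L2_rel_refl[OF F(1)], of "-1" "\<lambda>_. 1" 0]
    by (simp add: parity_abs_L2 square_integrable_reflect cinner_abs_L2)
qed

lemma cinner_parity: "cinner (blinfun_apply parity f) g = cinner f (blinfun_apply parity g)"
  using isometry_cinner[OF complex_linear_parity norm_parity, of f "blinfun_apply parity g"] by simp

text \<open>The parities inside \<open>op_conv\<close> and inside the argument used by
  \<open>measure_conv\<close> cancel, so only shifted copies of the adjoint of \<open>S\<close>
  remain under the trace.\<close>

lemma op_check_adjoint_op_check: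
  assumes "complex_linear S"
  shows "op_check (op_adjoint (op_check S)) = op_adjoint S"
proof -
  have "op_adjoint (op_check S) = op_check (op_adjoint S)"
    by (rule op_adjoint_eqI) (simp add: op_check_def cinner_parity cinner_adjoint[OF assms])
  then show ?thesis by (intro blinfun_eqI) (simp add: op_check_def)
qed

text \<open>The matrix coefficient at \<open>x\<close> and \<open>y\<close> of \<open>S\<close>
  conjugated by the shift at \<open>z\<close>, with the outer shift moved onto \<open>y\<close> as
  its adjoint.\<close>

definition shifted_form ::
  "'d::finite operator \<Rightarrow> 'd L2 \<Rightarrow> 'd L2 \<Rightarrow> (real ^ 'd) \<times> (real ^ 'd) \<Rightarrow> complex" where
  "shifted_form S x y z = cinner (blinfun_apply S (blinfun_apply (op_adjoint (tf_shift z)) x))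
     (blinfun_apply (op_adjoint (tf_shift z)) y)"

lemma cmod_shifted_form_le: "cmod (shifted_form S x y z) \<le> norm S * norm x * norm y"
proof -
  let ?U = "blinfun_apply (op_adjoint (tf_shift z))"
  have U: "norm (?U f) \<le> norm f" for f
    by (intro norm_adjoint_isometry_le complex_linear_tf_shift norm_tf_shift)
  have "cmod (shifted_form S x y z) \<le> norm (blinfun_apply S (?U x)) * norm (?U y)"
    unfolding shifted_form_def by (rule cmod_cinner_le)
  also have "\<dots> \<le> (norm S * norm (?U x)) * norm (?U y)"
    by (intro mult_right_mono norm_blinfun) auto
  also have "\<dots> \<le> (norm S * norm x) * norm y" by (intro mult_mono U) auto
  finally show ?thesis .
qed

text \<open>Parseval over a countable basis writes the form as a sum of products of coefficients of
  single shifts, each measurable in \<open>z\<close>.\<close>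

lemma borel_measurable_shifted_form:
  assumes S: "complex_linear S"
  shows "shifted_form S x y \<in> borel_measurable borel"
proof -
  obtain E :: "'a L2 set" where E: "orthonormal_basis E" using orthonormal_basis_exists by blast
  then have "countable E" by (intro orthonormal_countable) (simp add: orthonormal_basis_def)
  then show ?thesis
  proof (rule borel_measurable_has_sum)
    fix b :: "'a L2" assume "b \<in> E"
    have "(\<lambda>z. cinner x (blinfun_apply (tf_shift z) (blinfun_apply (op_adjoint S) b)) *
        cnj (cinner y (blinfun_apply (tf_shift z) b))) \<in> borel_measurable borel"
      by (intro borel_measurable_times borel_measurable_cinner_tf_shift
          measurable_compose[OF borel_measurable_cinner_tf_shift borel_measurable_cnj])
    then show "(\<lambda>z. cinner x (blinfun_apply (tf_shift z) (blinfun_apply (op_adjoint S) b)) *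
        cnj (cinner y (blinfun_apply (tf_shift z) b))) \<in> borel_measurable borel" .
  next
    fix z :: "(real ^ 'a) \<times> (real ^ 'a)"
    let ?U = "blinfun_apply (op_adjoint (tf_shift z))"
    show "((\<lambda>b. cinner x (blinfun_apply (tf_shift z) (blinfun_apply (op_adjoint S) b)) *
        cnj (cinner y (blinfun_apply (tf_shift z) b))) has_sum shifted_form S x y z) E"
      using Parseval[OF E, of "blinfun_apply S (?U x)" "?U y"]
      by (simp add: shifted_form_def cinner_adjoint[OF S] cinner_adjoint[OF complex_linear_tf_shift, symmetric]
          cinner_adjoint'[OF complex_linear_tf_shift] flip: cinner_commute)
  qed
qed

section \<open>Pairings with trace class operators\<close>

lemma svd_weight_sum:
  assumes "singular_value_decomposition N s e g R" "(\<lambda>n. s n powr enn2real 1) summable_on N"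
  shows "s summable_on N"
proof -
  have "s n = s n powr enn2real 1" if "n \<in> N" for n
    using assms(1) that by (auto simp: singular_value_decomposition_def)
  then show ?thesis using assms(2) by (simp cong: summable_on_cong)
qed

text \<open>Inserting the decomposition of \<open>R\<close> presents the operator under the trace as
  a nuclear series. The conjugate is the one that \<open>measure_pairing\<close> puts on its
  integrand.\<close>

lemma op_conv_has_sum:
  assumes S: "complex_linear S" and svd: "singular_value_decomposition N s e g R"
    and s: "s summable_on N"
  shows "((\<lambda>n. complex_of_real (s n) * shifted_form S (e n) (g n) z) has_sum
    cnj (op_conv R (op_adjoint (op_check S)) z)) N"
proof -
  let ?V = "blinfun_apply (tf_shift z)" and ?U = "blinfun_apply (op_adjoint (tf_shift z))"
  have V: "complex_linear (tf_shift z)" by (rule complex_linear_tf_shift)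
  have e: "orthonormal_on N e" and g: "orthonormal_on N g" and pos: "\<And>n. n \<in> N \<Longrightarrow> 0 < s n"
    using svd by (auto simp: singular_value_decomposition_def)
  let ?T = "R o\<^sub>L tf_shift z o\<^sub>L op_check (op_adjoint (op_check S)) o\<^sub>L op_adjoint (tf_shift z)"
  have "((\<lambda>n. cinner (s n *\<^sub>R g n) (?V (blinfun_apply S (?U (e n))))) has_sum op_trace ?T) N"
  proof (rule nuclear_trace_has_sum)
    fix x y
    show "((\<lambda>n. cinner x (?V (blinfun_apply S (?U (e n)))) * cinner (s n *\<^sub>R g n) y) has_sum
        cinner (blinfun_apply ?T x) y) N"
      using svd_cinner_has_sum[OF svd, of "?V (blinfun_apply (op_adjoint S) (?U x))" y]
      by (simp add: op_check_adjoint_op_check[OF S] cinner_adjoint[OF V]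
          cinner_adjoint'[OF S, symmetric] cinner_adjoint'[OF V] cinner.scaleR_left
          scaleR_conv_of_real mult_ac)
  next
    have "norm (?V (blinfun_apply S (?U (e n)))) * norm (s n *\<^sub>R g n) \<le> norm S * s n" if n: "n \<in> N" for n
    proof -
      have "norm (blinfun_apply S (?U (e n))) \<le> norm S * norm (?U (e n))" by (rule norm_blinfun)
      also have "\<dots> \<le> norm S * 1"
        using norm_adjoint_isometry_le[OF V norm_tf_shift, of "e n"] orthonormal_norm[OF e n]
        by (intro mult_left_mono) auto
      finally show ?thesis
        using pos[OF n] orthonormal_norm[OF g n] by (simp add: mult_right_mono)
    qed
    then show "(\<lambda>n. norm (?V (blinfun_apply S (?U (e n)))) * norm (s n *\<^sub>R g n)) summable_on N"
      by (intro summable_on_comparison_test[OF summable_on_cmult_right[OF s]]) auto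
  qed
  then have "((\<lambda>n. cnj (cinner (s n *\<^sub>R g n) (?V (blinfun_apply S (?U (e n)))))) has_sum
      cnj (op_conv R (op_adjoint (op_check S)) z)) N"
    by (simp add: op_conv_def)
  also have "(\<lambda>n. cnj (cinner (s n *\<^sub>R g n) (?V (blinfun_apply S (?U (e n)))))) =
      (\<lambda>n. complex_of_real (s n) * shifted_form S (e n) (g n) z)"
    unfolding shifted_form_def cinner_commute[symmetric]
    by (simp add: cinner_adjoint[OF V] cinner.scaleR_right scaleR_conv_of_real blinfun.scaleR_right)
  finally show ?thesis .
qed

text \<open>Again a nuclear series, with the same weights and vectors as in
  \<open>op_conv_has_sum\<close>; this makes the two sides of the equation defining
  \<open>measure_conv\<close> comparable term by term.\<close>

lemma schatten_pairing_has_sum: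
  assumes A: "complex_linear A" and svd: "singular_value_decomposition N s e g R"
    and s: "s summable_on N"
  shows "((\<lambda>n. complex_of_real (s n) * cinner (blinfun_apply A (e n)) (g n)) has_sum
    schatten_pairing A R) N"
proof -
  have e: "orthonormal_on N e" and g: "orthonormal_on N g" and pos: "\<And>n. n \<in> N \<Longrightarrow> 0 < s n"
    using svd by (auto simp: singular_value_decomposition_def)
  have R: "complex_linear R" using svd by (rule svd_complex_linear)
  have "((\<lambda>n. cinner (s n *\<^sub>R blinfun_apply A (e n)) (g n)) has_sum op_trace (A o\<^sub>L op_adjoint R)) N"
  proof (rule nuclear_trace_has_sum)
    fix x y
    let ?y = "blinfun_apply (op_adjoint A) y"
    have "((\<lambda>n. cnj (complex_of_real (s n) * cinner ?y (e n) * cinner (g n) x)) has_sum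
        cnj (cinner (blinfun_apply R ?y) x)) N"
      using svd_cinner_has_sum[OF svd, of ?y x] by (simp only: has_sum_cnj_iff)
    also have "cnj (cinner (blinfun_apply R ?y) x) = cinner (blinfun_apply (A o\<^sub>L op_adjoint R) x) y"
      unfolding cinner_commute[symmetric]
      by (simp add: cinner_adjoint[OF A] cinner_adjoint'[OF R])
    also have "(\<lambda>n. cnj (complex_of_real (s n) * cinner ?y (e n) * cinner (g n) x)) =
        (\<lambda>n. cinner x (g n) * cinner (s n *\<^sub>R blinfun_apply A (e n)) y)"
      by (simp add: cinner_adjoint[OF A] cinner.scaleR_left scaleR_conv_of_real mult_ac
          flip: cinner_commute)
    finally show "((\<lambda>n. cinner x (g n) * cinner (s n *\<^sub>R blinfun_apply A (e n)) y) has_sum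
        cinner (blinfun_apply (A o\<^sub>L op_adjoint R) x) y) N" .
  next
    have "norm (g n) * norm (s n *\<^sub>R blinfun_apply A (e n)) \<le> norm A * s n" if n: "n \<in> N" for n
      using norm_blinfun[of A "e n"] pos[OF n] orthonormal_norm[OF g n] orthonormal_norm[OF e n]
      by (simp add: mult.commute mult_left_mono)
    then show "(\<lambda>n. norm (g n) * norm (s n *\<^sub>R blinfun_apply A (e n))) summable_on N"
      by (intro summable_on_comparison_test[OF summable_on_cmult_right[OF s]]) auto
  qed
  then show ?thesis
    by (simp add: schatten_pairing_def cinner.scaleR_left scaleR_conv_of_real)
qed

lemma schatten_class_1E:
  assumes "R \<in> schatten_class 1"
  obtains N s e g where "singular_value_decomposition N s e g R" "s summable_on N"
  using assms svd_weight_sum by (fastforce simp: schatten_class_def)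

lemma svd_rank_one:
  assumes "norm e = 1" "norm g = 1"
  shows "singular_value_decomposition {0} (\<lambda>_. 1) (\<lambda>_. e) (\<lambda>_. g) (rank_one g e)"
  using assms has_sum_finite[of "{0 :: nat}" "\<lambda>_. rank_one g e"]
  by (simp add: singular_value_decomposition_def orthonormal_on_def cinner_same)

text \<open>Pairing with rank-one operators recovers all matrix coefficients.\<close>

lemma schatten_pairing_eqD:
  assumes A: "complex_linear A" and A': "complex_linear A'"
    and eq: "\<And>R. R \<in> schatten_class 1 \<Longrightarrow> schatten_pairing A R = schatten_pairing A' R"
  shows "A = A'"
proof -
  have unit: "cinner (blinfun_apply A e) g = cinner (blinfun_apply A' e) g"
    if "norm e = 1" "norm g = 1" for e g
  proof -
    have "rank_one g e \<in> schatten_class 1"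
      unfolding schatten_class_def using svd_rank_one[OF that]
      by (auto intro!: exI[of _ "{0}"] exI[of _ "\<lambda>_. 1"])
    then have "schatten_pairing A (rank_one g e) = schatten_pairing A' (rank_one g e)" by (rule eq)
    moreover have "schatten_pairing C (rank_one g e) = cinner (blinfun_apply C e) g"
      if "complex_linear C" for C
      using schatten_pairing_has_sum[OF that svd_rank_one[OF \<open>norm e = 1\<close> \<open>norm g = 1\<close>]]
      by (simp add: has_sum_finite_iff)
    ultimately show ?thesis using A A' by simp
  qed
  have "cinner (blinfun_apply A x) y = cinner (blinfun_apply A' x) y" for x y
  proof (cases "x = 0 \<or> y = 0")
    case True
    then show ?thesis by (auto simp: blinfun.zero_right cinner.zero_left cinner.zero_right)
  next
    case False
    then show ?thesis using unit[of "(1 / norm x) *\<^sub>R x" "(1 / norm y) *\<^sub>R y"]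
      by (simp add: blinfun.scaleR_right cinner.scaleR_left cinner.scaleR_right)
  qed
  then show ?thesis by (intro blinfun_eqI cinner_eqI)
qed

text \<open>The averaged coefficients are a bounded sesquilinear form, hence come from an operator
  \<open>A\<close>. Termwise integration over the decomposition of a trace class \<open>R\<close>
  gives the defining pairing for \<open>A\<close>, and \<open>schatten_pairing_eqD\<close> makes
  \<open>A\<close> the only candidate.\<close>

lemma
  fixes \<mu> :: "((real ^ 'd) \<times> (real ^ 'd)) set \<Rightarrow> complex" and S :: "'d::finite operator"
  assumes \<mu>: "complex_measure \<mu>" and S: "complex_linear S"
  shows complex_linear_measure_conv: "complex_linear (measure_conv \<mu> S)"
    and norm_measure_conv_le: "norm (measure_conv \<mu> S) \<le> total_variation_norm \<mu> * norm S"
    and cinner_measure_conv: "cinner (blinfun_apply (measure_conv \<mu> S) x) y =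
      (\<integral>z. shifted_form S x y z * polar_density \<mu> z \<partial>total_variation \<mu>)"
proof -
  let ?M = "total_variation \<mu>" and ?h = "polar_density \<mu>"
  interpret finite_measure ?M by (rule finite_measure_total_variation) fact
  define B where "B x y = (\<integral>z. shifted_form S x y z * ?h z \<partial>?M)" for x y
  have meas: "(\<lambda>z. shifted_form S x y z * ?h z) \<in> borel_measurable ?M" for x y
    using borel_measurable_times[OF borel_measurable_shifted_form[OF S] borel_measurable_polar_density[OF \<mu>]]
    by (simp cong: measurable_cong_sets)
  have norm_le: "cmod (shifted_form S x y z * ?h z) \<le> norm S * norm x * norm y" for x y z
    using cmod_shifted_form_le[of S x y z] by (simp add: norm_mult norm_polar_density[OF \<mu>])
  have int: "integrable ?M (\<lambda>z. shifted_form S x y z * ?h z)" for x y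
    by (rule integrable_const_bound[OF AE_I2[OF norm_le] meas])
  have B_le: "cmod (B x y) \<le> (total_variation_norm \<mu> * norm S) * norm x * norm y" for x y
  proof -
    have "cmod (B x y) \<le> (\<integral>z. cmod (shifted_form S x y z * ?h z) \<partial>?M)"
      unfolding B_def by (rule integral_norm_bound)
    also have "\<dots> \<le> (\<integral>z. norm S * norm x * norm y \<partial>?M)"
      using int norm_le by (intro integral_mono) auto
    finally show ?thesis by (simp add: total_variation_norm_def mult_ac)
  qed
  have add: "B (x + y) z = B x z + B y z" "B x (y + z) = B x y + B x z" for x y z
    unfolding B_def Bochner_Integration.integral_add[OF int int, symmetric]
    by (simp_all add: shifted_form_def blinfun.add_right cinner_add_left cinner_add_right distrib_right)
  have adj: "blinfun_apply (op_adjoint (tf_shift z)) (c *\<^sub>C x) =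
      c *\<^sub>C blinfun_apply (op_adjoint (tf_shift z)) x" for c z and x :: "'d L2"
    using complex_linear_adjoint[OF complex_linear_tf_shift[of z]] by (simp add: complex_linear_def)
  have scale: "B (c *\<^sub>C x) y = c * B x y" "B x (c *\<^sub>C y) = cnj c * B x y" for c x y
    using S unfolding B_def complex_linear_def
    by (simp_all add: shifted_form_def adj cinner_scaleC_left cinner_scaleC_right mult.assoc)
  obtain A where A: "complex_linear A" "\<And>x y. cinner (blinfun_apply A x) y = B x y"
    "norm A \<le> total_variation_norm \<mu> * norm S"
  proof (rule sesquilinear_operator[OF add(1) scale(1) add(2) scale(2) B_le])
    show "0 \<le> total_variation_norm \<mu> * norm S" by (simp add: total_variation_norm_def)
  qed blast
  have pairing: "schatten_pairing A R = measure_pairing \<mu> (op_conv R (op_adjoint (op_check S)))"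
    if R: "R \<in> schatten_class 1" for R
  proof -
    obtain N s e g where svd: "singular_value_decomposition N s e g R" "s summable_on N"
      using R by (rule schatten_class_1E)
    have e: "orthonormal_on N e" and g: "orthonormal_on N g" and pos: "\<And>n. n \<in> N \<Longrightarrow> 0 < s n"
      using svd by (auto simp: singular_value_decomposition_def)
    let ?f = "\<lambda>n z. complex_of_real (s n) * (shifted_form S (e n) (g n) z * ?h z)"
    have "((\<lambda>n. \<integral>z. ?f n z \<partial>?M) has_sum
        (\<integral>z. cnj (op_conv R (op_adjoint (op_check S)) z) * ?h z \<partial>?M)) N"
    proof (rule has_sum_integral[OF finite_measure_axioms])
      show "?f n \<in> borel_measurable ?M" for n
        by (rule borel_measurable_times[OF borel_measurable_const meas])
      show "cmod (?f n z) \<le> norm S * s n" if n: "n \<in> N" for n z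
      proof -
        have "cmod (?f n z) = s n * cmod (shifted_form S (e n) (g n) z * ?h z)"
          unfolding norm_mult[of "complex_of_real (s n)"] using pos[OF n] by simp
        also have "\<dots> \<le> s n * norm S"
          using norm_le[of "e n" "g n" z] pos[OF n] orthonormal_norm[OF e n] orthonormal_norm[OF g n]
          by (intro mult_left_mono) auto
        finally show ?thesis by (simp add: mult.commute)
      qed
      show "((\<lambda>n. ?f n z) has_sum cnj (op_conv R (op_adjoint (op_check S)) z) * ?h z) N" for z
        using has_sum_cmult_left[OF op_conv_has_sum[OF S svd, of z], of "?h z"]
        by (simp add: mult.assoc)
    qed (rule summable_on_cmult_right[OF svd(2)])
    then have "((\<lambda>n. complex_of_real (s n) * cinner (blinfun_apply A (e n)) (g n)) has_sum
        measure_pairing \<mu> (op_conv R (op_adjoint (op_check S)))) N"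
      by (simp add: A(2) B_def measure_pairing_def complex_measure_integral_def)
    with schatten_pairing_has_sum[OF A(1) svd] show ?thesis by (rule has_sum_unique)
  qed
  have "measure_conv \<mu> S = A"
    unfolding measure_conv_def
  proof (rule the_equality)
    fix A' assume "A' \<in> schatten_class \<infinity> \<and> (\<forall>R\<in>schatten_class 1.
      schatten_pairing A' R = measure_pairing \<mu> (op_conv R (op_adjoint (op_check S))))"
    then show "A' = A" using A(1) pairing
      by (intro schatten_pairing_eqD) (auto simp: schatten_class_def)
  qed (use A(1) pairing in \<open>simp add: schatten_class_def\<close>)
  then show "complex_linear (measure_conv \<mu> S)"
    "norm (measure_conv \<mu> S) \<le> total_variation_norm \<mu> * norm S"
    "cinner (blinfun_apply (measure_conv \<mu> S) x) y =
      (\<integral>z. shifted_form S x y z * ?h z \<partial>?M)"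
    using A by (simp_all add: B_def)
qed

text \<open>The phase-space shifts preserve singular value decompositions, so the diagonal of every
  shifted copy of \<open>S\<close> obeys the bound for \<open>S\<close>, and Jensen's inequality averages these bounds.\<close>

lemma measure_conv_diagonal_le:
  fixes \<mu> :: "((real ^ 'd) \<times> (real ^ 'd)) set \<Rightarrow> complex" and S :: "'d::finite operator"
  assumes \<mu>: "complex_measure \<mu>" and q: "1 \<le> q"
    and svd: "singular_value_decomposition K t f h S" and t: "(\<lambda>k. t k powr q) summable_on K"
    and F: "finite F" "orthonormal_on F e" "orthonormal_on F g"
  shows "(\<Sum>n\<in>F. cmod (cinner (blinfun_apply (measure_conv \<mu> S) (e n)) (g n)) powr q) \<le>
    total_variation_norm \<mu> powr q * (\<Sum>\<^sub>\<infinity>k\<in>K. t k powr q)"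
proof -
  let ?M = "total_variation \<mu>" and ?T = "\<Sum>\<^sub>\<infinity>k\<in>K. t k powr q"
  interpret finite_measure ?M by (rule finite_measure_total_variation) fact
  have S: "complex_linear S" using svd by (rule svd_complex_linear)
  let ?m = "measure ?M (space ?M)"
  let ?\<phi> = "\<lambda>n z. cmod (shifted_form S (e n) (g n) z)"
  have meas: "?\<phi> n \<in> borel_measurable ?M" for n
    using measurable_compose[OF borel_measurable_shifted_form[OF S] borel_measurable_norm]
    by (simp cong: measurable_cong_sets)
  have \<phi>_le: "?\<phi> n z \<le> norm S * norm (e n) * norm (g n)" for n z by (rule cmod_shifted_form_le)
  have int: "integrable ?M (\<lambda>z. ?\<phi> n z powr q)" for n
    using \<phi>_le q meas
    by (intro integrable_const_bound[of _ "(norm S * norm (e n) * norm (g n)) powr q"])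
      (auto intro!: AE_I2 powr_mono2)
  have diag: "(\<Sum>n\<in>F. ?\<phi> n z powr q) \<le> ?T" for z
  proof (rule sum_powr_diagonal_le[OF q])
    let ?V = "blinfun_apply (tf_shift z)"
    \<comment> \<open>The shift is absorbed into the singular vectors, which stay orthonormal; the
      singular values \<open>t\<close> do not depend on \<open>z\<close>, so the bound is
      uniform.\<close>
    show "orthonormal_on K (\<lambda>k. ?V (f k))" "orthonormal_on K (\<lambda>k. ?V (h k))"
      using svd by (auto simp: singular_value_decomposition_def
        intro!: orthonormal_on_isometry complex_linear_tf_shift)
    show "((\<lambda>k. complex_of_real (t k) * cinner (e n) (?V (f k)) * cinner (?V (h k)) (g n)) has_sum
        shifted_form S (e n) (g n) z) K" for n
      using svd_cinner_has_sum[OF svd, of "blinfun_apply (op_adjoint (tf_shift z)) (e n)"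
          "blinfun_apply (op_adjoint (tf_shift z)) (g n)"]
      by (simp add: shifted_form_def cinner_adjoint[OF complex_linear_tf_shift]
          cinner_adjoint'[OF complex_linear_tf_shift])
  qed (use svd t F in \<open>auto simp: singular_value_decomposition_def less_imp_le\<close>)
  have "cmod (cinner (blinfun_apply (measure_conv \<mu> S) (e n)) (g n)) powr q \<le>
      ?m powr (q - 1) * (\<integral>z. ?\<phi> n z powr q \<partial>?M)" for n
  proof -
    have "cmod (cinner (blinfun_apply (measure_conv \<mu> S) (e n)) (g n)) \<le>
        (\<integral>z. cmod (shifted_form S (e n) (g n) z * polar_density \<mu> z) \<partial>?M)"
      unfolding cinner_measure_conv[OF \<mu> S] by (rule integral_norm_bound)
    also have "\<dots> = (\<integral>z. ?\<phi> n z \<partial>?M)" by (simp add: norm_mult norm_polar_density[OF \<mu>])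
    finally have "cmod (cinner (blinfun_apply (measure_conv \<mu> S) (e n)) (g n)) powr q \<le>
        (\<integral>z. ?\<phi> n z \<partial>?M) powr q"
      using q by (intro powr_mono2) auto
    also have "\<dots> \<le> ?m powr (q - 1) * (\<integral>z. ?\<phi> n z powr q \<partial>?M)"
      using finite_measure_axioms q meas norm_ge_zero \<phi>_le by (rule integral_powr_le)
    finally show ?thesis .
  qed
  then have "(\<Sum>n\<in>F. cmod (cinner (blinfun_apply (measure_conv \<mu> S) (e n)) (g n)) powr q) \<le>
      (\<Sum>n\<in>F. ?m powr (q - 1) * (\<integral>z. ?\<phi> n z powr q \<partial>?M))"
    by (intro sum_mono)
  also have "\<dots> = ?m powr (q - 1) * (\<integral>z. (\<Sum>n\<in>F. ?\<phi> n z powr q) \<partial>?M)"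
    using int by (simp add: sum_distrib_left Bochner_Integration.integral_sum)
  also have "\<dots> \<le> ?m powr (q - 1) * (\<integral>z. ?T \<partial>?M)"
    using int diag by (intro mult_left_mono integral_mono) auto
  \<comment> \<open>One factor of the mass comes from integrating the constant \<open>?T\<close>,
    the remaining power from Jensen's inequality.\<close>
  also have "\<dots> = (?m * ?m powr (q - 1)) * ?T" by simp
  also have "?m * ?m powr (q - 1) = total_variation_norm \<mu> powr q"
    using powr_mult_base[of ?m "q - 1"] by (simp add: total_variation_norm_def)
  finally show ?thesis .
qed

theorem proposition3p4:
  fixes \<mu> :: "((real ^ 'd) \<times> (real ^ 'd)) set \<Rightarrow> complex"
    and S :: "'d::finite operator"
    and p :: ennreal
  assumes "complex_measure \<mu>" and "1 \<le> p" and "S \<in> schatten_class p"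
  shows "measure_conv \<mu> S \<in> schatten_class p \<and>
         schatten_norm p (measure_conv \<mu> S) \<le> total_variation_norm \<mu> * schatten_norm p S"
proof (cases "p = \<infinity>")
  case True
  then show ?thesis
    using assms complex_linear_measure_conv[of \<mu> S] norm_measure_conv_le[of \<mu> S]
    by (simp add: schatten_class_def schatten_norm_def)
next
  case False
  let ?q = "enn2real p" and ?A = "measure_conv \<mu> S" and ?m = "total_variation_norm \<mu>"
  have q: "1 \<le> ?q"
    using assms(2) False by (metis enn2real_1 enn2real_mono infinity_ennreal_def top.not_eq_extremum)
  obtain K t f h where svd: "singular_value_decomposition K t f h S" "(\<lambda>k. t k powr ?q) summable_on K"
    using assms(3) False by (auto simp: schatten_class_def)
  let ?T = "\<Sum>\<^sub>\<infinity>k\<in>K. t k powr ?q"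
  have S: "complex_linear S" using svd(1) by (rule svd_complex_linear)
  have m: "0 \<le> ?m" and T: "0 \<le> ?T" by (simp_all add: total_variation_norm_def infsum_nonneg)
  \<comment> \<open>The constant \<open>C\<close> of the diagonal hypothesis is here
    \<open>?m powr ?q * ?T\<close>, whose root of order \<open>?q\<close> is the claimed right-hand
    side.\<close>
  obtain N s e g where A: "singular_value_decomposition N s e g ?A" "(\<lambda>n. s n powr ?q) summable_on N"
    "(\<Sum>\<^sub>\<infinity>n\<in>N. s n powr ?q) \<le> ?m powr ?q * ?T"
    using svd_exists[OF complex_linear_measure_conv[OF assms(1) S] q
        measure_conv_diagonal_le[OF assms(1) q svd]] .
  have "schatten_norm p ?A = (\<Sum>\<^sub>\<infinity>n\<in>N. s n powr ?q) powr (1 / ?q)"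
    by (rule schatten_norm_svd[OF assms(2) False A(1,2)])
  also have "\<dots> \<le> (?m powr ?q * ?T) powr (1 / ?q)"
    using A(3) q by (intro powr_mono2 infsum_nonneg) auto
  also have "\<dots> = ?m * ?T powr (1 / ?q)" using q m by (simp add: powr_mult powr_powr)
  also have "\<dots> = ?m * schatten_norm p S"
    by (simp add: schatten_norm_svd[OF assms(2) False svd])
  finally have "schatten_norm p ?A \<le> ?m * schatten_norm p S" .
  moreover have "?A \<in> schatten_class p" using False A by (auto simp: schatten_class_def)
  ultimately show ?thesis by simp
qed

end
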